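(* Let $\mathbb{K}$ be a field of characteristic $0$, let $\mathfrak{L}$ be a finite-dimensional Lie-Yamaguti algebra over $\mathbb{K}$ with basis $\{e_1,\dots,e_n\}$, and let $G(\mathcal{A}(\mathfrak{L})^\circ)^{inv}$ be the group of all invertible group-like elements of the finite dual $\mathcal{A}(\mathfrak{L})^\circ$. Then the map $$\zeta:G(\mathcal{A}(\mathfrak{L})^\circ)^{inv}\to\operatorname{Aut}_{\operatorname{LYA}}(\mathfrak{L}),\qquad\zeta(\theta)(e_i):=\sum_{s=1}^n\theta(x_{si})e_s,$$ for any $\theta\in G(\mathcal{A}(\mathfrak{L})^\circ)^{inv}$ and $i=1,2,\dots,n$, is an isomorphism of groups.
   Context: All vector spaces and (multi)linear maps are over a fixed field $\mathbb{K}$ of characteristic $0$; algebras are unital and associative, coalgebras are counital and coassociative. A Lie-Yamaguti algebra is a triple $(\mathfrak{L},[\cdot,\cdot],\{\cdot,\cdot,\cdot\})$ with $\mathfrak{L}$ a $\mathbb{K}$-vector space, $[\cdot,\cdot]$ bilinear and $\{\cdot,\cdot,\cdot\}$ trilinear (both with values in $\mathfrak{L}$) such that for all $a,b,c,d,e\in\mathfrak{L}$: (LY1) $[a,b]=-[b,a]$; (LY2) $\{a,b,c\}=-\{b,a,c\}$; (LY3) $[[a,b],c]+\{a,b,c\}+[[b,c],a]+\{b,c,a\}+[[c,a],b]+\{c,a,b\}=0$; (LY4) $\{[a,b],c,d\}+\{[b,c],a,d\}+\{[c,a],b,d\}=0$; (LY5) $\{a,b,[c,d]\}=[\{a,b,c\},d]+[c,\{a,b,d\}]$;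 (LY6) $\{a,b,\{c,d,e\}\}=\{\{a,b,c\},d,e\}+\{c,\{a,b,d\},e\}+\{c,d,\{a,b,e\}\}$. $\operatorname{Aut}_{\operatorname{LYA}}(\mathfrak{L})$ is the group, under composition, of bijective linear maps $\mathfrak{L}\to\mathfrak{L}$ preserving both brackets. Universal algebra of $\mathfrak{L}$: let $[e_i,e_j]=\sum_{s=1}^n\tau_{ij}^s e_s$ and $\{e_i,e_j,e_k\}=\sum_{s=1}^n\omega_{ijk}^s e_s$. Then $\mathcal{A}(\mathfrak{L}):=\mathbb{K}[X_{si}:s,i=1,\dots,n]/J$, where $J$ is the ideal generated by all polynomials $\sum_{u=1}^n\tau_{ij}^u X_{au}-\sum_{s,t=1}^n\tau_{st}^a X_{si}X_{tj}$ and $\sum_{u=1}^n\omega_{ijk}^u X_{au}-\sum_{r,s,t=1}^n\omega_{rst}^a X_{ri}X_{sj}X_{tk}$, for $a,i,j,k=1,\dots,n$; $x_{si}$ denotes the class of $X_{si}$. $\mathcal{A}(\mathfrak{L})$ is a commutative bialgebra with $\Delta(x_{ij})=\sum_{s=1}^n x_{is}\otimes x_{sj}$ and $\varepsilon(x_{ij})=\delta_{ij}$. For a bialgebra $B$, $G(B)=\{g\in B:\Delta(g)=g\otimes g,\ \varepsilon(g)=1\}$ is the monoid of group-like elements under the multiplication of $B$, and $B^\circ=\{f\in\operatorname{Hom}(B,\mathbb{K}):f(I)=0\text{ for some ideal }I\text{ of }B\text{ with }\dim_{\mathbb{K}}(B/I)<\infty\}$ is the finite dual bialgebra, whose multiplication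 is the convolution product $(f\star g)(b)=\sum f(b_{(1)})g(b_{(2)})$ with unit $\varepsilon$. One has $G(B^\circ)=\operatorname{Hom}_{\operatorname{Alg}_{\mathbb{K}}}(B,\mathbb{K})$, the set of algebra morphisms $B\to\mathbb{K}$. $G(B^\circ)^{inv}$ is the group of invertible elements of the monoid $G(B^\circ)$. *)

theory Defs
  imports Complex_Main "HOL-Algebra.QuotRing" "HOL-Algebra.Module" "HOL-Library.Poly_Mapping"
begin

section \<open>Lie-Yamaguti algebras\<close>

locale lie_yamaguti_algebra = vector_space scale
  for scale :: "'k::field \<Rightarrow> 'v::ab_group_add \<Rightarrow> 'v" +
  fixes br :: "'v \<Rightarrow> 'v \<Rightarrow> 'v" and tr :: "'v \<Rightarrow> 'v \<Rightarrow> 'v \<Rightarrow> 'v"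
  assumes br_linear1: "Vector_Spaces.linear scale scale (\<lambda>a. br a b)"
    and br_linear2: "Vector_Spaces.linear scale scale (\<lambda>b. br a b)"
    and tr_linear1: "Vector_Spaces.linear scale scale (\<lambda>a. tr a b c)"
    and tr_linear2: "Vector_Spaces.linear scale scale (\<lambda>b. tr a b c)"
    and tr_linear3: "Vector_Spaces.linear scale scale (\<lambda>c. tr a b c)"
    and LY1: "br a b = - br b a"
    and LY2: "tr a b c = - tr b a c"
    and LY3: "br (br a b) c + tr a b c + br (br b c) a + tr b c a + br (br c a) b + tr c a b = 0"
    and LY4: "tr (br a b) c d + tr (br b c) a d + tr (br c a) b d = 0"
    and LY5: "tr a b (br c d) = br (tr a b c) d + br c (tr a b d)"
    and LY6: "tr a b (tr c d e) = tr (tr a b c) d e + tr c (tr a b d) e + tr c d (tr a b e)"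

definition Aut_LYA ::
  "('k::field \<Rightarrow> 'v::ab_group_add \<Rightarrow> 'v) \<Rightarrow> ('v \<Rightarrow> 'v \<Rightarrow> 'v) \<Rightarrow> ('v \<Rightarrow> 'v \<Rightarrow> 'v \<Rightarrow> 'v) \<Rightarrow> ('v \<Rightarrow> 'v) monoid"
  where "Aut_LYA scale br tr =
    \<lparr>carrier = {f. Vector_Spaces.linear scale scale f \<and> bij f \<and>
        (\<forall>a b. f (br a b) = br (f a) (f b)) \<and>
        (\<forall>a b c. f (tr a b c) = tr (f a) (f b) (f c))},
     monoid.mult = (\<circ>), one = id\<rparr>"


section \<open>Algebras over a field\<close>

text \<open>The scalars form a type \<open>'k\<close>. A unital associative \<open>'k\<close>-algebra is given by a record of
  type \<open>('k, 'a) module\<close>, which has the ring operations as well as a scalar multiplication.\<close>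

definition ground_algebra :: "('k::field, 'k) module"
  where "ground_algebra =
    \<lparr>carrier = UNIV, monoid.mult = (*), one = 1, ring.zero = 0, add = (+), smult = (*)\<rparr>"

definition quotient_algebra :: "('k, 'a, 'm) module_scheme \<Rightarrow> 'a set \<Rightarrow> ('k, 'a set) module"
  where "quotient_algebra A I =
    \<lparr>carrier = carrier (A Quot I), monoid.mult = monoid.mult (A Quot I), one = one (A Quot I),
     ring.zero = ring.zero (A Quot I), add = add (A Quot I),
     smult = (\<lambda>c C. \<Union>x\<in>C. I +>\<^bsub>A\<^esub> (c \<odot>\<^bsub>A\<^esub> x))\<rparr>"

definition alg_hom ::
  "('k, 'a, 'm) module_scheme \<Rightarrow> ('k, 'b, 'n) module_scheme \<Rightarrow> ('a \<Rightarrow> 'b) set"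
  where "alg_hom A B =
    {h \<in> ring_hom A B. \<forall>c. \<forall>x\<in>carrier A. h (c \<odot>\<^bsub>A\<^esub> x) = c \<odot>\<^bsub>B\<^esub> h x}"

text \<open>The functional is required to be \<open>0\<close> outside of the carrier, so that two functionals
  are equal iff they agree on the carrier.\<close>

definition linear_functionals :: "('k::field, 'a, 'm) module_scheme \<Rightarrow> ('a \<Rightarrow> 'k) set"
  where "linear_functionals A =
    {f. (\<forall>x\<in>carrier A. \<forall>y\<in>carrier A. f (x \<oplus>\<^bsub>A\<^esub> y) = f x + f y) \<and>
        (\<forall>c. \<forall>x\<in>carrier A. f (c \<odot>\<^bsub>A\<^esub> x) = c * f x) \<and>
        (\<forall>x. x \<notin> carrier A \<longrightarrow> f x = 0)}"

text \<open>Existence of a finite basis.\<close>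

definition finite_dim :: "('k::field, 'a, 'm) module_scheme \<Rightarrow> bool"
  where "finite_dim A \<longleftrightarrow>
    (\<exists>S. finite S \<and> S \<subseteq> carrier A \<and>
      (\<forall>x\<in>carrier A. \<exists>!c. c \<in> S \<rightarrow>\<^sub>E UNIV \<and> x = (\<Oplus>\<^bsub>A\<^esub>s\<in>S. c s \<odot>\<^bsub>A\<^esub> s)))"


section \<open>Tensor products\<close>

text \<open>The tensor product of \<open>A\<close> and \<open>B\<close> is the free vector space on the set
  \<open>carrier A \<times> carrier B\<close> modulo the bilinearity relations. The multiplication
  \<open>(a, b) (a', b') = (a a', b b')\<close> on the free vector space induces the usual one on the
  quotient, as the span of the relations is an ideal.\<close>

definition free_scale :: "'k::field \<Rightarrow> ('i \<Rightarrow>\<^sub>0 'k) \<Rightarrow> ('i \<Rightarrow>\<^sub>0 'k)"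
  where "free_scale c = Poly_Mapping.map ((*) c)"

definition free_algebra ::
  "('k::field, 'a, 'm) module_scheme \<Rightarrow> ('k, 'b, 'n) module_scheme \<Rightarrow> ('k, ('a \<times> 'b) \<Rightarrow>\<^sub>0 'k) module"
  where "free_algebra A B =
    \<lparr>carrier = {p. Poly_Mapping.keys p \<subseteq> carrier A \<times> carrier B},
     monoid.mult = (\<lambda>p q. \<Sum>(a, b)\<in>Poly_Mapping.keys p. \<Sum>(a', b')\<in>Poly_Mapping.keys q.
        Poly_Mapping.single (a \<otimes>\<^bsub>A\<^esub> a', b \<otimes>\<^bsub>B\<^esub> b')
          (Poly_Mapping.lookup p (a, b) * Poly_Mapping.lookup q (a', b'))),
     one = Poly_Mapping.single (\<one>\<^bsub>A\<^esub>, \<one>\<^bsub>B\<^esub>) 1,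
     ring.zero = 0, add = (+), smult = free_scale\<rparr>"

definition tensor_relations ::
  "('k::field, 'a, 'm) module_scheme \<Rightarrow> ('k, 'b, 'n) module_scheme \<Rightarrow> (('a \<times> 'b) \<Rightarrow>\<^sub>0 'k) set"
  where "tensor_relations A B = Modules.module.span free_scale
    ({Poly_Mapping.single (x \<oplus>\<^bsub>A\<^esub> x', y) 1 - Poly_Mapping.single (x, y) 1 - Poly_Mapping.single (x', y) 1
        | x x' y. x \<in> carrier A \<and> x' \<in> carrier A \<and> y \<in> carrier B} \<union>
     {Poly_Mapping.single (x, y \<oplus>\<^bsub>B\<^esub> y') 1 - Poly_Mapping.single (x, y) 1 - Poly_Mapping.single (x, y') 1
        | x y y'. x \<in> carrier A \<and> y \<in> carrier B \<and> y' \<in> carrier B} \<union>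
     {Poly_Mapping.single (c \<odot>\<^bsub>A\<^esub> x, y) 1 - Poly_Mapping.single (x, y) c
        | c x y. x \<in> carrier A \<and> y \<in> carrier B} \<union>
     {Poly_Mapping.single (x, c \<odot>\<^bsub>B\<^esub> y) 1 - Poly_Mapping.single (x, y) c
        | c x y. x \<in> carrier A \<and> y \<in> carrier B})"

definition tensor_algebra ::
  "('k::field, 'a, 'm) module_scheme \<Rightarrow> ('k, 'b, 'n) module_scheme \<Rightarrow> ('k, (('a \<times> 'b) \<Rightarrow>\<^sub>0 'k) set) module"
  where "tensor_algebra A B = quotient_algebra (free_algebra A B) (tensor_relations A B)"

definition tensor ::
  "('k::field, 'a, 'm) module_scheme \<Rightarrow> ('k, 'b, 'n) module_scheme \<Rightarrow> 'a \<Rightarrow> 'b \<Rightarrow> (('a \<times> 'b) \<Rightarrow>\<^sub>0 'k) set"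
  where "tensor A B a b =
    tensor_relations A B +>\<^bsub>free_algebra A B\<^esub> Poly_Mapping.single (a, b) 1"

text \<open>The linear functional \<open>f \<otimes> g\<close>, determined by \<open>(f \<otimes> g) (a \<otimes> b) = f a * g b\<close>. For linear \<open>f\<close>
  and \<open>g\<close>, the value \<open>v\<close> does not depend on the representative \<open>p\<close> of the class \<open>t\<close>.\<close>

definition tensor_functional :: "('a \<Rightarrow> 'k::field) \<Rightarrow> ('b \<Rightarrow> 'k) \<Rightarrow> (('a \<times> 'b) \<Rightarrow>\<^sub>0 'k) set \<Rightarrow> 'k"
  where "tensor_functional f g t =
    (THE v. \<exists>p\<in>t. v = (\<Sum>(a, b)\<in>Poly_Mapping.keys p. Poly_Mapping.lookup p (a, b) * f a * g b))"


section \<open>Bialgebras, finite duals and group-like elements\<close>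

record (overloaded) ('k::zero, 'a) bialgebra = "('k, 'a) module" +
  comult :: "'a \<Rightarrow> (('a \<times> 'a) \<Rightarrow>\<^sub>0 'k) set"
  counit :: "'a \<Rightarrow> 'k"

definition convolution ::
  "('k::field, 'a, 'm) bialgebra_scheme \<Rightarrow> ('a \<Rightarrow> 'k) \<Rightarrow> ('a \<Rightarrow> 'k) \<Rightarrow> 'a \<Rightarrow> 'k"
  where "convolution B f g =
    (\<lambda>b. if b \<in> carrier B then tensor_functional f g (comult B b) else 0)"

definition finite_dual_algebra ::
  "('k::field, 'a, 'm) bialgebra_scheme \<Rightarrow> ('k, 'a \<Rightarrow> 'k) module"
  where "finite_dual_algebra B =
    \<lparr>carrier = {f \<in> linear_functionals B.
        \<exists>I. ideal I B \<and> finite_dim (quotient_algebra B I) \<and> (\<forall>x\<in>I. f x = 0)},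
     monoid.mult = convolution B,
     one = (\<lambda>b. if b \<in> carrier B then counit B b else 0),
     ring.zero = (\<lambda>b. 0),
     add = (\<lambda>f g b. f b + g b),
     smult = (\<lambda>c f b. c * f b)\<rparr>"

text \<open>The comultiplication of the finite dual is dual to the multiplication of \<open>B\<close>: it sends \<open>f\<close> to
  the unique \<open>t = \<Sum>i. g\<^sub>i \<otimes> h\<^sub>i\<close> such that \<open>f (a b) = \<Sum>i. g\<^sub>i a * h\<^sub>i b\<close> for all \<open>a\<close> and \<open>b\<close>. The
  right-hand side arises by applying to \<open>t\<close> the tensor product of the functionals
  \<open>evaluation at a\<close> and \<open>evaluation at b\<close>.\<close>

definition finite_dual_comult ::
  "('k::field, 'a, 'm) bialgebra_scheme \<Rightarrow> ('a \<Rightarrow> 'k) \<Rightarrow> ((('a \<Rightarrow> 'k) \<times> ('a \<Rightarrow> 'k)) \<Rightarrow>\<^sub>0 'k) set"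
  where "finite_dual_comult B f =
    (THE t. t \<in> carrier (tensor_algebra (finite_dual_algebra B) (finite_dual_algebra B)) \<and>
      (\<forall>a\<in>carrier B. \<forall>b\<in>carrier B.
        tensor_functional (\<lambda>g. g a) (\<lambda>h. h b) t = f (a \<otimes>\<^bsub>B\<^esub> b)))"

definition finite_dual ::
  "('k::field, 'a, 'm) bialgebra_scheme \<Rightarrow> ('k, 'a \<Rightarrow> 'k) bialgebra"
  where "finite_dual B = module.extend (finite_dual_algebra B)
    \<lparr>comult = finite_dual_comult B, counit = (\<lambda>f. f \<one>\<^bsub>B\<^esub>)\<rparr>"

definition grouplikes :: "('k::field, 'a, 'm) bialgebra_scheme \<Rightarrow> 'a monoid"
  where "grouplikes B =
    \<lparr>carrier = {g \<in> carrier B. comult B g = tensor B B g g \<and> counit B g = 1},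
     monoid.mult = monoid.mult B, one = \<one>\<^bsub>B\<^esub>\<rparr>"


section \<open>The universal algebra of a Lie-Yamaguti algebra\<close>

text \<open>The basis is \<open>e 1, \<dots>, e n\<close>. The following are the structure constants
  \<open>\<tau>\<^sub>i\<^sub>j\<^sup>s\<close> and \<open>\<omega>\<^sub>i\<^sub>j\<^sub>k\<^sup>s\<close>.\<close>

definition br_coeff ::
  "('k::field \<Rightarrow> 'v::ab_group_add \<Rightarrow> 'v) \<Rightarrow> ('v \<Rightarrow> 'v \<Rightarrow> 'v) \<Rightarrow> nat \<Rightarrow> (nat \<Rightarrow> 'v) \<Rightarrow> nat \<Rightarrow> nat \<Rightarrow> nat \<Rightarrow> 'k"
  where "br_coeff scale br n e i j s =
    Modules.module.representation scale (e ` {1..n}) (br (e i) (e j)) (e s)"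

definition tr_coeff ::
  "('k::field \<Rightarrow> 'v::ab_group_add \<Rightarrow> 'v) \<Rightarrow> ('v \<Rightarrow> 'v \<Rightarrow> 'v \<Rightarrow> 'v) \<Rightarrow> nat \<Rightarrow> (nat \<Rightarrow> 'v) \<Rightarrow>
    nat \<Rightarrow> nat \<Rightarrow> nat \<Rightarrow> nat \<Rightarrow> 'k"
  where "tr_coeff scale tr n e i j k s =
    Modules.module.representation scale (e ` {1..n}) (tr (e i) (e j) (e k)) (e s)"

text \<open>Polynomials in variables indexed by pairs of natural numbers, as elements of the monoid
  algebra of the monomials \<open>(nat \<times> nat) \<Rightarrow>\<^sub>0 nat\<close>.\<close>

type_synonym 'k poly2 = "((nat \<times> nat) \<Rightarrow>\<^sub>0 nat) \<Rightarrow>\<^sub>0 'k"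

definition pvar :: "nat \<Rightarrow> nat \<Rightarrow> 'k::field poly2"
  where "pvar s i = Poly_Mapping.single (Poly_Mapping.single (s, i) 1) 1"

definition pconst :: "'k \<Rightarrow> 'k::field poly2"
  where "pconst c = Poly_Mapping.single 0 c"

definition poly_algebra :: "nat \<Rightarrow> ('k::field, 'k poly2) module"
  where "poly_algebra n =
    \<lparr>carrier = {p. \<forall>m\<in>Poly_Mapping.keys p. Poly_Mapping.keys m \<subseteq> {1..n} \<times> {1..n}},
     monoid.mult = (*), one = 1, ring.zero = 0, add = (+), smult = (\<lambda>c p. pconst c * p)\<rparr>"

definition univ_ideal ::
  "('k::field \<Rightarrow> 'v::ab_group_add \<Rightarrow> 'v) \<Rightarrow> ('v \<Rightarrow> 'v \<Rightarrow> 'v) \<Rightarrow> ('v \<Rightarrow> 'v \<Rightarrow> 'v \<Rightarrow> 'v) \<Rightarrow>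
    nat \<Rightarrow> (nat \<Rightarrow> 'v) \<Rightarrow> 'k poly2 set"
  where "univ_ideal scale br tr n e = Idl\<^bsub>poly_algebra n\<^esub>
    ({(\<Sum>u=1..n. pconst (br_coeff scale br n e i j u) * pvar a u) -
      (\<Sum>s=1..n. \<Sum>t=1..n. pconst (br_coeff scale br n e s t a) * pvar s i * pvar t j)
        | a i j. a \<in> {1..n} \<and> i \<in> {1..n} \<and> j \<in> {1..n}} \<union>
     {(\<Sum>u=1..n. pconst (tr_coeff scale tr n e i j k u) * pvar a u) -
      (\<Sum>r=1..n. \<Sum>s=1..n. \<Sum>t=1..n.
        pconst (tr_coeff scale tr n e r s t a) * pvar r i * pvar s j * pvar t k)
        | a i j k. a \<in> {1..n} \<and> i \<in> {1..n} \<and> j \<in> {1..n} \<and> k \<in> {1..n}})"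

definition univ_algebra ::
  "('k::field \<Rightarrow> 'v::ab_group_add \<Rightarrow> 'v) \<Rightarrow> ('v \<Rightarrow> 'v \<Rightarrow> 'v) \<Rightarrow> ('v \<Rightarrow> 'v \<Rightarrow> 'v \<Rightarrow> 'v) \<Rightarrow>
    nat \<Rightarrow> (nat \<Rightarrow> 'v) \<Rightarrow> ('k, 'k poly2 set) module"
  where "univ_algebra scale br tr n e =
    quotient_algebra (poly_algebra n) (univ_ideal scale br tr n e)"

definition univ_gen ::
  "('k::field \<Rightarrow> 'v::ab_group_add \<Rightarrow> 'v) \<Rightarrow> ('v \<Rightarrow> 'v \<Rightarrow> 'v) \<Rightarrow> ('v \<Rightarrow> 'v \<Rightarrow> 'v \<Rightarrow> 'v) \<Rightarrow>
    nat \<Rightarrow> (nat \<Rightarrow> 'v) \<Rightarrow> nat \<Rightarrow> nat \<Rightarrow> 'k poly2 set"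
  where "univ_gen scale br tr n e s i =
    univ_ideal scale br tr n e +>\<^bsub>poly_algebra n\<^esub> pvar s i"

text \<open>Comultiplication and counit are the unique algebra morphisms with the prescribed values
  on the generators. The conditions \<^const>\<open>extensional\<close> and \<^const>\<open>linear_functionals\<close> only fix
  the values outside of the carrier.\<close>

definition univ_comult ::
  "('k::field \<Rightarrow> 'v::ab_group_add \<Rightarrow> 'v) \<Rightarrow> ('v \<Rightarrow> 'v \<Rightarrow> 'v) \<Rightarrow> ('v \<Rightarrow> 'v \<Rightarrow> 'v \<Rightarrow> 'v) \<Rightarrow>
    nat \<Rightarrow> (nat \<Rightarrow> 'v) \<Rightarrow> 'k poly2 set \<Rightarrow> (('k poly2 set \<times> 'k poly2 set) \<Rightarrow>\<^sub>0 'k) set"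
  where "univ_comult scale br tr n e =
    (let A = univ_algebra scale br tr n e; x = univ_gen scale br tr n e in
      THE D. D \<in> alg_hom A (tensor_algebra A A) \<and> D \<in> extensional (carrier A) \<and>
        (\<forall>i\<in>{1..n}. \<forall>j\<in>{1..n}.
          D (x i j) = (\<Oplus>\<^bsub>tensor_algebra A A\<^esub>s\<in>{1..n}. tensor A A (x i s) (x s j))))"

definition univ_counit ::
  "('k::field \<Rightarrow> 'v::ab_group_add \<Rightarrow> 'v) \<Rightarrow> ('v \<Rightarrow> 'v \<Rightarrow> 'v) \<Rightarrow> ('v \<Rightarrow> 'v \<Rightarrow> 'v \<Rightarrow> 'v) \<Rightarrow>
    nat \<Rightarrow> (nat \<Rightarrow> 'v) \<Rightarrow> 'k poly2 set \<Rightarrow> 'k"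
  where "univ_counit scale br tr n e =
    (let A = univ_algebra scale br tr n e; x = univ_gen scale br tr n e in
      THE \<epsilon>. \<epsilon> \<in> alg_hom A ground_algebra \<and> \<epsilon> \<in> linear_functionals A \<and>
        (\<forall>i\<in>{1..n}. \<forall>j\<in>{1..n}. \<epsilon> (x i j) = (if i = j then 1 else 0)))"

definition univ_bialgebra ::
  "('k::field \<Rightarrow> 'v::ab_group_add \<Rightarrow> 'v) \<Rightarrow> ('v \<Rightarrow> 'v \<Rightarrow> 'v) \<Rightarrow> ('v \<Rightarrow> 'v \<Rightarrow> 'v \<Rightarrow> 'v) \<Rightarrow>
    nat \<Rightarrow> (nat \<Rightarrow> 'v) \<Rightarrow> ('k, 'k poly2 set) bialgebra"
  where "univ_bialgebra scale br tr n e = module.extend (univ_algebra scale br tr n e)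
    \<lparr>comult = univ_comult scale br tr n e, counit = univ_counit scale br tr n e\<rparr>"

text \<open>\<open>zeta \<dots> \<theta>\<close> is the linear map with \<open>e\<^sub>i \<mapsto> \<Sum>s. \<theta> (x\<^sub>s\<^sub>i) e\<^sub>s\<close>.\<close>

definition zeta ::
  "('k::field \<Rightarrow> 'v::ab_group_add \<Rightarrow> 'v) \<Rightarrow> ('v \<Rightarrow> 'v \<Rightarrow> 'v) \<Rightarrow> ('v \<Rightarrow> 'v \<Rightarrow> 'v \<Rightarrow> 'v) \<Rightarrow>
    nat \<Rightarrow> (nat \<Rightarrow> 'v) \<Rightarrow> ('k poly2 set \<Rightarrow> 'k) \<Rightarrow> 'v \<Rightarrow> 'v"
  where "zeta scale br tr n e \<theta> =
    (THE f. Vector_Spaces.linear scale scale f \<and>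
      (\<forall>i\<in>{1..n}. f (e i) = (\<Sum>s=1..n. scale (\<theta> (univ_gen scale br tr n e s i)) (e s))))"

end

theory Submission
  imports Defs "HOL-Library.Function_Algebras"
begin

text \<open>Let \<open>A\<close> be the universal algebra of the Lie-Yamaguti algebra \<open>L\<close>. By construction, a morphism
  from \<open>A\<close> to a commutative algebra \<open>T\<close> is the same as a matrix over \<open>T\<close> that satisfies the defining
  relations of \<open>A\<close>, here called a structure matrix (\<open>univ_algebra_hom_exists\<close>,
  \<open>univ_algebra_hom_eq\<close>). The relations say that the matrix intertwines the structure constants, so
  products of structure matrices are structure matrices (\<open>structure_matrix_product\<close>). For \<open>T = A \<otimes> A\<close>
  this yields the comultiplication of \<open>A\<close>. For the ground field \<open>T = K\<close>, structure matrices are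
  exactly the matrices of the linear maps of \<open>L\<close> that preserve both brackets
  (\<open>endomorphism_iff_structure_matrix\<close>). Hence \<open>\<theta> \<mapsto> \<zeta>(\<theta>)\<close> is a bijection from the characters of \<open>A\<close>
  to the endomorphisms of \<open>L\<close>. It turns convolution into composition, because the value of the
  convolution product at \<open>x\<^sub>i\<^sub>j\<close> is \<open>\<Sum>s. f(x\<^sub>i\<^sub>s) g(x\<^sub>s\<^sub>j)\<close>, and the counit into the identity. So it is an
  isomorphism of monoids, and it restricts to an isomorphism of the groups of units.

  It remains to identify the group-like elements of the finite dual with the characters
  (\<open>grouplikes_finite_dual\<close>). The comultiplication of the finite dual is defined by the
  requirement that \<open>\<Delta>(f)\<close> has the value \<open>f(a b)\<close> at \<open>(a, b)\<close>. Such a tensor is unique, since tensors of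
  functionals are separated by pairs of arguments (\<open>tensor_separation\<close>), and it exists for \<open>f\<close> in the
  finite dual (\<open>finite_dual_comult_exists\<close>). Therefore \<open>\<Delta>(f) = f \<otimes> f\<close> says that \<open>f\<close> is multiplicative.
  Both facts rest on dual systems for finitely many independent functionals
  (\<open>dual_elements_exist\<close>) and on the description of the ideals of finite codimension as the
  common kernels of finitely many functionals. A character belongs to the finite dual
  because its kernel is such an ideal.\<close>

section \<open>Commutative algebras, quotients and morphisms\<close>

text \<open>A commutative unital algebra over the field given by the scalar type. The scalars range over the
  whole type, so no closure condition on them is needed.\<close>

locale commutative_algebra = cring A
  for A :: "('k::field, 'a, 'm) module_scheme" (structure) +
  assumes smult_closed [simp, intro]: "x \<in> carrier A \<Longrightarrow> c \<odot> x \<in> carrier A"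
    and smult_l_distr: "x \<in> carrier A \<Longrightarrow> (c + d) \<odot> x = c \<odot> x \<oplus> d \<odot> x"
    and smult_r_distr: "x \<in> carrier A \<Longrightarrow> y \<in> carrier A \<Longrightarrow> c \<odot> (x \<oplus> y) = c \<odot> x \<oplus> c \<odot> y"
    and smult_assoc: "x \<in> carrier A \<Longrightarrow> (c * d) \<odot> x = c \<odot> (d \<odot> x)"
    and smult_one [simp]: "x \<in> carrier A \<Longrightarrow> 1 \<odot> x = x"
    and smult_mult: "x \<in> carrier A \<Longrightarrow> y \<in> carrier A \<Longrightarrow> (c \<odot> x) \<otimes> y = c \<odot> (x \<otimes> y)"
begin

lemma smult_mult_right:
  "x \<in> carrier A \<Longrightarrow> y \<in> carrier A \<Longrightarrow> x \<otimes> (c \<odot> y) = c \<odot> (x \<otimes> y)"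
  by (metis m_comm smult_closed smult_mult)

lemma smult_l_null [simp]: "x \<in> carrier A \<Longrightarrow> 0 \<odot> x = \<zero>"
  by (metis add.l_cancel_one' add_0 smult_closed smult_l_distr)

lemma smult_r_null [simp]: "c \<odot> \<zero> = \<zero>"
  by (metis add.l_cancel_one' l_zero smult_closed smult_r_distr zero_closed)

lemma smult_minus_one: "x \<in> carrier A \<Longrightarrow> (- 1) \<odot> x = \<ominus> x"
  by (metis add.inv_equality add.left_inverse smult_closed smult_l_distr smult_l_null smult_one)

lemma smult_finsum:
  "f \<in> S \<rightarrow> carrier A \<Longrightarrow> c \<odot> (\<Oplus>s\<in>S. f s) = (\<Oplus>s\<in>S. c \<odot> f s)"
proof (induction S rule: infinite_finite_induct)
  case (insert x F)
  then show ?case by (simp add: Pi_def smult_r_distr)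
qed simp_all

lemma finsum_swap:
  assumes "finite S" "finite T" "\<And>s t. s \<in> S \<Longrightarrow> t \<in> T \<Longrightarrow> f s t \<in> carrier A"
  shows "(\<Oplus>s\<in>S. \<Oplus>t\<in>T. f s t) = (\<Oplus>t\<in>T. \<Oplus>s\<in>S. f s t)"
  using assms(1,3)
proof (induction S)
  case (insert x F)
  have "(\<Oplus>t\<in>T. \<Oplus>s\<in>insert x F. f s t) = (\<Oplus>t\<in>T. f x t \<oplus> (\<Oplus>s\<in>F. f s t))"
    using insert by (intro finsum_cong') (auto simp: Pi_def)
  also have "\<dots> = (\<Oplus>t\<in>T. f x t) \<oplus> (\<Oplus>t\<in>T. \<Oplus>s\<in>F. f s t)"
    using insert by (intro finsum_addf) (auto simp: Pi_def)
  finally show ?case using insert by (simp add: Pi_def)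
qed simp

end

lemma commutative_algebra_ground: "commutative_algebra (ground_algebra :: ('k::field, 'k) module)"
proof -
  have "cring (ground_algebra :: ('k, 'k) module)"
    by (intro cringI abelian_groupI comm_monoidI)
      (auto simp: ground_algebra_def algebra_simps intro: exI[of _ "- _"])
  then show ?thesis
    unfolding commutative_algebra_def commutative_algebra_axioms_def
    by (simp add: ground_algebra_def algebra_simps)
qed

lemma ground_algebra_simps [simp]:
  "carrier ground_algebra = UNIV" "x \<otimes>\<^bsub>ground_algebra\<^esub> y = x * y"
  "x \<oplus>\<^bsub>ground_algebra\<^esub> y = x + y" "\<one>\<^bsub>ground_algebra\<^esub> = 1" "\<zero>\<^bsub>ground_algebra\<^esub> = 0"
  "x \<odot>\<^bsub>ground_algebra\<^esub> y = x * y"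
  by (simp_all add: ground_algebra_def)

lemma finsum_ground [simp]: "finsum ground_algebra f S = sum f S"
proof -
  interpret commutative_algebra "ground_algebra :: ('a, 'a) module"
    by (rule commutative_algebra_ground)
  show ?thesis
    by (induction S rule: infinite_finite_induct) simp_all
qed

lemma alg_homD:
  assumes "h \<in> alg_hom A T"
  shows "x \<in> carrier A \<Longrightarrow> h x \<in> carrier T"
    and "x \<in> carrier A \<Longrightarrow> y \<in> carrier A \<Longrightarrow> h (x \<oplus>\<^bsub>A\<^esub> y) = h x \<oplus>\<^bsub>T\<^esub> h y"
    and "x \<in> carrier A \<Longrightarrow> y \<in> carrier A \<Longrightarrow> h (x \<otimes>\<^bsub>A\<^esub> y) = h x \<otimes>\<^bsub>T\<^esub> h y"
    and "h \<one>\<^bsub>A\<^esub> = \<one>\<^bsub>T\<^esub>"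
    and "x \<in> carrier A \<Longrightarrow> h (c \<odot>\<^bsub>A\<^esub> x) = c \<odot>\<^bsub>T\<^esub> h x"
  using assms by (auto simp: alg_hom_def ring_hom_def)

lemma alg_homI:
  assumes "\<And>x. x \<in> carrier A \<Longrightarrow> h x \<in> carrier T"
    and "\<And>x y. x \<in> carrier A \<Longrightarrow> y \<in> carrier A \<Longrightarrow> h (x \<oplus>\<^bsub>A\<^esub> y) = h x \<oplus>\<^bsub>T\<^esub> h y"
    and "\<And>x y. x \<in> carrier A \<Longrightarrow> y \<in> carrier A \<Longrightarrow> h (x \<otimes>\<^bsub>A\<^esub> y) = h x \<otimes>\<^bsub>T\<^esub> h y"
    and "h \<one>\<^bsub>A\<^esub> = \<one>\<^bsub>T\<^esub>"
    and "\<And>c x. x \<in> carrier A \<Longrightarrow> h (c \<odot>\<^bsub>A\<^esub> x) = c \<odot>\<^bsub>T\<^esub> h x"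
  shows "h \<in> alg_hom A T"
  using assms by (auto simp: alg_hom_def ring_hom_def)

lemma alg_hom_comp:
  assumes "g \<in> alg_hom A T" "h \<in> alg_hom T U"
  shows "(\<lambda>x. h (g x)) \<in> alg_hom A U"
  by (intro alg_homI) (simp_all add: alg_homD[OF assms(1)] alg_homD[OF assms(2)])


lemma alg_hom_cong:
  assumes "h \<in> alg_hom A T" "commutative_algebra A" "\<And>x. x \<in> carrier A \<Longrightarrow> g x = h x"
  shows "g \<in> alg_hom A T"
proof -
  interpret commutative_algebra A by fact
  show ?thesis by (intro alg_homI) (simp_all add: assms(3) alg_homD[OF assms(1)])
qed

lemma alg_hom_ring_hom_cring:
  assumes "h \<in> alg_hom A T" "commutative_algebra A" "commutative_algebra T"
  shows "ring_hom_cring A T h"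
  using assms by (simp add: alg_hom_def ring_hom_cring_def ring_hom_cring_axioms_def
      commutative_algebra.axioms(1))

lemma alg_hom_zero:
  assumes "h \<in> alg_hom A T" "commutative_algebra A" "commutative_algebra T"
  shows "h \<zero>\<^bsub>A\<^esub> = \<zero>\<^bsub>T\<^esub>"
  using ring_hom_cring.hom_zero[OF alg_hom_ring_hom_cring[OF assms]] .

lemma alg_hom_finsum:
  assumes "h \<in> alg_hom A T" "commutative_algebra A" "commutative_algebra T" "f \<in> S \<rightarrow> carrier A"
  shows "h (\<Oplus>\<^bsub>A\<^esub>s\<in>S. f s) = (\<Oplus>\<^bsub>T\<^esub>s\<in>S. h (f s))"
  using ring_hom_cring.hom_finsum[OF alg_hom_ring_hom_cring[OF assms(1-3)] assms(4)]
  by (simp add: o_def)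

lemma alg_hom_minus:
  assumes "h \<in> alg_hom A T" "commutative_algebra A" "commutative_algebra T"
    "x \<in> carrier A" "y \<in> carrier A"
  shows "h (x \<ominus>\<^bsub>A\<^esub> y) = h x \<ominus>\<^bsub>T\<^esub> h y"
proof -
  interpret ring_hom_cring A T h by (rule alg_hom_ring_hom_cring) fact+
  show ?thesis using assms(4,5) by (simp add: a_minus_def)
qed

lemma quotient_algebra_simps [simp]:
  "carrier (quotient_algebra A I) = a_rcosets\<^bsub>A\<^esub> I"
  "\<one>\<^bsub>quotient_algebra A I\<^esub> = I +>\<^bsub>A\<^esub> \<one>\<^bsub>A\<^esub>"
  "\<zero>\<^bsub>quotient_algebra A I\<^esub> = I"
  by (simp_all add: quotient_algebra_def FactRing_def)

lemma a_rcosets_iff: "C \<in> a_rcosets\<^bsub>A\<^esub> I \<longleftrightarrow> (\<exists>x\<in>carrier A. C = I +>\<^bsub>A\<^esub> x)"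
  by (auto simp: A_RCOSETS_def RCOSETS_def a_r_coset_def)

context commutative_algebra
begin

lemma ideal_smult_closed:
  assumes "ideal I A" "x \<in> I"
  shows "c \<odot> x \<in> I"
proof -
  interpret I: ideal I A by fact
  have "x \<in> carrier A" using assms(2) by simp
  then have "c \<odot> x = (c \<odot> \<one>) \<otimes> x" by (simp add: smult_mult)
  then show ?thesis using assms(2) by (simp add: I.I_l_closed)
qed

text \<open>The scalar multiplication of the quotient is a union over representatives; it is computed on any
  single representative since ideals are stable under scalars.\<close>

lemma quotient_algebra_ops:
  assumes "ideal I A" "x \<in> carrier A" "y \<in> carrier A"
  shows "(I +> x) \<oplus>\<^bsub>quotient_algebra A I\<^esub> (I +> y) = I +> (x \<oplus> y)"
    and "(I +> x) \<otimes>\<^bsub>quotient_algebra A I\<^esub> (I +> y) = I +> (x \<otimes> y)"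
    and "c \<odot>\<^bsub>quotient_algebra A I\<^esub> (I +> x) = I +> (c \<odot> x)"
proof -
  interpret I: ideal I A by fact
  show "(I +> x) \<oplus>\<^bsub>quotient_algebra A I\<^esub> (I +> y) = I +> (x \<oplus> y)"
    using assms I.a_rcos_sum by (simp add: quotient_algebra_def FactRing_def)
  show "(I +> x) \<otimes>\<^bsub>quotient_algebra A I\<^esub> (I +> y) = I +> (x \<otimes> y)"
    using assms I.rcoset_mult_add by (simp add: quotient_algebra_def FactRing_def)
  have eq: "I +> c \<odot> x' = I +> c \<odot> x" if x': "x' \<in> I +> x" for x'
  proof -
    obtain h where h: "h \<in> I" "x' = h \<oplus> x"
      using x' by (auto simp: a_r_coset_def r_coset_def)
    then have "c \<odot> x' = c \<odot> h \<oplus> c \<odot> x" using assms by (simp add: smult_r_distr)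
    moreover have "c \<odot> h \<in> I" using h assms(1) ideal_smult_closed by blast
    ultimately have "c \<odot> x' \<in> I +> c \<odot> x" by (auto simp: a_r_coset_def r_coset_def)
    then show ?thesis using assms(2) I.a_repr_independence' smult_closed by metis
  qed
  have "x \<in> I +> x" using I.a_rcos_self assms(2) by blast
  then have "(\<Union>x'\<in>I +> x. I +> c \<odot> x') = I +> c \<odot> x" using eq by blast
  then show "c \<odot>\<^bsub>quotient_algebra A I\<^esub> (I +> x) = I +> (c \<odot> x)"
    by (simp add: quotient_algebra_def)
qed

lemma coset_eq_iff:
  assumes "ideal I A" "x \<in> carrier A" "y \<in> carrier A"
  shows "I +> x = I +> y \<longleftrightarrow> x \<ominus> y \<in> I"
proof -
  interpret I: ideal I A by fact
  have "x \<ominus> y \<in> I \<longleftrightarrow> x \<in> I +> y" using I.a_rcos_module_minus[OF ring_axioms assms(3,2)] by simp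
  then show ?thesis using assms I.a_rcos_self I.a_repr_independence' by metis
qed

lemma commutative_algebra_quotient:
  assumes "ideal I A"
  shows "commutative_algebra (quotient_algebra A I)"
proof -
  interpret I: ideal I A by fact
  let ?Q = "quotient_algebra A I"
  note ops = quotient_algebra_ops[OF assms]
  have zero: "I = I +> \<zero>" by (simp add: I.a_subset)
  have "cring ?Q"
  proof (rule cringI)
    show "abelian_group ?Q"
    proof (rule abelian_groupI)
      fix X assume "X \<in> carrier ?Q"
      then obtain x where x: "x \<in> carrier A" "X = I +> x" by (auto simp: a_rcosets_iff)
      have "(I +> \<ominus> x) \<oplus>\<^bsub>?Q\<^esub> X = \<zero>\<^bsub>?Q\<^esub>" using x by (simp add: ops l_neg I.a_subset)
      moreover have "I +> \<ominus> x \<in> carrier ?Q" using x by (auto simp: a_rcosets_iff)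
      ultimately show "\<exists>Y\<in>carrier ?Q. Y \<oplus>\<^bsub>?Q\<^esub> X = \<zero>\<^bsub>?Q\<^esub>" by blast
    next
      show "\<zero>\<^bsub>?Q\<^esub> \<in> carrier ?Q" using zero by (auto simp: a_rcosets_iff)
    next
      fix X assume "X \<in> carrier ?Q"
      then obtain x where x: "x \<in> carrier A" "X = I +> x" by (auto simp: a_rcosets_iff)
      then show "\<zero>\<^bsub>?Q\<^esub> \<oplus>\<^bsub>?Q\<^esub> X = X" using ops(1)[of \<zero> x] zero by simp
    qed (auto simp: a_rcosets_iff ops a_ac)
    show "comm_monoid ?Q"
      by (rule comm_monoidI) (auto simp: a_rcosets_iff ops m_ac)
    show "(X \<oplus>\<^bsub>?Q\<^esub> Y) \<otimes>\<^bsub>?Q\<^esub> Z = X \<otimes>\<^bsub>?Q\<^esub> Z \<oplus>\<^bsub>?Q\<^esub> Y \<otimes>\<^bsub>?Q\<^esub> Z"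
      if "X \<in> carrier ?Q" "Y \<in> carrier ?Q" "Z \<in> carrier ?Q" for X Y Z
      using that by (auto simp: a_rcosets_iff ops l_distr)
  qed
  then show ?thesis
    unfolding commutative_algebra_def commutative_algebra_axioms_def
    by (auto simp: a_rcosets_iff ops smult_l_distr smult_r_distr smult_assoc smult_mult)
qed

lemma quotient_proj_alg_hom:
  assumes "ideal I A"
  shows "(\<lambda>x. I +> x) \<in> alg_hom A (quotient_algebra A I)"
  by (rule alg_homI) (auto simp: a_rcosets_iff quotient_algebra_ops[OF assms])

text \<open>The universal property of the quotient by an ideal.\<close>

lemma quotient_lift:
  assumes I: "ideal I A" and T: "commutative_algebra T"
    and h: "h \<in> alg_hom A T" and kill: "\<And>x. x \<in> I \<Longrightarrow> h x = \<zero>\<^bsub>T\<^esub>"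
  obtains g where "g \<in> alg_hom (quotient_algebra A I) T"
    "\<And>x. x \<in> carrier A \<Longrightarrow> g (I +> x) = h x"
proof -
  interpret I: ideal I A by fact
  interpret T: commutative_algebra T by fact
  define g where "g C = h (SOME x. x \<in> carrier A \<and> C = I +> x)" for C
  have g: "g (I +> x) = h x" if x: "x \<in> carrier A" for x
  proof -
    let ?y = "SOME y. y \<in> carrier A \<and> I +> x = I +> y"
    have y: "?y \<in> carrier A \<and> I +> x = I +> ?y" by (rule someI[of _ x]) (use x in simp)
    then have "x \<ominus> ?y \<in> I" using coset_eq_iff[OF I x] by blast
    then have "h x \<ominus>\<^bsub>T\<^esub> h ?y = \<zero>\<^bsub>T\<^esub>"
      using kill alg_hom_minus[OF h commutative_algebra_axioms T x] y by metis
    then have "h x = h ?y"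
      using alg_homD(1)[OF h] x y T.minus_equality[of "h x" "\<ominus>\<^bsub>T\<^esub> h ?y"] by (simp add: a_minus_def)
    then show ?thesis by (simp add: g_def)
  qed
  have "g \<in> alg_hom (quotient_algebra A I) T"
    by (rule alg_homI) (auto simp: a_rcosets_iff g alg_homD[OF h] quotient_algebra_ops[OF I])
  then show thesis using g that by blast
qed

end

section \<open>Evaluation of polynomials\<close>

lemma poly_mapping_add_single_induct [case_names zero add]:
  assumes "P 0"
    and "\<And>k c p. P p \<Longrightarrow> k \<notin> Poly_Mapping.keys p \<Longrightarrow> c \<noteq> 0 \<Longrightarrow> P (Poly_Mapping.single k c + p)"
  shows "P (p :: 'a \<Rightarrow>\<^sub>0 'b::comm_monoid_add)"
proof (induction p rule: update_induct)
  case const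
  show ?case using assms(1) .
next
  case (update p k c)
  have "Poly_Mapping.update k c p = Poly_Mapping.single k c + p"
    using update(1) by (intro poly_mapping_eqI)
      (auto simp: lookup_update lookup_add lookup_single in_keys_iff)
  then show ?case using assms(2) update by simp
qed

lemma keys_single_add:
  fixes p :: "'a \<Rightarrow>\<^sub>0 'b::comm_monoid_add"
  assumes "k \<notin> Poly_Mapping.keys p" "c \<noteq> 0"
  shows "Poly_Mapping.keys (Poly_Mapping.single k c + p) = insert k (Poly_Mapping.keys p)"
  using assms by (auto simp: in_keys_iff lookup_add lookup_single when_def split: if_splits)

lemma poly_algebra_simps [simp]:
  "p \<oplus>\<^bsub>poly_algebra n\<^esub> q = p + q" "p \<otimes>\<^bsub>poly_algebra n\<^esub> q = p * q"
  "\<one>\<^bsub>poly_algebra n\<^esub> = 1" "\<zero>\<^bsub>poly_algebra n\<^esub> = 0" "c \<odot>\<^bsub>poly_algebra n\<^esub> p = pconst c * p"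
  by (simp_all add: poly_algebra_def)

lemma poly_algebra_carrier:
  "p \<in> carrier (poly_algebra n) \<longleftrightarrow>
    (\<forall>m\<in>Poly_Mapping.keys p. Poly_Mapping.keys m \<subseteq> {1..n} \<times> {1..n})"
  by (simp add: poly_algebra_def)

lemma poly_algebra_closed [simp]:
  fixes p q :: "'k::field poly2"
  assumes "p \<in> carrier (poly_algebra n)" "q \<in> carrier (poly_algebra n)"
  shows "p + q \<in> carrier (poly_algebra n)" "p * q \<in> carrier (poly_algebra n)"
    and "- p \<in> carrier (poly_algebra n)" "p - q \<in> carrier (poly_algebra n)"
proof -
  have add: "p + q \<in> carrier (poly_algebra n)" if "q \<in> carrier (poly_algebra n)" for q :: "'k poly2"
    using assms(1) that keys_add[of p q] unfolding poly_algebra_carrier by blast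
  have uminus: "- q \<in> carrier (poly_algebra n)" if "q \<in> carrier (poly_algebra n)"
    for q :: "'k poly2"
  proof -
    have "Poly_Mapping.keys (- q) = Poly_Mapping.keys q" by (auto simp: in_keys_iff)
    then show ?thesis using that by (simp add: poly_algebra_carrier)
  qed
  from uminus show "- p \<in> carrier (poly_algebra n)" using assms(1) .
  from add[OF uminus[OF assms(2)]] show "p - q \<in> carrier (poly_algebra n)" by simp
  show "p + q \<in> carrier (poly_algebra n)" using add[OF assms(2)] .
  show "p * q \<in> carrier (poly_algebra n)"
    unfolding poly_algebra_carrier
  proof
    fix m assume "m \<in> Poly_Mapping.keys (p * q)"
    then obtain a b where "a \<in> Poly_Mapping.keys p" "b \<in> Poly_Mapping.keys q" "m = a + b"
      using keys_mult[of p q] by auto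
    then show "Poly_Mapping.keys m \<subseteq> {1..n} \<times> {1..n}"
      using assms keys_add[of a b] unfolding poly_algebra_carrier by blast
  qed
qed

lemma poly_algebra_basic_closed [simp]:
  "0 \<in> carrier (poly_algebra n)" "1 \<in> carrier (poly_algebra n)" "pconst c \<in> carrier (poly_algebra n)"
  "s \<in> {1..n} \<Longrightarrow> i \<in> {1..n} \<Longrightarrow> pvar s i \<in> carrier (poly_algebra n)"
  by (auto simp: poly_algebra_carrier pconst_def pvar_def split: if_splits)

lemma pconst_arith:
  "pconst (c + d) = pconst c + pconst d" "pconst (c * d) = pconst c * pconst d" "pconst 1 = 1"
  by (simp_all add: pconst_def single_add mult_single)

lemma poly_algebra_commutative_algebra: "commutative_algebra (poly_algebra n)"
proof -
  have "cring (poly_algebra n :: ('a, 'a poly2) module)"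
    by (intro cringI abelian_groupI comm_monoidI)
      (auto simp: algebra_simps intro!: bexI[of _ "- _"])
  then show ?thesis
    unfolding commutative_algebra_def commutative_algebra_axioms_def
    by (auto simp: algebra_simps pconst_arith)
qed

lemma finsum_poly_algebra:
  "f \<in> S \<rightarrow> carrier (poly_algebra n) \<Longrightarrow> finsum (poly_algebra n) f S = sum f S"
proof -
  interpret commutative_algebra "poly_algebra n" by (rule poly_algebra_commutative_algebra)
  show "f \<in> S \<rightarrow> carrier (poly_algebra n) \<Longrightarrow> finsum (poly_algebra n) f S = sum f S"
    by (induction S rule: infinite_finite_induct) (simp_all add: Pi_def)
qed

lemma poly_algebra_sum_closed [simp]:
  "(\<And>s. s \<in> S \<Longrightarrow> f s \<in> carrier (poly_algebra n)) \<Longrightarrow> sum f S \<in> carrier (poly_algebra n)"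
  by (induction S rule: infinite_finite_induct) simp_all

lemma poly_algebra_minus:
  assumes "p \<in> carrier (poly_algebra n)" "q \<in> carrier (poly_algebra n)"
  shows "p \<ominus>\<^bsub>poly_algebra n\<^esub> q = p - q"
proof -
  interpret commutative_algebra "poly_algebra n" by (rule poly_algebra_commutative_algebra)
  have "\<ominus>\<^bsub>poly_algebra n\<^esub> q = - q"
    using assms(2) by (intro minus_equality) simp_all
  then show ?thesis by (simp add: a_minus_def)
qed

text \<open>The variables generate the polynomial algebra.\<close>

lemma poly_algebra_hom_eq:
  fixes p :: "'k::field poly2"
  assumes T: "commutative_algebra T"
    and g: "g \<in> alg_hom (poly_algebra n) T" and h: "h \<in> alg_hom (poly_algebra n) T"
    and eq: "\<And>s i. s \<in> {1..n} \<Longrightarrow> i \<in> {1..n} \<Longrightarrow> g (pvar s i) = h (pvar s i)"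
    and p: "p \<in> carrier (poly_algebra n)"
  shows "g p = h p"
proof -
  note gD = alg_homD[OF g, simplified] and hD = alg_homD[OF h, simplified]
  have var: "g (Poly_Mapping.single (Poly_Mapping.single (s, i) d) 1) =
      h (Poly_Mapping.single (Poly_Mapping.single (s, i) d) 1) \<and>
      Poly_Mapping.single (Poly_Mapping.single (s, i) d) (1::'k) \<in> carrier (poly_algebra n)"
    if "s \<in> {1..n}" "i \<in> {1..n}" for s i d
  proof (induction d)
    case 0
    show ?case using gD(4) hD(4) by simp
  next
    case (Suc d)
    have "Poly_Mapping.single (Poly_Mapping.single (s, i) (Suc d)) (1::'k) =
      pvar s i * Poly_Mapping.single (Poly_Mapping.single (s, i) d) 1"
      by (simp add: pvar_def mult_single flip: single_add)
    moreover have "(pvar s i :: 'k poly2) \<in> carrier (poly_algebra n)"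
      using that by (rule poly_algebra_basic_closed(4))
    ultimately show ?case using Suc eq[OF that] by (simp add: gD(3) hD(3))
  qed
  have mon: "Poly_Mapping.keys m \<subseteq> {1..n} \<times> {1..n} \<Longrightarrow>
      g (Poly_Mapping.single m 1) = h (Poly_Mapping.single m 1) \<and>
      Poly_Mapping.single m (1::'k) \<in> carrier (poly_algebra n)" for m
  proof (induction m rule: poly_mapping_add_single_induct)
    case zero
    show ?case using gD(4) hD(4) by simp
  next
    case (add k d m)
    obtain s i where k: "k = (s, i)" by (cases k)
    have "Poly_Mapping.keys (Poly_Mapping.single k d + m) = insert k (Poly_Mapping.keys m)"
      using add(2,3) by (rule keys_single_add)
    then have *: "s \<in> {1..n}" "i \<in> {1..n}" "Poly_Mapping.keys m \<subseteq> {1..n} \<times> {1..n}"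
      using add(4) k by auto
    have "Poly_Mapping.single (Poly_Mapping.single k d + m) (1::'k) =
      Poly_Mapping.single (Poly_Mapping.single (s, i) d) 1 * Poly_Mapping.single m 1"
      by (simp add: mult_single k)
    then show ?case using add(1)[OF *(3)] var[OF *(1,2)] by (simp add: gD(3) hD(3))
  qed
  show ?thesis
    using p
  proof (induction p rule: poly_mapping_add_single_induct)
    case zero
    interpret commutative_algebra "poly_algebra n :: ('k, 'k poly2) module"
      by (rule poly_algebra_commutative_algebra)
    show ?case
      using alg_hom_zero[OF g commutative_algebra_axioms T]
        alg_hom_zero[OF h commutative_algebra_axioms T] by simp
  next
    case (add m c p)
    have "Poly_Mapping.keys (Poly_Mapping.single m c + p) = insert m (Poly_Mapping.keys p)"
      using add(2,3) by (rule keys_single_add)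
    then have *: "Poly_Mapping.keys m \<subseteq> {1..n} \<times> {1..n}" "p \<in> carrier (poly_algebra n)"
      using add(4) by (auto simp: poly_algebra_carrier)
    have "Poly_Mapping.single m c = pconst c * Poly_Mapping.single m 1"
      by (simp add: pconst_def mult_single)
    then show ?case
      using mon[OF *(1)] add(1)[OF *(2)] *(2) by (simp add: gD(2,5) hD(2,5))
  qed
qed

context commutative_algebra
begin

text \<open>The value of a monomial at the point \<open>v\<close>. The product runs over all index pairs; variables
  with indices outside of \<open>{1..n}\<close> are ignored, which makes the value multiplicative on all
  monomials and not just on those of \<^term>\<open>poly_algebra n\<close>.\<close>

definition monomial_value :: "nat \<Rightarrow> (nat \<times> nat \<Rightarrow> 'a) \<Rightarrow> (nat \<times> nat \<Rightarrow>\<^sub>0 nat) \<Rightarrow> 'a"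
  where "monomial_value n v m = (\<Otimes>k\<in>{1..n} \<times> {1..n}. v k [^] Poly_Mapping.lookup m k)"

text \<open>The value of a polynomial at the point \<open>v\<close>.\<close>

definition poly_value :: "nat \<Rightarrow> (nat \<times> nat \<Rightarrow> 'a) \<Rightarrow> 'k poly2 \<Rightarrow> 'a"
  where "poly_value n v p =
    (\<Oplus>m\<in>Poly_Mapping.keys p. Poly_Mapping.lookup p m \<odot> monomial_value n v m)"

context
  fixes n :: nat and v :: "nat \<times> nat \<Rightarrow> 'a"
  assumes v: "\<And>k. k \<in> {1..n} \<times> {1..n} \<Longrightarrow> v k \<in> carrier A"
begin

lemma monomial_value_closed [simp]: "monomial_value n v m \<in> carrier A"
  unfolding monomial_value_def using v by (intro finprod_closed) (auto simp: Pi_def)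

lemma monomial_value_zero: "monomial_value n v 0 = \<one>"
  unfolding monomial_value_def by (intro finprod_one_eqI) simp

lemma monomial_value_add:
  "monomial_value n v (m + m') = monomial_value n v m \<otimes> monomial_value n v m'"
proof -
  have "monomial_value n v (m + m') = (\<Otimes>k\<in>{1..n} \<times> {1..n}.
      v k [^] Poly_Mapping.lookup m k \<otimes> v k [^] Poly_Mapping.lookup m' k)"
    unfolding monomial_value_def using v
    by (intro finprod_cong') (auto simp: lookup_add nat_pow_mult)
  also have "\<dots> = monomial_value n v m \<otimes> monomial_value n v m'"
    unfolding monomial_value_def using v by (intro finprod_multf) (auto simp: Pi_def)
  finally show ?thesis .
qed

lemma monomial_value_single:
  assumes "k \<in> {1..n} \<times> {1..n}"
  shows "monomial_value n v (Poly_Mapping.single k 1) = v k"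
proof -
  have "monomial_value n v (Poly_Mapping.single k 1) =
      (\<Otimes>l\<in>{1..n} \<times> {1..n}. if k = l then v l else \<one>)"
    unfolding monomial_value_def using v
    by (intro finprod_cong') (auto simp: lookup_single when_def)
  also have "\<dots> = v k" using assms v by (intro finprod_singleton) auto
  finally show ?thesis .
qed

lemma poly_value_superset:
  assumes "finite M" "Poly_Mapping.keys p \<subseteq> M"
  shows "poly_value n v p = (\<Oplus>m\<in>M. Poly_Mapping.lookup p m \<odot> monomial_value n v m)"
  unfolding poly_value_def
  by (rule add.finprod_mono_neutral_cong_left) (use assms in \<open>auto simp: in_keys_iff\<close>)

lemma poly_value_closed [simp]: "poly_value n v p \<in> carrier A"
  unfolding poly_value_def by (intro finsum_closed) auto

lemma poly_value_add: "poly_value n v (p + q) = poly_value n v p \<oplus> poly_value n v q"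
proof -
  let ?M = "Poly_Mapping.keys p \<union> Poly_Mapping.keys q"
  have "poly_value n v (p + q) = (\<Oplus>m\<in>?M. Poly_Mapping.lookup p m \<odot> monomial_value n v m \<oplus>
      Poly_Mapping.lookup q m \<odot> monomial_value n v m)"
    using keys_add[of p q] by (subst poly_value_superset[of ?M]) (auto simp: lookup_add smult_l_distr)
  also have "\<dots> = poly_value n v p \<oplus> poly_value n v q"
    by (subst finsum_addf) (auto simp: poly_value_superset[of ?M])
  finally show ?thesis .
qed

lemma poly_value_single:
  "poly_value n v (Poly_Mapping.single m c) = c \<odot> monomial_value n v m"
  by (subst poly_value_superset[of "{m}"]) auto

lemma poly_value_zero: "poly_value n v 0 = \<zero>"
  by (simp add: poly_value_def)

lemma poly_value_mult: "poly_value n v (p * q) = poly_value n v p \<otimes> poly_value n v q"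
proof (induction p rule: poly_mapping_add_single_induct)
  case zero
  show ?case by (simp add: poly_value_zero)
next
  case (add m c p)
  have "poly_value n v (Poly_Mapping.single m c * q) =
      c \<odot> (monomial_value n v m \<otimes> poly_value n v q)"
  proof (induction q rule: poly_mapping_add_single_induct)
    case zero
    show ?case by (simp add: poly_value_zero)
  next
    case (add m' c' q)
    then show ?case
      by (simp add: distrib_left poly_value_add mult_single poly_value_single monomial_value_add
          r_distr smult_r_distr smult_assoc smult_mult_right)
  qed
  then show ?case
    using add by (simp add: distrib_right poly_value_add poly_value_single l_distr smult_mult)
qed

lemma poly_value_alg_hom: "poly_value n v \<in> alg_hom (poly_algebra n) A"
proof (rule alg_homI)
  have "poly_value n v (Poly_Mapping.single 0 1) = \<one>"
    by (simp only: poly_value_single) (simp add: monomial_value_zero)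
  then show "poly_value n v \<one>\<^bsub>poly_algebra n\<^esub> = \<one>" by simp
  show "poly_value n v (c \<odot>\<^bsub>poly_algebra n\<^esub> p) = c \<odot> poly_value n v p" for c p
    by (simp add: poly_value_mult pconst_def poly_value_single monomial_value_zero smult_mult)
qed (simp_all add: poly_value_add poly_value_mult)

lemma poly_value_pvar:
  "s \<in> {1..n} \<Longrightarrow> i \<in> {1..n} \<Longrightarrow> poly_value n v (pvar s i) = v (s, i)"
  unfolding pvar_def poly_value_single by (subst monomial_value_single) (auto simp: v)

end

end

section \<open>The universal property of the universal algebra\<close>

text \<open>The lower bound of sums over \<open>{1..n}\<close> should not be rewritten to \<open>Suc 0\<close>.\<close>

declare One_nat_def [simp del]

text \<open>A matrix over \<open>A\<close> that satisfies the relations of the universal algebra for the structure constants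
  \<open>\<tau>\<close> and \<open>\<omega>\<close>. In coordinates, these say that the matrix preserves the binary and the ternary
  bracket. The multiple sums of the relations are written as sums over pairs and triples, so that
  both conditions read \<open>V \<tau> = \<tau> V'\<close> with \<open>V'\<close> a Kronecker power of \<open>V\<close>.\<close>

definition structure_matrix ::
  "('k::field, 'a, 'm) module_scheme \<Rightarrow> nat \<Rightarrow> (nat \<Rightarrow> nat \<Rightarrow> nat \<Rightarrow> 'k) \<Rightarrow>
    (nat \<Rightarrow> nat \<Rightarrow> nat \<Rightarrow> nat \<Rightarrow> 'k) \<Rightarrow> (nat \<Rightarrow> nat \<Rightarrow> 'a) \<Rightarrow> bool"
  where "structure_matrix A n \<tau> \<omega> V \<longleftrightarrow>
    (\<forall>s\<in>{1..n}. \<forall>i\<in>{1..n}. V s i \<in> carrier A) \<and>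
    (\<forall>a\<in>{1..n}. \<forall>(i, j)\<in>{1..n} \<times> {1..n}.
      (\<Oplus>\<^bsub>A\<^esub>u\<in>{1..n}. \<tau> i j u \<odot>\<^bsub>A\<^esub> V a u) =
      (\<Oplus>\<^bsub>A\<^esub>\<sigma>\<in>{1..n} \<times> {1..n}.
        \<tau> (fst \<sigma>) (snd \<sigma>) a \<odot>\<^bsub>A\<^esub> (V (fst \<sigma>) i \<otimes>\<^bsub>A\<^esub> V (snd \<sigma>) j))) \<and>
    (\<forall>a\<in>{1..n}. \<forall>(i, j, k)\<in>{1..n} \<times> {1..n} \<times> {1..n}.
      (\<Oplus>\<^bsub>A\<^esub>u\<in>{1..n}. \<omega> i j k u \<odot>\<^bsub>A\<^esub> V a u) =
      (\<Oplus>\<^bsub>A\<^esub>\<sigma>\<in>{1..n} \<times> {1..n} \<times> {1..n}.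
        \<omega> (fst \<sigma>) (fst (snd \<sigma>)) (snd (snd \<sigma>)) a \<odot>\<^bsub>A\<^esub>
          (V (fst \<sigma>) i \<otimes>\<^bsub>A\<^esub> (V (fst (snd \<sigma>)) j \<otimes>\<^bsub>A\<^esub> V (snd (snd \<sigma>)) k))))"

lemma structure_matrix_hom:
  fixes A :: "('k::field, 'a, 'm) module_scheme"
  assumes g: "g \<in> alg_hom A T" and A: "commutative_algebra A" and T: "commutative_algebra T"
    and V: "structure_matrix A n \<tau> \<omega> V"
  shows "structure_matrix T n \<tau> \<omega> (\<lambda>s i. g (V s i))"
proof -
  interpret commutative_algebra A by fact
  interpret T: commutative_algebra T by fact
  have c: "V s i \<in> carrier A" if "s \<in> {1..n}" "i \<in> {1..n}" for s i
    using V that unfolding structure_matrix_def by blast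
  note gD = alg_homD[OF g] and gsum = alg_hom_finsum[OF g A T]
  have lin: "(\<Oplus>\<^bsub>T\<^esub>u\<in>{1..n}. x u \<odot>\<^bsub>T\<^esub> g (V a u)) = g (\<Oplus>\<^bsub>A\<^esub>u\<in>{1..n}. x u \<odot>\<^bsub>A\<^esub> V a u)"
    if "a \<in> {1..n}" for a and x :: "nat \<Rightarrow> 'k"
    using that c by (subst gsum) (auto simp: gD Pi_def intro!: T.finsum_cong')
  have quad: "(\<Oplus>\<^bsub>T\<^esub>\<sigma>\<in>{1..n} \<times> {1..n}. x \<sigma> \<odot>\<^bsub>T\<^esub> (g (V (fst \<sigma>) i) \<otimes>\<^bsub>T\<^esub> g (V (snd \<sigma>) j))) =
      g (\<Oplus>\<^bsub>A\<^esub>\<sigma>\<in>{1..n} \<times> {1..n}. x \<sigma> \<odot>\<^bsub>A\<^esub> (V (fst \<sigma>) i \<otimes>\<^bsub>A\<^esub> V (snd \<sigma>) j))"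
    if "i \<in> {1..n}" "j \<in> {1..n}" for i j and x :: "nat \<times> nat \<Rightarrow> 'k"
    using that c by (subst gsum) (auto simp: gD Pi_def intro!: T.finsum_cong')
  have cub: "(\<Oplus>\<^bsub>T\<^esub>\<sigma>\<in>{1..n} \<times> {1..n} \<times> {1..n}. x \<sigma> \<odot>\<^bsub>T\<^esub> (g (V (fst \<sigma>) i) \<otimes>\<^bsub>T\<^esub>
        (g (V (fst (snd \<sigma>)) j) \<otimes>\<^bsub>T\<^esub> g (V (snd (snd \<sigma>)) k)))) =
      g (\<Oplus>\<^bsub>A\<^esub>\<sigma>\<in>{1..n} \<times> {1..n} \<times> {1..n}. x \<sigma> \<odot>\<^bsub>A\<^esub> (V (fst \<sigma>) i \<otimes>\<^bsub>A\<^esub>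
        (V (fst (snd \<sigma>)) j \<otimes>\<^bsub>A\<^esub> V (snd (snd \<sigma>)) k)))"
    if "i \<in> {1..n}" "j \<in> {1..n}" "k \<in> {1..n}" for i j k and x :: "nat \<times> nat \<times> nat \<Rightarrow> 'k"
    using that c by (subst gsum) (auto simp: gD Pi_def intro!: T.finsum_cong')
  show ?thesis
    unfolding structure_matrix_def
  proof (intro conjI ballI)
    show "g (V s i) \<in> carrier T" if "s \<in> {1..n}" "i \<in> {1..n}" for s i
      using c[OF that] by (simp add: gD)
  next
    fix a p assume a: "a \<in> {1..n}" and p: "p \<in> {1..n} \<times> {1..n}"
    obtain i j where ij: "p = (i, j)" "i \<in> {1..n}" "j \<in> {1..n}" using p by auto
    show "case p of (i, j) \<Rightarrow> (\<Oplus>\<^bsub>T\<^esub>u\<in>{1..n}. \<tau> i j u \<odot>\<^bsub>T\<^esub> g (V a u)) =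
      (\<Oplus>\<^bsub>T\<^esub>\<sigma>\<in>{1..n} \<times> {1..n}.
        \<tau> (fst \<sigma>) (snd \<sigma>) a \<odot>\<^bsub>T\<^esub> (g (V (fst \<sigma>) i) \<otimes>\<^bsub>T\<^esub> g (V (snd \<sigma>) j)))"
      using V a ij(2,3) unfolding ij(1) prod.case lin[OF a] quad[OF ij(2,3)] structure_matrix_def
      by fastforce
  next
    fix a p assume a: "a \<in> {1..n}" and p: "p \<in> {1..n} \<times> {1..n} \<times> {1..n}"
    obtain i j k where ij: "p = (i, j, k)" "i \<in> {1..n}" "j \<in> {1..n}" "k \<in> {1..n}" using p by auto
    show "case p of (i, j, k) \<Rightarrow> (\<Oplus>\<^bsub>T\<^esub>u\<in>{1..n}. \<omega> i j k u \<odot>\<^bsub>T\<^esub> g (V a u)) =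
      (\<Oplus>\<^bsub>T\<^esub>\<sigma>\<in>{1..n} \<times> {1..n} \<times> {1..n}.
        \<omega> (fst \<sigma>) (fst (snd \<sigma>)) (snd (snd \<sigma>)) a \<odot>\<^bsub>T\<^esub>
          (g (V (fst \<sigma>) i) \<otimes>\<^bsub>T\<^esub> (g (V (fst (snd \<sigma>)) j) \<otimes>\<^bsub>T\<^esub> g (V (snd (snd \<sigma>)) k))))"
      using V a ij(2-) unfolding ij(1) prod.case lin[OF a] cub[OF ij(2-)] structure_matrix_def
      by fastforce
  qed
qed

context commutative_algebra
begin

lemma finsum_product:
  assumes "finite S" "finite T" "f \<in> S \<rightarrow> carrier A" "g \<in> T \<rightarrow> carrier A"
  shows "(\<Oplus>s\<in>S. f s) \<otimes> (\<Oplus>t\<in>T. g t) = (\<Oplus>p\<in>S \<times> T. f (fst p) \<otimes> g (snd p))"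
  using assms(1,3)
proof (induction S)
  case empty
  show ?case using assms by (simp add: finsum_closed)
next
  case (insert x F)
  have "(\<Oplus>p\<in>insert x F \<times> T. f (fst p) \<otimes> g (snd p)) =
      (\<Oplus>p\<in>Pair x ` T \<union> F \<times> T. f (fst p) \<otimes> g (snd p))"
    by (rule arg_cong[where f = "finsum A _"]) auto
  also have "\<dots> = (\<Oplus>p\<in>Pair x ` T. f (fst p) \<otimes> g (snd p)) \<oplus> (\<Oplus>p\<in>F \<times> T. f (fst p) \<otimes> g (snd p))"
    using insert assms by (intro finsum_Un_disjoint) (auto simp: Pi_def)
  also have "(\<Oplus>p\<in>Pair x ` T. f (fst p) \<otimes> g (snd p)) = (\<Oplus>t\<in>T. f x \<otimes> g t)"
    using insert assms by (subst finsum_reindex) (auto simp: Pi_def inj_on_def)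
  also have "\<dots> = f x \<otimes> (\<Oplus>t\<in>T. g t)"
    using insert assms by (subst finsum_rdistr) (auto simp: Pi_def)
  finally show ?case
    using insert assms by (simp add: Pi_def l_distr finsum_closed)
qed

text \<open>Let \<open>\<tau>\<close> be the matrix of a linear map from a space with basis \<open>M\<close> to one with basis \<open>N\<close>. If
  \<open>X \<tau> = \<tau> X'\<close> and \<open>Y \<tau> = \<tau> Y'\<close>, then \<open>X Y \<tau> = X \<tau> Y' = \<tau> X' Y'\<close>.\<close>

lemma intertwining_product:
  assumes fin: "finite N" "finite M"
    and X: "\<And>a b. a \<in> N \<Longrightarrow> b \<in> N \<Longrightarrow> X a b \<in> carrier A"
    and X': "\<And>a b. a \<in> M \<Longrightarrow> b \<in> M \<Longrightarrow> X' a b \<in> carrier A"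
    and Y: "\<And>a b. a \<in> N \<Longrightarrow> b \<in> N \<Longrightarrow> Y a b \<in> carrier A"
    and Y': "\<And>a b. a \<in> M \<Longrightarrow> b \<in> M \<Longrightarrow> Y' a b \<in> carrier A"
    and eqX: "\<And>a \<alpha>. a \<in> N \<Longrightarrow> \<alpha> \<in> M \<Longrightarrow>
      (\<Oplus>u\<in>N. \<tau> \<alpha> u \<odot> X a u) = (\<Oplus>\<sigma>\<in>M. \<tau> \<sigma> a \<odot> X' \<sigma> \<alpha>)"
    and eqY: "\<And>a \<alpha>. a \<in> N \<Longrightarrow> \<alpha> \<in> M \<Longrightarrow>
      (\<Oplus>u\<in>N. \<tau> \<alpha> u \<odot> Y a u) = (\<Oplus>\<sigma>\<in>M. \<tau> \<sigma> a \<odot> Y' \<sigma> \<alpha>)"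
    and a: "a \<in> N" and \<alpha>: "\<alpha> \<in> M"
  shows "(\<Oplus>u\<in>N. \<tau> \<alpha> u \<odot> (\<Oplus>c\<in>N. X a c \<otimes> Y c u)) =
    (\<Oplus>\<sigma>\<in>M. \<tau> \<sigma> a \<odot> (\<Oplus>\<rho>\<in>M. X' \<sigma> \<rho> \<otimes> Y' \<rho> \<alpha>))"
proof -
  note cl = X X' Y Y' fin a \<alpha>
  have "(\<Oplus>u\<in>N. \<tau> \<alpha> u \<odot> (\<Oplus>c\<in>N. X a c \<otimes> Y c u)) = (\<Oplus>u\<in>N. \<Oplus>c\<in>N. X a c \<otimes> (\<tau> \<alpha> u \<odot> Y c u))"
    by (intro finsum_cong', simp)
      (auto simp: cl smult_finsum smult_mult_right intro!: finsum_cong')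
  also have "\<dots> = (\<Oplus>c\<in>N. \<Oplus>u\<in>N. X a c \<otimes> (\<tau> \<alpha> u \<odot> Y c u))"
    by (intro finsum_swap) (auto simp: cl)
  also have "\<dots> = (\<Oplus>c\<in>N. X a c \<otimes> (\<Oplus>\<sigma>\<in>M. \<tau> \<sigma> c \<odot> Y' \<sigma> \<alpha>))"
    by (intro finsum_cong', simp) (auto simp: cl finsum_rdistr simp flip: eqY)
  also have "\<dots> = (\<Oplus>c\<in>N. \<Oplus>\<sigma>\<in>M. (\<tau> \<sigma> c \<odot> X a c) \<otimes> Y' \<sigma> \<alpha>)"
    by (intro finsum_cong', simp)
      (auto simp: cl finsum_rdistr smult_mult smult_mult_right intro!: finsum_cong')
  also have "\<dots> = (\<Oplus>\<sigma>\<in>M. \<Oplus>c\<in>N. (\<tau> \<sigma> c \<odot> X a c) \<otimes> Y' \<sigma> \<alpha>)"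
    by (intro finsum_swap) (auto simp: cl)
  also have "\<dots> = (\<Oplus>\<sigma>\<in>M. (\<Oplus>\<rho>\<in>M. \<tau> \<rho> a \<odot> X' \<rho> \<sigma>) \<otimes> Y' \<sigma> \<alpha>)"
    by (intro finsum_cong', simp) (auto simp: cl finsum_ldistr simp flip: eqX)
  also have "\<dots> = (\<Oplus>\<sigma>\<in>M. \<Oplus>\<rho>\<in>M. \<tau> \<rho> a \<odot> (X' \<rho> \<sigma> \<otimes> Y' \<sigma> \<alpha>))"
    by (intro finsum_cong', simp) (auto simp: cl finsum_ldistr smult_mult intro!: finsum_cong')
  also have "\<dots> = (\<Oplus>\<rho>\<in>M. \<Oplus>\<sigma>\<in>M. \<tau> \<rho> a \<odot> (X' \<rho> \<sigma> \<otimes> Y' \<sigma> \<alpha>))"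
    by (intro finsum_swap) (auto simp: cl)
  also have "\<dots> = (\<Oplus>\<sigma>\<in>M. \<tau> \<sigma> a \<odot> (\<Oplus>\<rho>\<in>M. X' \<sigma> \<rho> \<otimes> Y' \<rho> \<alpha>))"
    by (intro finsum_cong', simp) (auto simp: cl smult_finsum)
  finally show ?thesis .
qed

text \<open>Composites of bracket-preserving maps preserve the brackets. The Kronecker powers of the product
  of two matrices are the products of the Kronecker powers.\<close>

lemma structure_matrix_product:
  assumes V: "structure_matrix A n \<tau> \<omega> V" and W: "structure_matrix A n \<tau> \<omega> W"
  shows "structure_matrix A n \<tau> \<omega> (\<lambda>i j. \<Oplus>s\<in>{1..n}. V i s \<otimes> W s j)"
proof -
  let ?N = "{1..n}"
  let ?Z = "\<lambda>i j. \<Oplus>s\<in>?N. V i s \<otimes> W s j"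
  define V2 where "V2 \<sigma> \<alpha> = V (fst \<sigma>) (fst \<alpha>) \<otimes> V (snd \<sigma>) (snd \<alpha>)" for \<sigma> \<alpha> :: "nat \<times> nat"
  define W2 where "W2 \<sigma> \<alpha> = W (fst \<sigma>) (fst \<alpha>) \<otimes> W (snd \<sigma>) (snd \<alpha>)" for \<sigma> \<alpha> :: "nat \<times> nat"
  define V3 where "V3 \<sigma> \<alpha> = V (fst \<sigma>) (fst \<alpha>) \<otimes> V2 (snd \<sigma>) (snd \<alpha>)" for \<sigma> \<alpha> :: "nat \<times> nat \<times> nat"
  define W3 where "W3 \<sigma> \<alpha> = W (fst \<sigma>) (fst \<alpha>) \<otimes> W2 (snd \<sigma>) (snd \<alpha>)" for \<sigma> \<alpha> :: "nat \<times> nat \<times> nat"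
  have cV: "V s i \<in> carrier A" if "s \<in> ?N" "i \<in> ?N" for s i
    using V that unfolding structure_matrix_def by blast
  have cW: "W s i \<in> carrier A" if "s \<in> ?N" "i \<in> ?N" for s i
    using W that unfolding structure_matrix_def by blast
  have cZ: "?Z s i \<in> carrier A" if "s \<in> ?N" "i \<in> ?N" for s i
    using that cV cW by (intro finsum_closed) auto
  have c2: "V2 \<sigma> \<alpha> \<in> carrier A" "W2 \<sigma> \<alpha> \<in> carrier A"
    if "\<sigma> \<in> ?N \<times> ?N" "\<alpha> \<in> ?N \<times> ?N" for \<sigma> \<alpha>
    using that cV cW by (auto simp: V2_def W2_def)
  have c3: "V3 \<sigma> \<alpha> \<in> carrier A" "W3 \<sigma> \<alpha> \<in> carrier A"
    if "\<sigma> \<in> ?N \<times> ?N \<times> ?N" "\<alpha> \<in> ?N \<times> ?N \<times> ?N" for \<sigma> \<alpha>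
    using that cV cW c2 by (auto simp: V3_def W3_def)
  have mult4: "(x \<otimes> y) \<otimes> (z \<otimes> w) = (x \<otimes> z) \<otimes> (y \<otimes> w)"
    if "x \<in> carrier A" "y \<in> carrier A" "z \<in> carrier A" "w \<in> carrier A" for x y z w
    using that by (simp add: m_ac)
  have Z2: "?Z (fst \<sigma>) (fst \<alpha>) \<otimes> ?Z (snd \<sigma>) (snd \<alpha>) = (\<Oplus>\<rho>\<in>?N \<times> ?N. V2 \<sigma> \<rho> \<otimes> W2 \<rho> \<alpha>)"
    if "\<sigma> \<in> ?N \<times> ?N" "\<alpha> \<in> ?N \<times> ?N" for \<sigma> \<alpha>
  proof -
    have "?Z (fst \<sigma>) (fst \<alpha>) \<otimes> ?Z (snd \<sigma>) (snd \<alpha>) = (\<Oplus>\<rho>\<in>?N \<times> ?N.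
        (V (fst \<sigma>) (fst \<rho>) \<otimes> W (fst \<rho>) (fst \<alpha>)) \<otimes> (V (snd \<sigma>) (snd \<rho>) \<otimes> W (snd \<rho>) (snd \<alpha>)))"
      using that cV cW by (intro finsum_product) auto
    also have "\<dots> = (\<Oplus>\<rho>\<in>?N \<times> ?N. V2 \<sigma> \<rho> \<otimes> W2 \<rho> \<alpha>)"
      unfolding V2_def W2_def using that by (intro finsum_cong' mult4) (auto intro!: cV cW m_closed)
    finally show ?thesis .
  qed
  have Z3: "?Z (fst \<sigma>) (fst \<alpha>) \<otimes> (?Z (fst (snd \<sigma>)) (fst (snd \<alpha>)) \<otimes> ?Z (snd (snd \<sigma>)) (snd (snd \<alpha>))) =
      (\<Oplus>\<rho>\<in>?N \<times> ?N \<times> ?N. V3 \<sigma> \<rho> \<otimes> W3 \<rho> \<alpha>)"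
    if "\<sigma> \<in> ?N \<times> ?N \<times> ?N" "\<alpha> \<in> ?N \<times> ?N \<times> ?N" for \<sigma> \<alpha>
  proof -
    have \<sigma>\<alpha>: "snd \<sigma> \<in> ?N \<times> ?N" "snd \<alpha> \<in> ?N \<times> ?N" using that by auto
    have "?Z (fst \<sigma>) (fst \<alpha>) \<otimes> (\<Oplus>\<rho>\<in>?N \<times> ?N. V2 (snd \<sigma>) \<rho> \<otimes> W2 \<rho> (snd \<alpha>)) = (\<Oplus>\<rho>\<in>?N \<times> ?N \<times> ?N.
        (V (fst \<sigma>) (fst \<rho>) \<otimes> W (fst \<rho>) (fst \<alpha>)) \<otimes> (V2 (snd \<sigma>) (snd \<rho>) \<otimes> W2 (snd \<rho>) (snd \<alpha>)))"
      using that cV cW c2 by (intro finsum_product) auto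
    also have "\<dots> = (\<Oplus>\<rho>\<in>?N \<times> ?N \<times> ?N. V3 \<sigma> \<rho> \<otimes> W3 \<rho> \<alpha>)"
      unfolding V3_def W3_def using that by (intro finsum_cong' mult4) (auto intro!: cV cW c2 m_closed)
    finally show ?thesis unfolding Z2[OF \<sigma>\<alpha>] .
  qed
  have eqV2: "(\<Oplus>u\<in>?N. \<tau> (fst \<alpha>) (snd \<alpha>) u \<odot> V a u) =
      (\<Oplus>\<sigma>\<in>?N \<times> ?N. \<tau> (fst \<sigma>) (snd \<sigma>) a \<odot> V2 \<sigma> \<alpha>)"
    if "a \<in> ?N" "\<alpha> \<in> ?N \<times> ?N" for a \<alpha>
    using V that unfolding structure_matrix_def V2_def by (auto simp: case_prod_unfold)
  have eqW2: "(\<Oplus>u\<in>?N. \<tau> (fst \<alpha>) (snd \<alpha>) u \<odot> W a u) =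
      (\<Oplus>\<sigma>\<in>?N \<times> ?N. \<tau> (fst \<sigma>) (snd \<sigma>) a \<odot> W2 \<sigma> \<alpha>)"
    if "a \<in> ?N" "\<alpha> \<in> ?N \<times> ?N" for a \<alpha>
    using W that unfolding structure_matrix_def W2_def by (auto simp: case_prod_unfold)
  have eqV3: "(\<Oplus>u\<in>?N. \<omega> (fst \<alpha>) (fst (snd \<alpha>)) (snd (snd \<alpha>)) u \<odot> V a u) =
      (\<Oplus>\<sigma>\<in>?N \<times> ?N \<times> ?N. \<omega> (fst \<sigma>) (fst (snd \<sigma>)) (snd (snd \<sigma>)) a \<odot> V3 \<sigma> \<alpha>)"
    if "a \<in> ?N" "\<alpha> \<in> ?N \<times> ?N \<times> ?N" for a \<alpha>
    using V that unfolding structure_matrix_def V3_def V2_def by (auto simp: case_prod_unfold)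
  have eqW3: "(\<Oplus>u\<in>?N. \<omega> (fst \<alpha>) (fst (snd \<alpha>)) (snd (snd \<alpha>)) u \<odot> W a u) =
      (\<Oplus>\<sigma>\<in>?N \<times> ?N \<times> ?N. \<omega> (fst \<sigma>) (fst (snd \<sigma>)) (snd (snd \<sigma>)) a \<odot> W3 \<sigma> \<alpha>)"
    if "a \<in> ?N" "\<alpha> \<in> ?N \<times> ?N \<times> ?N" for a \<alpha>
    using W that unfolding structure_matrix_def W3_def W2_def by (auto simp: case_prod_unfold)
  have "(\<Oplus>u\<in>?N. \<tau> (fst \<alpha>) (snd \<alpha>) u \<odot> ?Z a u) =
      (\<Oplus>\<sigma>\<in>?N \<times> ?N. \<tau> (fst \<sigma>) (snd \<sigma>) a \<odot> (?Z (fst \<sigma>) (fst \<alpha>) \<otimes> ?Z (snd \<sigma>) (snd \<alpha>)))"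
    if a: "a \<in> ?N" and \<alpha>: "\<alpha> \<in> ?N \<times> ?N" for a \<alpha>
  proof -
    have "(\<Oplus>u\<in>?N. \<tau> (fst \<alpha>) (snd \<alpha>) u \<odot> ?Z a u) =
        (\<Oplus>\<sigma>\<in>?N \<times> ?N. \<tau> (fst \<sigma>) (snd \<sigma>) a \<odot> (\<Oplus>\<rho>\<in>?N \<times> ?N. V2 \<sigma> \<rho> \<otimes> W2 \<rho> \<alpha>))"
      by (rule intertwining_product[where \<tau> = "\<lambda>\<alpha>. \<tau> (fst \<alpha>) (snd \<alpha>)"])
        (fact cV cW c2 eqV2 eqW2 a \<alpha> | simp)+
    also have "\<dots> = (\<Oplus>\<sigma>\<in>?N \<times> ?N. \<tau> (fst \<sigma>) (snd \<sigma>) a \<odot>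
        (?Z (fst \<sigma>) (fst \<alpha>) \<otimes> ?Z (snd \<sigma>) (snd \<alpha>)))"
    proof (intro finsum_cong' refl funcsetI)
      fix \<sigma> assume \<sigma>: "\<sigma> \<in> ?N \<times> ?N"
      show "\<tau> (fst \<sigma>) (snd \<sigma>) a \<odot> (\<Oplus>\<rho>\<in>?N \<times> ?N. V2 \<sigma> \<rho> \<otimes> W2 \<rho> \<alpha>) =
          \<tau> (fst \<sigma>) (snd \<sigma>) a \<odot> (?Z (fst \<sigma>) (fst \<alpha>) \<otimes> ?Z (snd \<sigma>) (snd \<alpha>))"
        by (simp only: Z2[OF \<sigma> \<alpha>])
      show "\<tau> (fst \<sigma>) (snd \<sigma>) a \<odot> (?Z (fst \<sigma>) (fst \<alpha>) \<otimes> ?Z (snd \<sigma>) (snd \<alpha>)) \<in> carrier A"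
        using \<sigma> \<alpha> by (intro smult_closed m_closed cZ) auto
    qed
    finally show ?thesis .
  qed
  moreover have "(\<Oplus>u\<in>?N. \<omega> (fst \<alpha>) (fst (snd \<alpha>)) (snd (snd \<alpha>)) u \<odot> ?Z a u) =
      (\<Oplus>\<sigma>\<in>?N \<times> ?N \<times> ?N. \<omega> (fst \<sigma>) (fst (snd \<sigma>)) (snd (snd \<sigma>)) a \<odot> (?Z (fst \<sigma>) (fst \<alpha>) \<otimes>
        (?Z (fst (snd \<sigma>)) (fst (snd \<alpha>)) \<otimes> ?Z (snd (snd \<sigma>)) (snd (snd \<alpha>)))))"
    if a: "a \<in> ?N" and \<alpha>: "\<alpha> \<in> ?N \<times> ?N \<times> ?N" for a \<alpha>
  proof -
    have "(\<Oplus>u\<in>?N. \<omega> (fst \<alpha>) (fst (snd \<alpha>)) (snd (snd \<alpha>)) u \<odot> ?Z a u) =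
        (\<Oplus>\<sigma>\<in>?N \<times> ?N \<times> ?N. \<omega> (fst \<sigma>) (fst (snd \<sigma>)) (snd (snd \<sigma>)) a \<odot>
          (\<Oplus>\<rho>\<in>?N \<times> ?N \<times> ?N. V3 \<sigma> \<rho> \<otimes> W3 \<rho> \<alpha>))"
      by (rule intertwining_product[where \<tau> = "\<lambda>\<alpha>. \<omega> (fst \<alpha>) (fst (snd \<alpha>)) (snd (snd \<alpha>))"])
        (fact cV cW c3 eqV3 eqW3 a \<alpha> | simp)+
    also have "\<dots> = (\<Oplus>\<sigma>\<in>?N \<times> ?N \<times> ?N. \<omega> (fst \<sigma>) (fst (snd \<sigma>)) (snd (snd \<sigma>)) a \<odot>
        (?Z (fst \<sigma>) (fst \<alpha>) \<otimes>
          (?Z (fst (snd \<sigma>)) (fst (snd \<alpha>)) \<otimes> ?Z (snd (snd \<sigma>)) (snd (snd \<alpha>)))))"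
    proof (intro finsum_cong' refl funcsetI)
      fix \<sigma> assume \<sigma>: "\<sigma> \<in> ?N \<times> ?N \<times> ?N"
      show "\<omega> (fst \<sigma>) (fst (snd \<sigma>)) (snd (snd \<sigma>)) a \<odot> (\<Oplus>\<rho>\<in>?N \<times> ?N \<times> ?N. V3 \<sigma> \<rho> \<otimes> W3 \<rho> \<alpha>) =
          \<omega> (fst \<sigma>) (fst (snd \<sigma>)) (snd (snd \<sigma>)) a \<odot> (?Z (fst \<sigma>) (fst \<alpha>) \<otimes>
            (?Z (fst (snd \<sigma>)) (fst (snd \<alpha>)) \<otimes> ?Z (snd (snd \<sigma>)) (snd (snd \<alpha>))))"
        by (simp only: Z3[OF \<sigma> \<alpha>])
      show "\<omega> (fst \<sigma>) (fst (snd \<sigma>)) (snd (snd \<sigma>)) a \<odot> (?Z (fst \<sigma>) (fst \<alpha>) \<otimes>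
            (?Z (fst (snd \<sigma>)) (fst (snd \<alpha>)) \<otimes> ?Z (snd (snd \<sigma>)) (snd (snd \<alpha>)))) \<in> carrier A"
        using \<sigma> \<alpha> by (intro smult_closed m_closed cZ) auto
    qed
    finally show ?thesis .
  qed
  ultimately show ?thesis
    unfolding structure_matrix_def using cZ by (auto simp: case_prod_unfold)
qed

end

text \<open>A binary and a ternary operation together with a family of vectors \<open>e\<close>. The universal algebra of
  these data is \<open>U\<close>, with generators \<open>x s i\<close>.\<close>

locale structure_constants =
  fixes scale :: "'k::field \<Rightarrow> 'v::ab_group_add \<Rightarrow> 'v"
    and br :: "'v \<Rightarrow> 'v \<Rightarrow> 'v" and tr :: "'v \<Rightarrow> 'v \<Rightarrow> 'v \<Rightarrow> 'v"
    and n :: nat and e :: "nat \<Rightarrow> 'v"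
begin

abbreviation "\<tau> \<equiv> br_coeff scale br n e"
abbreviation "\<omega> \<equiv> tr_coeff scale tr n e"
abbreviation "U \<equiv> univ_algebra scale br tr n e"
abbreviation "x \<equiv> univ_gen scale br tr n e"

text \<open>The generators of the ideal of relations.\<close>

definition br_relation :: "nat \<Rightarrow> nat \<Rightarrow> nat \<Rightarrow> 'k poly2"
  where "br_relation a i j = (\<Sum>u=1..n. pconst (\<tau> i j u) * pvar a u) -
    (\<Sum>s=1..n. \<Sum>t=1..n. pconst (\<tau> s t a) * pvar s i * pvar t j)"

definition tr_relation :: "nat \<Rightarrow> nat \<Rightarrow> nat \<Rightarrow> nat \<Rightarrow> 'k poly2"
  where "tr_relation a i j k = (\<Sum>u=1..n. pconst (\<omega> i j k u) * pvar a u) -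
    (\<Sum>r=1..n. \<Sum>s=1..n. \<Sum>t=1..n. pconst (\<omega> r s t a) * pvar r i * pvar s j * pvar t k)"

definition relations :: "'k poly2 set"
  where "relations = {br_relation a i j | a i j. a \<in> {1..n} \<and> i \<in> {1..n} \<and> j \<in> {1..n}} \<union>
    {tr_relation a i j k | a i j k. a \<in> {1..n} \<and> i \<in> {1..n} \<and> j \<in> {1..n} \<and> k \<in> {1..n}}"

lemma univ_ideal_relations: "univ_ideal scale br tr n e = Idl\<^bsub>poly_algebra n\<^esub> relations"
  by (simp add: univ_ideal_def relations_def br_relation_def tr_relation_def)

lemma relations_closed: "relations \<subseteq> carrier (poly_algebra n)"
  unfolding relations_def br_relation_def tr_relation_def
  by (auto simp del: atLeastAtMost_iff
      intro!: poly_algebra_closed poly_algebra_sum_closed poly_algebra_basic_closed)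

lemma univ_ideal: "ideal (univ_ideal scale br tr n e) (poly_algebra n)"
proof -
  interpret commutative_algebra "poly_algebra n :: ('k, 'k poly2) module"
    by (rule poly_algebra_commutative_algebra)
  show ?thesis unfolding univ_ideal_relations by (rule genideal_ideal[OF relations_closed])
qed

lemma univ_algebra_commutative_algebra: "commutative_algebra U"
  unfolding univ_algebra_def
  by (rule commutative_algebra.commutative_algebra_quotient[OF poly_algebra_commutative_algebra univ_ideal])

lemma univ_proj_alg_hom:
  "(\<lambda>p. univ_ideal scale br tr n e +>\<^bsub>poly_algebra n\<^esub> p) \<in>
    alg_hom (poly_algebra n) U"
  unfolding univ_algebra_def
  by (rule commutative_algebra.quotient_proj_alg_hom[OF poly_algebra_commutative_algebra univ_ideal])

text \<open>Morphisms from the polynomial algebra that vanish on the relations correspond to structure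
  matrices.\<close>

lemma kills_relations_iff:
  assumes T: "commutative_algebra T" and g: "g \<in> alg_hom (poly_algebra n) T"
  shows "(\<forall>p\<in>relations. g p = \<zero>\<^bsub>T\<^esub>) \<longleftrightarrow> structure_matrix T n \<tau> \<omega> (\<lambda>s i. g (pvar s i))"
proof -
  interpret T: commutative_algebra T by fact
  let ?P = "poly_algebra n :: ('k, 'k poly2) module" and ?N = "{1..n}"
  note P = poly_algebra_commutative_algebra[of n]
  note gD = alg_homD[OF g, simplified]
  have cl: "g (pvar s i) \<in> carrier T" if "s \<in> ?N" "i \<in> ?N" for s i
    using that by (intro gD(1) poly_algebra_basic_closed)
  have gconst: "g (pconst c) = c \<odot>\<^bsub>T\<^esub> \<one>\<^bsub>T\<^esub>" for c using gD(5)[of 1 c] gD(4) by simp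
  have gsum: "g (sum f S) = (\<Oplus>\<^bsub>T\<^esub>s\<in>S. g (f s))" if "\<And>s. s \<in> S \<Longrightarrow> f s \<in> carrier ?P"
    for f and S :: "'z set"
    using alg_hom_finsum[OF g P T, of f S] that finsum_poly_algebra[of f S n] by (simp add: Pi_def)
  have gminus: "g (p - q) = \<zero>\<^bsub>T\<^esub> \<longleftrightarrow> g p = g q" if "p \<in> carrier ?P" "q \<in> carrier ?P" for p q
  proof -
    have "g (p - q) = g p \<ominus>\<^bsub>T\<^esub> g q" using alg_hom_minus[OF g P T that] that
      by (simp add: poly_algebra_minus)
    moreover have "g p \<ominus>\<^bsub>T\<^esub> g q = \<zero>\<^bsub>T\<^esub> \<longleftrightarrow> g p = g q"
      using gD(1)[OF that(1)] gD(1)[OF that(2)]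
      by (metis T.minus_equality T.minus_minus T.a_inv_closed T.r_neg a_minus_def)
    ultimately show ?thesis by simp
  qed
  have lin: "g (\<Sum>u=1..n. pconst (c u) * pvar a u) = (\<Oplus>\<^bsub>T\<^esub>u\<in>?N. c u \<odot>\<^bsub>T\<^esub> g (pvar a u))"
    "(\<Sum>u=1..n. pconst (c u) * pvar a u) \<in> carrier ?P"
    if "a \<in> ?N" for a c
  proof -
    have v: "pvar a u \<in> carrier ?P" if "u \<in> ?N" for u
      using \<open>a \<in> ?N\<close> that by (rule poly_algebra_basic_closed)
    show "(\<Sum>u=1..n. pconst (c u) * pvar a u) \<in> carrier ?P"
      using v by (intro poly_algebra_sum_closed poly_algebra_closed poly_algebra_basic_closed(3)) blast
    have "g (\<Sum>u=1..n. pconst (c u) * pvar a u) = (\<Oplus>\<^bsub>T\<^esub>u\<in>?N. g (pconst (c u) * pvar a u))"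
      using v by (subst gsum) auto
    also have "\<dots> = (\<Oplus>\<^bsub>T\<^esub>u\<in>?N. c u \<odot>\<^bsub>T\<^esub> g (pvar a u))"
      using v by (intro T.finsum_cong') (auto simp: gD gconst T.smult_mult)
    finally show "g (\<Sum>u=1..n. pconst (c u) * pvar a u) = (\<Oplus>\<^bsub>T\<^esub>u\<in>?N. c u \<odot>\<^bsub>T\<^esub> g (pvar a u))" .
  qed
  have quad: "g (\<Sum>s=1..n. \<Sum>t=1..n. pconst (c s t) * pvar s i * pvar t j) =
      (\<Oplus>\<^bsub>T\<^esub>\<sigma>\<in>?N \<times> ?N. c (fst \<sigma>) (snd \<sigma>) \<odot>\<^bsub>T\<^esub> (g (pvar (fst \<sigma>) i) \<otimes>\<^bsub>T\<^esub> g (pvar (snd \<sigma>) j)))"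
    "(\<Sum>s=1..n. \<Sum>t=1..n. pconst (c s t) * pvar s i * pvar t j) \<in> carrier ?P"
    if ij: "i \<in> ?N" "j \<in> ?N" for i j c
  proof -
    have v: "pvar u i \<in> carrier ?P" "pvar u j \<in> carrier ?P" if "u \<in> ?N" for u
      using that ij by (auto intro!: poly_algebra_basic_closed )
    have "(\<Sum>s=1..n. \<Sum>t=1..n. pconst (c s t) * pvar s i * pvar t j) =
      (\<Sum>\<sigma>\<in>?N \<times> ?N. pconst (c (fst \<sigma>) (snd \<sigma>)) * (pvar (fst \<sigma>) i * pvar (snd \<sigma>) j))"
      by (simp add: sum.cartesian_product case_prod_unfold mult.assoc)
    moreover have "g \<dots> = (\<Oplus>\<^bsub>T\<^esub>\<sigma>\<in>?N \<times> ?N. g (pconst (c (fst \<sigma>) (snd \<sigma>)) * (pvar (fst \<sigma>) i * pvar (snd \<sigma>) j)))"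
      using v by (subst gsum) auto
    moreover have "\<dots> = (\<Oplus>\<^bsub>T\<^esub>\<sigma>\<in>?N \<times> ?N. c (fst \<sigma>) (snd \<sigma>) \<odot>\<^bsub>T\<^esub> (g (pvar (fst \<sigma>) i) \<otimes>\<^bsub>T\<^esub> g (pvar (snd \<sigma>) j)))"
      using v by (intro T.finsum_cong') (auto simp: gD gconst T.smult_mult)
    ultimately show "g (\<Sum>s=1..n. \<Sum>t=1..n. pconst (c s t) * pvar s i * pvar t j) =
      (\<Oplus>\<^bsub>T\<^esub>\<sigma>\<in>?N \<times> ?N. c (fst \<sigma>) (snd \<sigma>) \<odot>\<^bsub>T\<^esub> (g (pvar (fst \<sigma>) i) \<otimes>\<^bsub>T\<^esub> g (pvar (snd \<sigma>) j)))"
      by simp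
    show "(\<Sum>s=1..n. \<Sum>t=1..n. pconst (c s t) * pvar s i * pvar t j) \<in> carrier ?P"
      using v by (intro poly_algebra_sum_closed poly_algebra_closed poly_algebra_basic_closed(3)) blast+
  qed
  have cub: "g (\<Sum>r=1..n. \<Sum>s=1..n. \<Sum>t=1..n. pconst (c r s t) * pvar r i * pvar s j * pvar t k) =
      (\<Oplus>\<^bsub>T\<^esub>\<sigma>\<in>?N \<times> ?N \<times> ?N. c (fst \<sigma>) (fst (snd \<sigma>)) (snd (snd \<sigma>)) \<odot>\<^bsub>T\<^esub>
        (g (pvar (fst \<sigma>) i) \<otimes>\<^bsub>T\<^esub> (g (pvar (fst (snd \<sigma>)) j) \<otimes>\<^bsub>T\<^esub> g (pvar (snd (snd \<sigma>)) k))))"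
    "(\<Sum>r=1..n. \<Sum>s=1..n. \<Sum>t=1..n. pconst (c r s t) * pvar r i * pvar s j * pvar t k) \<in> carrier ?P"
    if ij: "i \<in> ?N" "j \<in> ?N" "k \<in> ?N" for i j k c
  proof -
    have v: "pvar u i \<in> carrier ?P" "pvar u j \<in> carrier ?P" "pvar u k \<in> carrier ?P" if "u \<in> ?N" for u
      using that ij by (auto intro!: poly_algebra_basic_closed )
    have "(\<Sum>r=1..n. \<Sum>s=1..n. \<Sum>t=1..n. pconst (c r s t) * pvar r i * pvar s j * pvar t k) =
      (\<Sum>\<sigma>\<in>?N \<times> ?N \<times> ?N. pconst (c (fst \<sigma>) (fst (snd \<sigma>)) (snd (snd \<sigma>))) *
        (pvar (fst \<sigma>) i * (pvar (fst (snd \<sigma>)) j * pvar (snd (snd \<sigma>)) k)))"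
      by (simp add: sum.cartesian_product case_prod_unfold mult.assoc)
    moreover have "g \<dots> = (\<Oplus>\<^bsub>T\<^esub>\<sigma>\<in>?N \<times> ?N \<times> ?N. g (pconst (c (fst \<sigma>) (fst (snd \<sigma>)) (snd (snd \<sigma>))) *
        (pvar (fst \<sigma>) i * (pvar (fst (snd \<sigma>)) j * pvar (snd (snd \<sigma>)) k))))"
      using v by (subst gsum) auto
    moreover have "\<dots> = (\<Oplus>\<^bsub>T\<^esub>\<sigma>\<in>?N \<times> ?N \<times> ?N. c (fst \<sigma>) (fst (snd \<sigma>)) (snd (snd \<sigma>)) \<odot>\<^bsub>T\<^esub>
        (g (pvar (fst \<sigma>) i) \<otimes>\<^bsub>T\<^esub> (g (pvar (fst (snd \<sigma>)) j) \<otimes>\<^bsub>T\<^esub> g (pvar (snd (snd \<sigma>)) k))))"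
      using v by (intro T.finsum_cong') (auto simp: gD gconst T.smult_mult)
    ultimately show "g (\<Sum>r=1..n. \<Sum>s=1..n. \<Sum>t=1..n. pconst (c r s t) * pvar r i * pvar s j * pvar t k) =
      (\<Oplus>\<^bsub>T\<^esub>\<sigma>\<in>?N \<times> ?N \<times> ?N. c (fst \<sigma>) (fst (snd \<sigma>)) (snd (snd \<sigma>)) \<odot>\<^bsub>T\<^esub>
        (g (pvar (fst \<sigma>) i) \<otimes>\<^bsub>T\<^esub> (g (pvar (fst (snd \<sigma>)) j) \<otimes>\<^bsub>T\<^esub> g (pvar (snd (snd \<sigma>)) k))))"
      by simp
    show "(\<Sum>r=1..n. \<Sum>s=1..n. \<Sum>t=1..n. pconst (c r s t) * pvar r i * pvar s j * pvar t k) \<in> carrier ?P"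
      using v by (intro poly_algebra_sum_closed poly_algebra_closed poly_algebra_basic_closed(3)) blast+
  qed
  have br: "g (br_relation a i j) = \<zero>\<^bsub>T\<^esub> \<longleftrightarrow>
      (\<Oplus>\<^bsub>T\<^esub>u\<in>?N. \<tau> i j u \<odot>\<^bsub>T\<^esub> g (pvar a u)) = (\<Oplus>\<^bsub>T\<^esub>\<sigma>\<in>?N \<times> ?N. \<tau> (fst \<sigma>) (snd \<sigma>) a \<odot>\<^bsub>T\<^esub>
        (g (pvar (fst \<sigma>) i) \<otimes>\<^bsub>T\<^esub> g (pvar (snd \<sigma>) j)))"
    if "a \<in> ?N" "i \<in> ?N" "j \<in> ?N" for a i j
    unfolding br_relation_def using that by (simp only: gminus lin quad)
  have tr: "g (tr_relation a i j k) = \<zero>\<^bsub>T\<^esub> \<longleftrightarrow>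
      (\<Oplus>\<^bsub>T\<^esub>u\<in>?N. \<omega> i j k u \<odot>\<^bsub>T\<^esub> g (pvar a u)) =
      (\<Oplus>\<^bsub>T\<^esub>\<sigma>\<in>?N \<times> ?N \<times> ?N. \<omega> (fst \<sigma>) (fst (snd \<sigma>)) (snd (snd \<sigma>)) a \<odot>\<^bsub>T\<^esub>
        (g (pvar (fst \<sigma>) i) \<otimes>\<^bsub>T\<^esub> (g (pvar (fst (snd \<sigma>)) j) \<otimes>\<^bsub>T\<^esub> g (pvar (snd (snd \<sigma>)) k))))"
    if "a \<in> ?N" "i \<in> ?N" "j \<in> ?N" "k \<in> ?N" for a i j k
    unfolding tr_relation_def using that by (simp only: gminus lin cub)
  have "(\<forall>p\<in>relations. g p = \<zero>\<^bsub>T\<^esub>) \<longleftrightarrow>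
      (\<forall>a\<in>?N. \<forall>i\<in>?N. \<forall>j\<in>?N. g (br_relation a i j) = \<zero>\<^bsub>T\<^esub>) \<and>
      (\<forall>a\<in>?N. \<forall>i\<in>?N. \<forall>j\<in>?N. \<forall>k\<in>?N. g (tr_relation a i j k) = \<zero>\<^bsub>T\<^esub>)"
    unfolding relations_def by blast
  also have "\<dots> \<longleftrightarrow> structure_matrix T n \<tau> \<omega> (\<lambda>s i. g (pvar s i))"
    unfolding structure_matrix_def using br tr cl by simp
  finally show ?thesis .
qed

lemma univ_gen_closed:
  "s \<in> {1..n} \<Longrightarrow> i \<in> {1..n} \<Longrightarrow>
    x s i \<in> carrier U"
  unfolding univ_gen_def by (rule alg_homD(1)[OF univ_proj_alg_hom poly_algebra_basic_closed(4)])

lemma univ_gen_structure_matrix: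
  "structure_matrix U n \<tau> \<omega> x"
proof -
  let ?P = "poly_algebra n :: ('k, 'k poly2) module"
  interpret P: commutative_algebra ?P by (rule poly_algebra_commutative_algebra)
  interpret I: ideal "univ_ideal scale br tr n e" ?P by (rule univ_ideal)
  have "univ_ideal scale br tr n e +>\<^bsub>?P\<^esub> p = \<zero>\<^bsub>U\<^esub>"
    if "p \<in> relations" for p
  proof -
    have "p \<in> univ_ideal scale br tr n e"
      unfolding univ_ideal_relations using that P.genideal_self[OF relations_closed] by blast
    then show ?thesis unfolding univ_algebra_def by (simp add: I.a_rcos_const)
  qed
  then show ?thesis
    using kills_relations_iff[OF univ_algebra_commutative_algebra univ_proj_alg_hom]
    unfolding univ_gen_def by blast
qed

text \<open>With \<open>univ_algebra_hom_eq\<close> this is the universal property: morphisms from the universal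
  algebra to \<open>T\<close> are the structure matrices over \<open>T\<close>.\<close>

lemma univ_algebra_hom_exists:
  assumes T: "commutative_algebra T" and V: "structure_matrix T n \<tau> \<omega> V"
  obtains h where "h \<in> alg_hom U T"
    "\<And>s i. s \<in> {1..n} \<Longrightarrow> i \<in> {1..n} \<Longrightarrow> h (x s i) = V s i"
proof -
  interpret T: commutative_algebra T by fact
  let ?P = "poly_algebra n :: ('k, 'k poly2) module" and ?I = "univ_ideal scale br tr n e"
  interpret P: commutative_algebra ?P by (rule poly_algebra_commutative_algebra)
  let ?g = "T.poly_value n (\<lambda>(s, i). V s i)"
  have v: "(\<lambda>(s, i). V s i) k \<in> carrier T" if "k \<in> {1..n} \<times> {1..n}" for k
    using V that unfolding structure_matrix_def by auto
  have g: "?g \<in> alg_hom ?P T" by (rule T.poly_value_alg_hom) (rule v)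
  have gv: "?g (pvar s i) = V s i" if "s \<in> {1..n}" "i \<in> {1..n}" for s i
    using T.poly_value_pvar[OF v that] by simp
  have "structure_matrix T n \<tau> \<omega> (\<lambda>s i. ?g (pvar s i)) \<longleftrightarrow> structure_matrix T n \<tau> \<omega> V"
    unfolding structure_matrix_def
    by (intro conj_cong ball_cong refl)
      (auto  simp: gv intro!: arg_cong2[where f = "(=)"] T.finsum_cong' v[of "(_, _)", simplified])
  then have "\<forall>p\<in>relations. ?g p = \<zero>\<^bsub>T\<^esub>" using kills_relations_iff[OF T g] V by blast
  then have "relations \<subseteq> a_kernel ?P T ?g"
    using relations_closed by (auto simp: a_kernel_def')
  moreover have "ideal (a_kernel ?P T ?g) ?P"
    by (rule ring_hom_ring.kernel_is_ideal, rule ring_hom_ringI2)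
      (use g in \<open>simp_all add: alg_hom_def P.ring_axioms T.ring_axioms\<close>)
  ultimately have "?I \<subseteq> a_kernel ?P T ?g"
    unfolding univ_ideal_relations by (intro P.genideal_minimal)
  then have kill: "?g p = \<zero>\<^bsub>T\<^esub>" if "p \<in> ?I" for p
    using that by (auto simp: a_kernel_def')
  obtain h where h: "h \<in> alg_hom (quotient_algebra ?P ?I) T"
      "\<And>p. p \<in> carrier ?P \<Longrightarrow> h (?I +>\<^bsub>?P\<^esub> p) = ?g p"
    using P.quotient_lift[OF univ_ideal T g kill] by blast
  show thesis
  proof (rule that)
    show "h \<in> alg_hom U T" using h(1) by (simp add: univ_algebra_def)
    show "h (x s i) = V s i" if "s \<in> {1..n}" "i \<in> {1..n}" for s i
      unfolding univ_gen_def h(2)[OF poly_algebra_basic_closed(4)[OF that]] by (rule gv[OF that])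
  qed
qed

lemma univ_algebra_hom_eq:
  assumes T: "commutative_algebra T"
    and g: "g \<in> alg_hom U T"
    and h: "h \<in> alg_hom U T"
    and eq: "\<And>s i. s \<in> {1..n} \<Longrightarrow> i \<in> {1..n} \<Longrightarrow>
      g (x s i) = h (x s i)"
    and y: "y \<in> carrier U"
  shows "g y = h y"
proof -
  let ?q = "\<lambda>p. univ_ideal scale br tr n e +>\<^bsub>poly_algebra n\<^esub> p"
  obtain p where p: "p \<in> carrier (poly_algebra n)" "y = ?q p"
    using y by (auto simp: univ_algebra_def a_rcosets_iff)
  have "g (?q p) = h (?q p)"
    using alg_hom_comp[OF univ_proj_alg_hom g] alg_hom_comp[OF univ_proj_alg_hom h] _ p(1)
    by (rule poly_algebra_hom_eq[OF T]) (use eq in \<open>simp add: univ_gen_def\<close>)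
  then show ?thesis using p by simp
qed

end

section \<open>Tensor products\<close>

lemma lookup_free_scale [simp]:
  "Poly_Mapping.lookup (free_scale c p) k = c * Poly_Mapping.lookup p k"
  by (simp add: free_scale_def map.rep_eq when_def)

lemma free_scale_single [simp]:
  "free_scale c (Poly_Mapping.single k d) = Poly_Mapping.single k (c * d)"
  by (rule poly_mapping_eqI) (simp add: lookup_single when_def)

text \<open>Formal linear combinations of elements of an index type.\<close>

interpretation free: vector_space "free_scale :: 'k::field \<Rightarrow> ('i \<Rightarrow>\<^sub>0 'k) \<Rightarrow> ('i \<Rightarrow>\<^sub>0 'k)"
  by unfold_locales (auto intro!: poly_mapping_eqI simp: lookup_add algebra_simps)

lemma keys_free_scale: "Poly_Mapping.keys (free_scale c p) \<subseteq> Poly_Mapping.keys p"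
  by (auto simp: in_keys_iff)

text \<open>The bilinear extension of \<open>(a, b) \<mapsto> f a * g b\<close> to formal combinations of pairs.\<close>

definition bilinear_value :: "('a \<Rightarrow> 'k::field) \<Rightarrow> ('b \<Rightarrow> 'k) \<Rightarrow> ('a \<times> 'b \<Rightarrow>\<^sub>0 'k) \<Rightarrow> 'k"
  where "bilinear_value f g p =
    (\<Sum>(a, b)\<in>Poly_Mapping.keys p. Poly_Mapping.lookup p (a, b) * f a * g b)"

lemma bilinear_value_add:
  "bilinear_value f g (p + q) = bilinear_value f g p + bilinear_value f g q"
  unfolding bilinear_value_def case_prod_unfold prod.collapse
  by (rule setsum_keys_plus_distrib) (simp_all add: distrib_right)

lemma bilinear_value_single [simp]:
  "bilinear_value f g (Poly_Mapping.single (a, b) c) = c * f a * g b"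
  by (simp add: bilinear_value_def)

lemma bilinear_value_zero [simp]: "bilinear_value f g 0 = 0"
  by (simp add: bilinear_value_def)

lemma bilinear_value_scale: "bilinear_value f g (free_scale c p) = c * bilinear_value f g p"
proof (induction p rule: poly_mapping_add_single_induct)
  case zero
  show ?case by simp
next
  case (add k d p)
  then show ?case
    by (cases k) (simp add: bilinear_value_add free.scale_right_distrib algebra_simps)
qed

lemma bilinear_value_minus:
  "bilinear_value f g (p - q) = bilinear_value f g p - bilinear_value f g q"
  using bilinear_value_add[of f g "p - q" q] by simp

lemma bilinear_value_sum: "bilinear_value f g (sum p S) = (\<Sum>s\<in>S. bilinear_value f g (p s))"
  by (induction S rule: infinite_finite_induct) (simp_all add: bilinear_value_add)

text \<open>Linear on the carrier, with arbitrary values elsewhere. The functionals \<open>evaluation at a\<close> on a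
  finite dual are of this kind, but they need not be in \<^const>\<open>linear_functionals\<close>.\<close>

definition linear_form_on :: "('k::field, 'a, 'm) module_scheme \<Rightarrow> ('a \<Rightarrow> 'k) \<Rightarrow> bool"
  where "linear_form_on A f \<longleftrightarrow>
    (\<forall>x\<in>carrier A. \<forall>y\<in>carrier A. f (x \<oplus>\<^bsub>A\<^esub> y) = f x + f y) \<and>
    (\<forall>c. \<forall>x\<in>carrier A. f (c \<odot>\<^bsub>A\<^esub> x) = c * f x)"

lemma alg_hom_linear_form: "f \<in> alg_hom A ground_algebra \<Longrightarrow> linear_form_on A f"
  by (simp add: linear_form_on_def alg_homD)

lemma bilinear_value_relations:
  assumes f: "linear_form_on A f" and g: "linear_form_on B g" and p: "p \<in> tensor_relations A B"
  shows "bilinear_value f g p = 0"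
  using p unfolding tensor_relations_def
proof (induction rule: free.span_induct)
  case base
  show ?case
    by (auto simp: free.subspace_def bilinear_value_add bilinear_value_scale)
next
  case (step p)
  then show ?case
    using f g unfolding linear_form_on_def
    by (auto simp: bilinear_value_minus distrib_left distrib_right mult_ac)
qed

text \<open>The cosets of the relations only involve the addition of formal sums, so they can be described for
  arbitrary \<open>A\<close> and \<open>B\<close>. This applies to the tensor square of a finite dual, of which only the
  vector space structure is needed.\<close>

lemma tensor_relations_coset:
  "tensor_relations A B +>\<^bsub>free_algebra A B\<^esub> p = (\<lambda>r. r + p) ` tensor_relations A B"
  by (auto simp: a_r_coset_def r_coset_def free_algebra_def)

lemma tensor_relations_subspace: "free.subspace (tensor_relations A B)"
  by (simp add: tensor_relations_def)

lemma tensor_relations_coset_eq_iff: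
  "tensor_relations A B +>\<^bsub>free_algebra A B\<^esub> p = tensor_relations A B +>\<^bsub>free_algebra A B\<^esub> q \<longleftrightarrow>
    p - q \<in> tensor_relations A B"
proof
  assume "tensor_relations A B +>\<^bsub>free_algebra A B\<^esub> p = tensor_relations A B +>\<^bsub>free_algebra A B\<^esub> q"
  moreover have "p \<in> tensor_relations A B +>\<^bsub>free_algebra A B\<^esub> p"
    unfolding tensor_relations_coset
    using free.subspace_0[OF tensor_relations_subspace] by (intro image_eqI[of _ _ 0]) auto
  ultimately show "p - q \<in> tensor_relations A B" by (auto simp: tensor_relations_coset)
next
  let ?R = "tensor_relations A B"
  assume pq: "p - q \<in> ?R"
  have "r + p \<in> (\<lambda>r. r + q) ` ?R" if "r \<in> ?R" for r
    using free.subspace_add[OF tensor_relations_subspace that pq]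
    by (intro image_eqI[of _ _ "r + (p - q)"]) auto
  moreover have "r + q \<in> (\<lambda>r. r + p) ` ?R" if "r \<in> ?R" for r
    using free.subspace_diff[OF tensor_relations_subspace that pq]
    by (intro image_eqI[of _ _ "r - (p - q)"]) auto
  ultimately show "?R +>\<^bsub>free_algebra A B\<^esub> p = ?R +>\<^bsub>free_algebra A B\<^esub> q"
    unfolding tensor_relations_coset by blast
qed

lemma free_algebra_carrier:
  "p \<in> carrier (free_algebra A B) \<longleftrightarrow> Poly_Mapping.keys p \<subseteq> carrier A \<times> carrier B"
  by (simp add: free_algebra_def)

lemma tensor_algebra_carrier:
  "t \<in> carrier (tensor_algebra A B) \<longleftrightarrow>
    (\<exists>p\<in>carrier (free_algebra A B). t = tensor_relations A B +>\<^bsub>free_algebra A B\<^esub> p)"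
  by (simp add: tensor_algebra_def a_rcosets_iff)

lemma tensor_functional_coset:
  assumes f: "linear_form_on A f" and g: "linear_form_on B g"
  shows "tensor_functional f g (tensor_relations A B +>\<^bsub>free_algebra A B\<^esub> p) = bilinear_value f g p"
proof -
  let ?t = "tensor_relations A B +>\<^bsub>free_algebra A B\<^esub> p"
  have "p \<in> ?t"
    unfolding tensor_relations_coset
    using free.subspace_0[OF tensor_relations_subspace] by (intro image_eqI[of _ _ 0]) auto
  moreover have "bilinear_value f g q = bilinear_value f g p" if "q \<in> ?t" for q
    using that bilinear_value_relations[OF f g]
    by (auto simp: tensor_relations_coset bilinear_value_add)
  ultimately have "(THE v. \<exists>q\<in>?t. v = bilinear_value f g q) = bilinear_value f g p"
    by (intro the_equality) blast+
  then show ?thesis by (simp add: tensor_functional_def bilinear_value_def)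
qed

lemma tensor_functional_tensor:
  assumes "linear_form_on A f" "linear_form_on B g"
  shows "tensor_functional f g (tensor A B a b) = f a * g b"
  unfolding tensor_def tensor_functional_coset[OF assms] by simp

lemma tensor_relations_intro:
  assumes "a \<in> carrier A" "b \<in> carrier B"
  shows "a' \<in> carrier A \<Longrightarrow> Poly_Mapping.single (a \<oplus>\<^bsub>A\<^esub> a', b) 1 - Poly_Mapping.single (a, b) 1 -
      Poly_Mapping.single (a', b) 1 \<in> tensor_relations A B"
    and "b' \<in> carrier B \<Longrightarrow> Poly_Mapping.single (a, b \<oplus>\<^bsub>B\<^esub> b') 1 - Poly_Mapping.single (a, b) 1 -
      Poly_Mapping.single (a, b') 1 \<in> tensor_relations A B"
    and "Poly_Mapping.single (c \<odot>\<^bsub>A\<^esub> a, b) 1 - Poly_Mapping.single (a, b) c \<in> tensor_relations A B"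
    and "Poly_Mapping.single (a, c \<odot>\<^bsub>B\<^esub> b) 1 - Poly_Mapping.single (a, b) c \<in> tensor_relations A B"
  unfolding tensor_relations_def using assms by (intro free.span_base; blast)+

lemma free_algebra_simps [simp]:
  "p \<oplus>\<^bsub>free_algebra A B\<^esub> q = p + q" "\<zero>\<^bsub>free_algebra A B\<^esub> = 0"
  "\<one>\<^bsub>free_algebra A B\<^esub> = Poly_Mapping.single (\<one>\<^bsub>A\<^esub>, \<one>\<^bsub>B\<^esub>) 1"
  "c \<odot>\<^bsub>free_algebra A B\<^esub> p = free_scale c p"
  by (simp_all add: free_algebra_def)

lemma free_algebra_mult:
  "p \<otimes>\<^bsub>free_algebra A B\<^esub> q = (\<Sum>k\<in>Poly_Mapping.keys p. \<Sum>l\<in>Poly_Mapping.keys q.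
    Poly_Mapping.single (fst k \<otimes>\<^bsub>A\<^esub> fst l, snd k \<otimes>\<^bsub>B\<^esub> snd l)
      (Poly_Mapping.lookup p k * Poly_Mapping.lookup q l))"
  by (simp add: free_algebra_def case_prod_unfold)

lemma free_algebra_distrib:
  "(p + q) \<otimes>\<^bsub>free_algebra A B\<^esub> r = p \<otimes>\<^bsub>free_algebra A B\<^esub> r + q \<otimes>\<^bsub>free_algebra A B\<^esub> r"
  "r \<otimes>\<^bsub>free_algebra A B\<^esub> (p + q) = r \<otimes>\<^bsub>free_algebra A B\<^esub> p + r \<otimes>\<^bsub>free_algebra A B\<^esub> q"
proof -
  show "(p + q) \<otimes>\<^bsub>free_algebra A B\<^esub> r = p \<otimes>\<^bsub>free_algebra A B\<^esub> r + q \<otimes>\<^bsub>free_algebra A B\<^esub> r"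
    unfolding free_algebra_mult
    by (rule setsum_keys_plus_distrib) (simp_all add: distrib_right single_add sum.distrib)
  show "r \<otimes>\<^bsub>free_algebra A B\<^esub> (p + q) = r \<otimes>\<^bsub>free_algebra A B\<^esub> p + r \<otimes>\<^bsub>free_algebra A B\<^esub> q"
    unfolding free_algebra_mult sum.distrib[symmetric]
    by (intro sum.cong refl, rule setsum_keys_plus_distrib) (simp_all add: distrib_left single_add)
qed

lemma free_algebra_mult_zero [simp]:
  "0 \<otimes>\<^bsub>free_algebra A B\<^esub> p = 0" "p \<otimes>\<^bsub>free_algebra A B\<^esub> 0 = 0"
  by (simp_all add: free_algebra_mult)

lemma free_algebra_mult_single:
  "Poly_Mapping.single (a, b) c \<otimes>\<^bsub>free_algebra A B\<^esub> Poly_Mapping.single (a', b') c' =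
    Poly_Mapping.single (a \<otimes>\<^bsub>A\<^esub> a', b \<otimes>\<^bsub>B\<^esub> b') (c * c')"
  by (simp add: free_algebra_mult)

lemma free_algebra_mult_minus:
  "r \<otimes>\<^bsub>free_algebra A B\<^esub> (p - q) = r \<otimes>\<^bsub>free_algebra A B\<^esub> p - r \<otimes>\<^bsub>free_algebra A B\<^esub> q"
  using free_algebra_distrib(2)[where r = r and p = "p - q" and q = q and A = A and B = B]
  by (simp add: algebra_simps)

lemma free_algebra_mult_scale:
  "free_scale c p \<otimes>\<^bsub>free_algebra A B\<^esub> q = free_scale c (p \<otimes>\<^bsub>free_algebra A B\<^esub> q)"
  "p \<otimes>\<^bsub>free_algebra A B\<^esub> free_scale c q = free_scale c (p \<otimes>\<^bsub>free_algebra A B\<^esub> q)"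
proof -
  have *: "Poly_Mapping.single k d \<otimes>\<^bsub>free_algebra A B\<^esub> free_scale c q =
      free_scale c (Poly_Mapping.single k d \<otimes>\<^bsub>free_algebra A B\<^esub> q) \<and>
      free_scale c (Poly_Mapping.single k d) \<otimes>\<^bsub>free_algebra A B\<^esub> q =
      free_scale c (Poly_Mapping.single k d \<otimes>\<^bsub>free_algebra A B\<^esub> q)" for k d
  proof (induction q rule: poly_mapping_add_single_induct)
    case zero
    show ?case by simp
  next
    case (add l b q)
    then show ?case
      by (cases k; cases l)
        (simp add: free_algebra_distrib free.scale_right_distrib free_algebra_mult_single mult_ac)
  qed
  have "free_scale c p \<otimes>\<^bsub>free_algebra A B\<^esub> q = free_scale c (p \<otimes>\<^bsub>free_algebra A B\<^esub> q) \<and>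
    p \<otimes>\<^bsub>free_algebra A B\<^esub> free_scale c q = free_scale c (p \<otimes>\<^bsub>free_algebra A B\<^esub> q)"
  proof (induction p rule: poly_mapping_add_single_induct)
    case zero
    show ?case by simp
  next
    case (add k b p)
    then show ?case
      using * by (simp add: free_algebra_distrib free.scale_right_distrib del: free_scale_single)
  qed
  then show "free_scale c p \<otimes>\<^bsub>free_algebra A B\<^esub> q = free_scale c (p \<otimes>\<^bsub>free_algebra A B\<^esub> q)"
    "p \<otimes>\<^bsub>free_algebra A B\<^esub> free_scale c q = free_scale c (p \<otimes>\<^bsub>free_algebra A B\<^esub> q)" by auto
qed

text \<open>Induction on the length of a formal sum over the two carriers; it reduces multilinear identities to
  pairs of elements.\<close>

lemma free_algebra_induct [consumes 1, case_names zero add]: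
  assumes "p \<in> carrier (free_algebra A B)"
    and "P 0"
    and "\<And>a b c p. a \<in> carrier A \<Longrightarrow> b \<in> carrier B \<Longrightarrow> p \<in> carrier (free_algebra A B) \<Longrightarrow> P p \<Longrightarrow>
      P (Poly_Mapping.single (a, b) c + p)"
  shows "P p"
  using assms(1)
proof (induction p rule: poly_mapping_add_single_induct)
  case zero
  show ?case by fact
next
  case (add k c p)
  have "Poly_Mapping.keys (Poly_Mapping.single k c + p) = insert k (Poly_Mapping.keys p)"
    using add(2,3) by (rule keys_single_add)
  then show ?case
    using add assms(3)[of "fst k" "snd k" p c] by (auto simp: free_algebra_carrier)
qed

lemma free_algebra_add_closed:
  "p \<in> carrier (free_algebra A B) \<Longrightarrow> q \<in> carrier (free_algebra A B) \<Longrightarrow>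
    p + q \<in> carrier (free_algebra A B)"
  using keys_add[of p q] by (auto simp: free_algebra_carrier)

lemma free_algebra_scale_closed:
  "p \<in> carrier (free_algebra A B) \<Longrightarrow> free_scale c p \<in> carrier (free_algebra A B)"
  using keys_free_scale[of c p] by (auto simp: free_algebra_carrier)

lemma free_algebra_single_closed:
  "a \<in> carrier A \<Longrightarrow> b \<in> carrier B \<Longrightarrow> Poly_Mapping.single (a, b) c \<in> carrier (free_algebra A B)"
  by (auto simp: free_algebra_carrier)

lemma free_algebra_zero_closed: "0 \<in> carrier (free_algebra A B)"
  by (simp add: free_algebra_carrier)

lemmas free_algebra_closed = free_algebra_add_closed free_algebra_scale_closed
  free_algebra_single_closed free_algebra_zero_closed

lemma free_algebra_subspace: "free.subspace (carrier (free_algebra A B))"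
  by (simp add: free.subspace_def free_algebra_closed)

text \<open>Two commutative algebras over the same field. The relations \<open>R\<close> form an ideal of the algebra \<open>F\<close> of
  formal sums of pairs, so the tensor product is a commutative algebra.\<close>

locale two_algebras = A: commutative_algebra A + B: commutative_algebra B
  for A :: "('k::field, 'a, 'm) module_scheme" and B :: "('k, 'b, 'n) module_scheme"
begin

abbreviation "F \<equiv> free_algebra A B"
abbreviation "R \<equiv> tensor_relations A B"

lemma free_mult_closed:
  assumes "p \<in> carrier F" "q \<in> carrier F"
  shows "p \<otimes>\<^bsub>F\<^esub> q \<in> carrier F"
proof -
  have *: "Poly_Mapping.single (a, b) c \<otimes>\<^bsub>F\<^esub> q \<in> carrier F" if "a \<in> carrier A" "b \<in> carrier B" for a b c
    using assms(2) that by (induction rule: free_algebra_induct)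
      (simp_all add: free_algebra_closed free_algebra_distrib free_algebra_mult_single)
  show ?thesis
    using assms(1) by (induction rule: free_algebra_induct)
      (simp_all add: free_algebra_closed free_algebra_distrib *)
qed

lemma free_mult_commute:
  assumes "p \<in> carrier F" "q \<in> carrier F"
  shows "p \<otimes>\<^bsub>F\<^esub> q = q \<otimes>\<^bsub>F\<^esub> p"
proof -
  have *: "Poly_Mapping.single (a, b) c \<otimes>\<^bsub>F\<^esub> q = q \<otimes>\<^bsub>F\<^esub> Poly_Mapping.single (a, b) c"
    if "a \<in> carrier A" "b \<in> carrier B" for a b c
    using assms(2) that
    by (induction rule: free_algebra_induct)
      (simp_all add: free_algebra_distrib free_algebra_mult_single A.m_comm B.m_comm mult.commute)
  show ?thesis
    using assms(1) by (induction rule: free_algebra_induct) (simp_all add: free_algebra_distrib *)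
qed

lemma free_mult_assoc:
  assumes "p \<in> carrier F" "q \<in> carrier F" "r \<in> carrier F"
  shows "p \<otimes>\<^bsub>F\<^esub> q \<otimes>\<^bsub>F\<^esub> r = p \<otimes>\<^bsub>F\<^esub> (q \<otimes>\<^bsub>F\<^esub> r)"
proof -
  have 1: "Poly_Mapping.single (a, b) c \<otimes>\<^bsub>F\<^esub> Poly_Mapping.single (a', b') c' \<otimes>\<^bsub>F\<^esub> r =
      Poly_Mapping.single (a, b) c \<otimes>\<^bsub>F\<^esub> (Poly_Mapping.single (a', b') c' \<otimes>\<^bsub>F\<^esub> r)"
    if "a \<in> carrier A" "b \<in> carrier B" "a' \<in> carrier A" "b' \<in> carrier B" for a b c a' b' c'
    using assms(3) that
    by (induction rule: free_algebra_induct)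
      (simp_all add: free_algebra_distrib free_algebra_mult_single A.m_assoc B.m_assoc mult.assoc)
  have 2: "Poly_Mapping.single (a, b) c \<otimes>\<^bsub>F\<^esub> q \<otimes>\<^bsub>F\<^esub> r = Poly_Mapping.single (a, b) c \<otimes>\<^bsub>F\<^esub> (q \<otimes>\<^bsub>F\<^esub> r)"
    if "a \<in> carrier A" "b \<in> carrier B" for a b c
    using assms(2) that
    by (induction rule: free_algebra_induct) (simp_all add: free_algebra_distrib 1)
  show ?thesis
    using assms(1) by (induction rule: free_algebra_induct) (simp_all add: free_algebra_distrib 2)
qed

lemma free_one_mult:
  assumes "p \<in> carrier F"
  shows "Poly_Mapping.single (\<one>\<^bsub>A\<^esub>, \<one>\<^bsub>B\<^esub>) 1 \<otimes>\<^bsub>F\<^esub> p = p"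
  using assms by (induction rule: free_algebra_induct)
    (simp_all add: free_algebra_distrib free_algebra_mult_single)

lemma free_commutative_algebra: "commutative_algebra F"
proof -
  have uminus: "- p \<in> carrier F" if "p \<in> carrier F" for p
    using free.subspace_neg[OF free_algebra_subspace that] .
  have "cring F"
    by (intro cringI abelian_groupI comm_monoidI)
      (auto simp: free_algebra_closed free_mult_closed free_mult_assoc free_one_mult
        free_algebra_distrib add_ac intro: free_mult_commute intro!: bexI[of _ "- _"] uminus)
  then show ?thesis
    unfolding commutative_algebra_def commutative_algebra_axioms_def
    by (auto simp: free_algebra_closed free.scale_left_distrib free.scale_right_distrib
        free_algebra_mult_scale)
qed

text \<open>Multiplying a bilinearity relation by a pair gives a multiple of a relation of the same kind.\<close>

lemma relations_mult_closed:
  assumes p: "p \<in> carrier F" and r: "r \<in> R"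
  shows "p \<otimes>\<^bsub>F\<^esub> r \<in> R"
proof -
  note sub = tensor_relations_subspace[of A B]
  have *: "Poly_Mapping.single (a, b) c \<otimes>\<^bsub>F\<^esub> r \<in> R" if ab: "a \<in> carrier A" "b \<in> carrier B" for a b c
    using r[unfolded tensor_relations_def]
  proof (induction rule: free.span_induct)
    case base
    show ?case
      using sub by (auto simp: free.subspace_def free_algebra_distrib free_algebra_mult_scale)
  next
    case (step r)
    {
      fix x x' y assume xy: "x \<in> carrier A" "x' \<in> carrier A" "y \<in> carrier B"
        and r: "r = Poly_Mapping.single (x \<oplus>\<^bsub>A\<^esub> x', y) 1 - Poly_Mapping.single (x, y) 1 - Poly_Mapping.single (x', y) 1"
      have "Poly_Mapping.single (a, b) c \<otimes>\<^bsub>F\<^esub> r = free_scale c (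
          Poly_Mapping.single (a \<otimes>\<^bsub>A\<^esub> x \<oplus>\<^bsub>A\<^esub> a \<otimes>\<^bsub>A\<^esub> x', b \<otimes>\<^bsub>B\<^esub> y) 1 - Poly_Mapping.single (a \<otimes>\<^bsub>A\<^esub> x, b \<otimes>\<^bsub>B\<^esub> y) 1 -
          Poly_Mapping.single (a \<otimes>\<^bsub>A\<^esub> x', b \<otimes>\<^bsub>B\<^esub> y) 1)"
        unfolding r using ab xy
        by (simp add: free_algebra_mult_minus free_algebra_mult_single A.r_distr
            free.scale_right_diff_distrib)
      moreover have "Poly_Mapping.single (a \<otimes>\<^bsub>A\<^esub> x \<oplus>\<^bsub>A\<^esub> a \<otimes>\<^bsub>A\<^esub> x', b \<otimes>\<^bsub>B\<^esub> y) 1 - Poly_Mapping.single (a \<otimes>\<^bsub>A\<^esub> x, b \<otimes>\<^bsub>B\<^esub> y) 1 -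
          Poly_Mapping.single (a \<otimes>\<^bsub>A\<^esub> x', b \<otimes>\<^bsub>B\<^esub> y) 1 \<in> R"
        using ab xy by (intro tensor_relations_intro(1)) auto
      ultimately have "Poly_Mapping.single (a, b) c \<otimes>\<^bsub>F\<^esub> r \<in> R"
        using free.subspace_scale[OF sub] by simp
    }
    moreover {
      fix x y y' assume xy: "x \<in> carrier A" "y \<in> carrier B" "y' \<in> carrier B"
        and r: "r = Poly_Mapping.single (x, y \<oplus>\<^bsub>B\<^esub> y') 1 - Poly_Mapping.single (x, y) 1 - Poly_Mapping.single (x, y') 1"
      have "Poly_Mapping.single (a, b) c \<otimes>\<^bsub>F\<^esub> r = free_scale c (
          Poly_Mapping.single (a \<otimes>\<^bsub>A\<^esub> x, b \<otimes>\<^bsub>B\<^esub> y \<oplus>\<^bsub>B\<^esub> b \<otimes>\<^bsub>B\<^esub> y') 1 - Poly_Mapping.single (a \<otimes>\<^bsub>A\<^esub> x, b \<otimes>\<^bsub>B\<^esub> y) 1 -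
          Poly_Mapping.single (a \<otimes>\<^bsub>A\<^esub> x, b \<otimes>\<^bsub>B\<^esub> y') 1)"
        unfolding r using ab xy
        by (simp add: free_algebra_mult_minus free_algebra_mult_single B.r_distr
            free.scale_right_diff_distrib)
      moreover have "Poly_Mapping.single (a \<otimes>\<^bsub>A\<^esub> x, b \<otimes>\<^bsub>B\<^esub> y \<oplus>\<^bsub>B\<^esub> b \<otimes>\<^bsub>B\<^esub> y') 1 - Poly_Mapping.single (a \<otimes>\<^bsub>A\<^esub> x, b \<otimes>\<^bsub>B\<^esub> y) 1 -
          Poly_Mapping.single (a \<otimes>\<^bsub>A\<^esub> x, b \<otimes>\<^bsub>B\<^esub> y') 1 \<in> R"
        using ab xy by (intro tensor_relations_intro(2)) auto
      ultimately have "Poly_Mapping.single (a, b) c \<otimes>\<^bsub>F\<^esub> r \<in> R"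
        using free.subspace_scale[OF sub] by simp
    }
    moreover {
      fix d x y assume xy: "x \<in> carrier A" "y \<in> carrier B"
        and r: "r = Poly_Mapping.single (d \<odot>\<^bsub>A\<^esub> x, y) 1 - Poly_Mapping.single (x, y) d"
      have "Poly_Mapping.single (a, b) c \<otimes>\<^bsub>F\<^esub> r = free_scale c (
          Poly_Mapping.single (d \<odot>\<^bsub>A\<^esub> (a \<otimes>\<^bsub>A\<^esub> x), b \<otimes>\<^bsub>B\<^esub> y) 1 - Poly_Mapping.single (a \<otimes>\<^bsub>A\<^esub> x, b \<otimes>\<^bsub>B\<^esub> y) d)"
        unfolding r using ab xy
        by (simp add: free_algebra_mult_minus free_algebra_mult_single A.smult_mult_right
            free.scale_right_diff_distrib)
      moreover have "Poly_Mapping.single (d \<odot>\<^bsub>A\<^esub> (a \<otimes>\<^bsub>A\<^esub> x), b \<otimes>\<^bsub>B\<^esub> y) 1 - Poly_Mapping.single (a \<otimes>\<^bsub>A\<^esub> x, b \<otimes>\<^bsub>B\<^esub> y) d \<in> R"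
        using ab xy by (intro tensor_relations_intro(3)) auto
      ultimately have "Poly_Mapping.single (a, b) c \<otimes>\<^bsub>F\<^esub> r \<in> R"
        using free.subspace_scale[OF sub] by simp
    }
    moreover {
      fix d x y assume xy: "x \<in> carrier A" "y \<in> carrier B"
        and r: "r = Poly_Mapping.single (x, d \<odot>\<^bsub>B\<^esub> y) 1 - Poly_Mapping.single (x, y) d"
      have "Poly_Mapping.single (a, b) c \<otimes>\<^bsub>F\<^esub> r = free_scale c (
          Poly_Mapping.single (a \<otimes>\<^bsub>A\<^esub> x, d \<odot>\<^bsub>B\<^esub> (b \<otimes>\<^bsub>B\<^esub> y)) 1 - Poly_Mapping.single (a \<otimes>\<^bsub>A\<^esub> x, b \<otimes>\<^bsub>B\<^esub> y) d)"
        unfolding r using ab xy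
        by (simp add: free_algebra_mult_minus free_algebra_mult_single B.smult_mult_right
            free.scale_right_diff_distrib)
      moreover have "Poly_Mapping.single (a \<otimes>\<^bsub>A\<^esub> x, d \<odot>\<^bsub>B\<^esub> (b \<otimes>\<^bsub>B\<^esub> y)) 1 - Poly_Mapping.single (a \<otimes>\<^bsub>A\<^esub> x, b \<otimes>\<^bsub>B\<^esub> y) d \<in> R"
        using ab xy by (intro tensor_relations_intro(4)) auto
      ultimately have "Poly_Mapping.single (a, b) c \<otimes>\<^bsub>F\<^esub> r \<in> R"
        using free.subspace_scale[OF sub] by simp
    }
    ultimately show ?case using step by (elim UnE CollectE exE conjE) simp_all
  qed
  show ?thesis
    using p by (induction rule: free_algebra_induct)
      (simp_all add: free.subspace_0[OF sub] free.subspace_add[OF sub] free_algebra_distrib *)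
qed

lemma relations_subset: "R \<subseteq> carrier F"
  unfolding tensor_relations_def
  by (rule free.span_minimal[OF _ free_algebra_subspace])
    (auto intro!: free.subspace_diff[OF free_algebra_subspace] free_algebra_closed)

lemma relations_ideal: "ideal R F"
proof -
  interpret F: commutative_algebra F by (rule free_commutative_algebra)
  note sub = tensor_relations_subspace[of A B]
  show ?thesis
  proof (rule idealI)
    show "ring F" by (rule F.ring_axioms)
    show "subgroup R (add_monoid F)"
    proof (rule group.subgroupI[OF F.a_group])
      show "R \<subseteq> carrier (add_monoid F)" using relations_subset by simp
      show "R \<noteq> {}" using free.subspace_0[OF sub] by blast
      show "inv\<^bsub>add_monoid F\<^esub> r \<in> R" if "r \<in> R" for r
        using F.smult_minus_one[of r] relations_subset that free.subspace_scale[OF sub that, of "- 1"]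
        by (auto simp: a_inv_def)
      show "r \<otimes>\<^bsub>add_monoid F\<^esub> s \<in> R" if "r \<in> R" "s \<in> R" for r s
        using free.subspace_add[OF sub that] by simp
    qed
    show "p \<otimes>\<^bsub>F\<^esub> r \<in> R" if "r \<in> R" "p \<in> carrier F" for p r
      using relations_mult_closed that by blast
    show "r \<otimes>\<^bsub>F\<^esub> p \<in> R" if "r \<in> R" "p \<in> carrier F" for p r
      using relations_mult_closed[OF that(2,1)] free_mult_commute[of r p] relations_subset that by auto
  qed
qed

lemma tensor_commutative_algebra: "commutative_algebra (tensor_algebra A B)"
  unfolding tensor_algebra_def
  by (rule commutative_algebra.commutative_algebra_quotient[OF free_commutative_algebra relations_ideal])

lemmas tensor_ops = commutative_algebra.quotient_algebra_ops[OF free_commutative_algebra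
    relations_ideal, folded tensor_algebra_def]

lemma tensor_closed:
  "a \<in> carrier A \<Longrightarrow> b \<in> carrier B \<Longrightarrow> tensor A B a b \<in> carrier (tensor_algebra A B)"
  by (auto simp: tensor_algebra_carrier tensor_def free_algebra_closed)

lemma tensor_mult:
  assumes "a \<in> carrier A" "b \<in> carrier B" "a' \<in> carrier A" "b' \<in> carrier B"
  shows "tensor A B a b \<otimes>\<^bsub>tensor_algebra A B\<^esub> tensor A B a' b' =
    tensor A B (a \<otimes>\<^bsub>A\<^esub> a') (b \<otimes>\<^bsub>B\<^esub> b')"
  using assms unfolding tensor_def
  by (subst tensor_ops(2)) (simp_all add: free_algebra_closed free_algebra_mult_single)

lemma tensor_one: "\<one>\<^bsub>tensor_algebra A B\<^esub> = tensor A B \<one>\<^bsub>A\<^esub> \<one>\<^bsub>B\<^esub>"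
  by (simp add: tensor_algebra_def tensor_def)

text \<open>The two canonical embeddings \<open>a \<mapsto> a \<otimes> 1\<close> and \<open>b \<mapsto> 1 \<otimes> b\<close>.\<close>

lemma tensor_left_alg_hom: "(\<lambda>a. tensor A B a \<one>\<^bsub>B\<^esub>) \<in> alg_hom A (tensor_algebra A B)"
proof (rule alg_homI)
  show "tensor A B (x \<oplus>\<^bsub>A\<^esub> y) \<one>\<^bsub>B\<^esub> = tensor A B x \<one>\<^bsub>B\<^esub> \<oplus>\<^bsub>tensor_algebra A B\<^esub> tensor A B y \<one>\<^bsub>B\<^esub>"
    if "x \<in> carrier A" "y \<in> carrier A" for x y
    using that tensor_relations_intro(1)[OF that(1) B.one_closed that(2)] unfolding tensor_def
    by (subst tensor_ops(1))
      (simp_all add: free_algebra_closed tensor_relations_coset_eq_iff diff_diff_eq)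
  show "tensor A B (c \<odot>\<^bsub>A\<^esub> x) \<one>\<^bsub>B\<^esub> = c \<odot>\<^bsub>tensor_algebra A B\<^esub> tensor A B x \<one>\<^bsub>B\<^esub>"
    if "x \<in> carrier A" for c x
    using that tensor_relations_intro(3)[OF that B.one_closed] unfolding tensor_def
    by (subst tensor_ops(3)[OF _ free_algebra_zero_closed])
      (simp_all add: free_algebra_closed tensor_relations_coset_eq_iff)
qed (simp_all add: tensor_closed tensor_mult tensor_one)

lemma tensor_right_alg_hom: "(\<lambda>b. tensor A B \<one>\<^bsub>A\<^esub> b) \<in> alg_hom B (tensor_algebra A B)"
proof (rule alg_homI)
  show "tensor A B \<one>\<^bsub>A\<^esub> (x \<oplus>\<^bsub>B\<^esub> y) = tensor A B \<one>\<^bsub>A\<^esub> x \<oplus>\<^bsub>tensor_algebra A B\<^esub> tensor A B \<one>\<^bsub>A\<^esub> y"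
    if "x \<in> carrier B" "y \<in> carrier B" for x y
    using that tensor_relations_intro(2)[OF A.one_closed that] unfolding tensor_def
    by (subst tensor_ops(1))
      (simp_all add: free_algebra_closed tensor_relations_coset_eq_iff diff_diff_eq)
  show "tensor A B \<one>\<^bsub>A\<^esub> (c \<odot>\<^bsub>B\<^esub> x) = c \<odot>\<^bsub>tensor_algebra A B\<^esub> tensor A B \<one>\<^bsub>A\<^esub> x"
    if "x \<in> carrier B" for c x
    using that tensor_relations_intro(4)[OF A.one_closed that] unfolding tensor_def
    by (subst tensor_ops(3)[OF _ free_algebra_zero_closed])
      (simp_all add: free_algebra_closed tensor_relations_coset_eq_iff)
qed (simp_all add: tensor_closed tensor_mult tensor_one)

lemma tensor_functional_alg_hom:
  assumes f: "f \<in> alg_hom A ground_algebra" and g: "g \<in> alg_hom B ground_algebra"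
  shows "tensor_functional f g \<in> alg_hom (tensor_algebra A B) ground_algebra"
proof -
  note fD = alg_homD[OF f, unfolded ground_algebra_simps] and gD = alg_homD[OF g, unfolded ground_algebra_simps]
  note val = tensor_functional_coset[OF alg_hom_linear_form[OF f] alg_hom_linear_form[OF g]]
  have *: "bilinear_value f g (Poly_Mapping.single (a, b) c \<otimes>\<^bsub>F\<^esub> q) = c * f a * g b * bilinear_value f g q"
    if "q \<in> carrier F" "a \<in> carrier A" "b \<in> carrier B" for a b c q
    using that by (induction rule: free_algebra_induct)
      (simp_all add: free_algebra_distrib free_algebra_mult_single bilinear_value_add fD gD algebra_simps)
  have mult: "bilinear_value f g (p \<otimes>\<^bsub>F\<^esub> q) = bilinear_value f g p * bilinear_value f g q"
    if "p \<in> carrier F" "q \<in> carrier F" for p q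
    using that by (induction rule: free_algebra_induct)
      (simp_all add: free_algebra_distrib bilinear_value_add * algebra_simps)
  show ?thesis
    by (rule alg_homI)
      (auto simp: tensor_algebra_carrier val tensor_ops bilinear_value_add bilinear_value_scale mult
        tensor_one tensor_functional_tensor[OF alg_hom_linear_form[OF f] alg_hom_linear_form[OF g]] fD gD)
qed

end

section \<open>The bialgebra structure of the universal algebra\<close>

text \<open>The algebra morphisms to the ground field, normalised to be \<open>0\<close> outside of the carrier.\<close>

definition characters :: "('k::field, 'a, 'm) module_scheme \<Rightarrow> ('a \<Rightarrow> 'k) set"
  where "characters A = alg_hom A ground_algebra \<inter> linear_functionals A"

lemma charactersI:
  assumes "h \<in> alg_hom A ground_algebra" "commutative_algebra A"
    and "\<And>x. x \<in> carrier A \<Longrightarrow> f x = h x" "\<And>x. x \<notin> carrier A \<Longrightarrow> f x = 0"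
  shows "f \<in> characters A"
proof -
  have f: "f \<in> alg_hom A ground_algebra" by (rule alg_hom_cong) fact+
  then show ?thesis
    using assms(4) by (simp add: characters_def linear_functionals_def alg_homD)
qed

lemma module_extend_simps [simp]:
  "carrier (module.extend A m) = carrier A" "monoid.mult (module.extend A m) = monoid.mult A"
  "one (module.extend A m) = one A" "ring.zero (module.extend A m) = ring.zero A"
  "add (module.extend A m) = add A" "smult (module.extend A m) = smult A"
  by (simp_all add: module.extend_def)

lemma commutative_algebra_extend:
  assumes "commutative_algebra A"
  shows "commutative_algebra (module.extend A m)"
proof -
  interpret commutative_algebra A by fact
  have "cring (module.extend A m)"
    by (intro cringI abelian_groupI comm_monoidI)
      (auto simp: a_ac m_ac l_distr r_distr l_neg intro!: bexI[of _ "\<ominus>\<^bsub>A\<^esub> _"])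
  then show ?thesis
    unfolding commutative_algebra_def commutative_algebra_axioms_def
    by (auto simp: smult_l_distr smult_r_distr smult_assoc smult_mult)
qed

lemma characters_extend [simp]: "characters (module.extend A m) = characters A"
  by (simp add: characters_def alg_hom_def ring_hom_def linear_functionals_def)

context structure_constants
begin

abbreviation "Bi \<equiv> univ_bialgebra scale br tr n e"

lemma univ_bialgebra_simps [simp]:
  "carrier Bi = carrier U" "monoid.mult Bi = monoid.mult U"
  "one Bi = one U" "ring.zero Bi = ring.zero U" "add Bi = add U" "smult Bi = smult U"
  "comult Bi = univ_comult scale br tr n e" "counit Bi = univ_counit scale br tr n e"
  "characters Bi = characters U"
  by (simp_all add: univ_bialgebra_def) (simp_all add: module.extend_def)

lemma two_algebras_univ: "two_algebras U U"
  by (simp add: two_algebras_def univ_algebra_commutative_algebra)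

text \<open>The comultiplication is well defined: the images of the generators under the two embeddings into
  the tensor square are structure matrices, and hence so is their product, which is the matrix of
  the prescribed values.\<close>

lemma univ_comult:
  "univ_comult scale br tr n e \<in> alg_hom U (tensor_algebra U U)"
  "i \<in> {1..n} \<Longrightarrow> j \<in> {1..n} \<Longrightarrow> univ_comult scale br tr n e (x i j) =
    (\<Oplus>\<^bsub>tensor_algebra U U\<^esub>s\<in>{1..n}. tensor U U (x i s) (x s j))"
proof -
  let ?T = "tensor_algebra U U"
  interpret two_algebras U U by (rule two_algebras_univ)
  interpret T: commutative_algebra ?T by (rule tensor_commutative_algebra)
  note U = univ_algebra_commutative_algebra and T = tensor_commutative_algebra
  let ?D = "\<lambda>i j. \<Oplus>\<^bsub>?T\<^esub>s\<in>{1..n}. tensor U U (x i s) (x s j)"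
  have "structure_matrix ?T n \<tau> \<omega> (\<lambda>i j. \<Oplus>\<^bsub>?T\<^esub>s\<in>{1..n}.
      tensor U U (x i s) \<one>\<^bsub>U\<^esub> \<otimes>\<^bsub>?T\<^esub> tensor U U \<one>\<^bsub>U\<^esub> (x s j))"
    by (intro T.structure_matrix_product
        structure_matrix_hom[OF tensor_left_alg_hom U T univ_gen_structure_matrix]
        structure_matrix_hom[OF tensor_right_alg_hom U T univ_gen_structure_matrix])
  then obtain h where h: "h \<in> alg_hom U ?T"
    "\<And>i j. i \<in> {1..n} \<Longrightarrow> j \<in> {1..n} \<Longrightarrow> h (x i j) = (\<Oplus>\<^bsub>?T\<^esub>s\<in>{1..n}.
      tensor U U (x i s) \<one>\<^bsub>U\<^esub> \<otimes>\<^bsub>?T\<^esub> tensor U U \<one>\<^bsub>U\<^esub> (x s j))"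
    using univ_algebra_hom_exists[OF T] by blast
  have hD: "h (x i j) = ?D i j" if "i \<in> {1..n}" "j \<in> {1..n}" for i j
    unfolding h(2)[OF that] using that
    by (intro T.finsum_cong') (auto simp: tensor_closed univ_gen_closed tensor_mult)
  \<comment> \<open>The conditions of which \<^const>\<open>univ_comult\<close> is the unique solution.\<close>
  let ?P = "\<lambda>D. D \<in> alg_hom U ?T \<and> D \<in> extensional (carrier U) \<and>
    (\<forall>i\<in>{1..n}. \<forall>j\<in>{1..n}. D (x i j) = ?D i j)"
  have "?P (restrict h (carrier U))"
    using alg_hom_cong[OF h(1) U, of "restrict h (carrier U)"] by (auto simp: univ_gen_closed hD)
  moreover have "D = D'" if "?P D" "?P D'" for D D'
  proof (rule extensionalityI[of _ "carrier U"])
    show "D y = D' y" if "y \<in> carrier U" for y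
      by (rule univ_algebra_hom_eq[OF T _ _ _ that]) (use \<open>?P D\<close> \<open>?P D'\<close> in auto)
  qed (use that in auto)
  ultimately have "\<exists>!D. ?P D" by blast
  then have THE: "?P (THE D. ?P D)" by (rule theI')
  have eq: "univ_comult scale br tr n e = (THE D. ?P D)"
    by (simp add: univ_comult_def Let_def)
  have "?P (univ_comult scale br tr n e)" unfolding eq by (rule THE)
  then show "univ_comult scale br tr n e \<in> alg_hom U ?T"
    "i \<in> {1..n} \<Longrightarrow> j \<in> {1..n} \<Longrightarrow> univ_comult scale br tr n e (x i j) = ?D i j" by blast+
qed

lemma characters_eqI:
  assumes "f \<in> characters U" "g \<in> characters U"
    and "\<And>s i. s \<in> {1..n} \<Longrightarrow> i \<in> {1..n} \<Longrightarrow> f (x s i) = g (x s i)"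
  shows "f = g"
proof
  fix y
  show "f y = g y"
  proof (cases "y \<in> carrier U")
    case True
    have "f \<in> alg_hom U ground_algebra" "g \<in> alg_hom U ground_algebra"
      using assms(1,2) by (simp_all add: characters_def)
    then show ?thesis
      by (rule univ_algebra_hom_eq[where g = f and h = g, OF commutative_algebra_ground _ _ assms(3) True])
  next
    case False
    then have "f y = 0" "g y = 0"
      using assms(1,2) by (simp_all add: characters_def linear_functionals_def)
    then show ?thesis by simp
  qed
qed

lemma characters_exist:
  assumes "structure_matrix ground_algebra n \<tau> \<omega> V"
  obtains f where "f \<in> characters U"
    "\<And>s i. s \<in> {1..n} \<Longrightarrow> i \<in> {1..n} \<Longrightarrow> f (x s i) = V s i"
proof -
  obtain h where h: "h \<in> alg_hom U ground_algebra"
    "\<And>s i. s \<in> {1..n} \<Longrightarrow> i \<in> {1..n} \<Longrightarrow> h (x s i) = V s i"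
    using univ_algebra_hom_exists[OF commutative_algebra_ground assms] by blast
  show thesis
  proof (rule that)
    show "(\<lambda>y. if y \<in> carrier U then h y else 0) \<in> characters U"
      by (rule charactersI[OF h(1) univ_algebra_commutative_algebra]) simp_all
    show "(if x s i \<in> carrier U then h (x s i) else 0) = V s i" if "s \<in> {1..n}" "i \<in> {1..n}" for s i
      using univ_gen_closed[OF that] h(2)[OF that] by simp
  qed
qed

lemma structure_matrix_identity:
  "structure_matrix ground_algebra n \<tau> \<omega> (\<lambda>s i. if s = i then 1 else 0)"
proof -
  have 2: "(\<Sum>\<sigma>\<in>{1..n} \<times> {1..n}. c \<sigma> * ((if fst \<sigma> = i then 1 else 0) * (if snd \<sigma> = j then 1 else 0))) =
      c (i, j)" if "i \<in> {1..n}" "j \<in> {1..n}" for c :: "nat \<times> nat \<Rightarrow> 'k" and i j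
  proof -
    have "(\<Sum>\<sigma>\<in>{1..n} \<times> {1..n}. c \<sigma> * ((if fst \<sigma> = i then 1 else 0) * (if snd \<sigma> = j then 1 else 0))) =
        (\<Sum>\<sigma>\<in>{1..n} \<times> {1..n}. if \<sigma> = (i, j) then c \<sigma> else 0)"
      by (rule sum.cong) auto
    then show ?thesis using that by simp
  qed
  have 3: "(\<Sum>\<sigma>\<in>{1..n} \<times> {1..n} \<times> {1..n}. c \<sigma> * ((if fst \<sigma> = i then 1 else 0) *
        ((if fst (snd \<sigma>) = j then 1 else 0) * (if snd (snd \<sigma>) = k then 1 else 0)))) = c (i, j, k)"
    if "i \<in> {1..n}" "j \<in> {1..n}" "k \<in> {1..n}" for c :: "nat \<times> nat \<times> nat \<Rightarrow> 'k" and i j k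
  proof -
    have "(\<Sum>\<sigma>\<in>{1..n} \<times> {1..n} \<times> {1..n}. c \<sigma> * ((if fst \<sigma> = i then 1 else 0) *
        ((if fst (snd \<sigma>) = j then 1 else 0) * (if snd (snd \<sigma>) = k then 1 else 0)))) =
        (\<Sum>\<sigma>\<in>{1..n} \<times> {1..n} \<times> {1..n}. if \<sigma> = (i, j, k) then c \<sigma> else 0)"
      by (rule sum.cong) auto
    then show ?thesis using that by simp
  qed
  have 1: "(\<Sum>u\<in>{1..n}. c u * (if a = u then 1 else 0)) = c a" if "a \<in> {1..n}"
    for c :: "nat \<Rightarrow> 'k" and a
  proof -
    have "(\<Sum>u\<in>{1..n}. c u * (if a = u then 1 else 0)) = (\<Sum>u\<in>{1..n}. if u = a then c u else 0)"
      by (rule sum.cong) auto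
    then show ?thesis using that by simp
  qed
  show ?thesis
    unfolding structure_matrix_def ground_algebra_simps finsum_ground
  proof (intro conjI ballI)
    fix a p assume "a \<in> {1..n}" "p \<in> {1..n} \<times> {1..n}"
    then show "case p of (i, j) \<Rightarrow> (\<Sum>u\<in>{1..n}. \<tau> i j u * (if a = u then 1 else 0)) =
        (\<Sum>\<sigma>\<in>{1..n} \<times> {1..n}. \<tau> (fst \<sigma>) (snd \<sigma>) a *
          ((if fst \<sigma> = i then 1 else 0) * (if snd \<sigma> = j then 1 else 0)))"
      using 1[of a] 2[of "fst p" "snd p" "\<lambda>\<sigma>. \<tau> (fst \<sigma>) (snd \<sigma>) a"]
      by (auto simp only: case_prod_unfold mem_Times_iff fst_conv snd_conv)
  next
    fix a p assume "a \<in> {1..n}" "p \<in> {1..n} \<times> {1..n} \<times> {1..n}"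
    then show "case p of (i, j, k) \<Rightarrow> (\<Sum>u\<in>{1..n}. \<omega> i j k u * (if a = u then 1 else 0)) =
        (\<Sum>\<sigma>\<in>{1..n} \<times> {1..n} \<times> {1..n}. \<omega> (fst \<sigma>) (fst (snd \<sigma>)) (snd (snd \<sigma>)) a *
          ((if fst \<sigma> = i then 1 else 0) *
            ((if fst (snd \<sigma>) = j then 1 else 0) * (if snd (snd \<sigma>) = k then 1 else 0))))"
      using 1[of a] 3[of "fst p" "fst (snd p)" "snd (snd p)"
          "\<lambda>\<sigma>. \<omega> (fst \<sigma>) (fst (snd \<sigma>)) (snd (snd \<sigma>)) a"]
      by (auto simp only: case_prod_unfold mem_Times_iff fst_conv snd_conv)
  qed simp
qed

lemma univ_counit:
  "univ_counit scale br tr n e \<in> characters U"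
  "i \<in> {1..n} \<Longrightarrow> j \<in> {1..n} \<Longrightarrow> univ_counit scale br tr n e (x i j) = (if i = j then 1 else 0)"
proof -
  let ?P = "\<lambda>\<epsilon>. \<epsilon> \<in> alg_hom U ground_algebra \<and> \<epsilon> \<in> linear_functionals U \<and>
    (\<forall>i\<in>{1..n}. \<forall>j\<in>{1..n}. \<epsilon> (x i j) = (if i = j then 1 else 0))"
  obtain f where "f \<in> characters U"
    "\<And>i j. i \<in> {1..n} \<Longrightarrow> j \<in> {1..n} \<Longrightarrow> f (x i j) = (if i = j then 1 else 0)"
    using characters_exist[OF structure_matrix_identity] by blast
  then have "?P f" by (simp add: characters_def)
  moreover have "f = g" if "?P f" "?P g" for f g
    using that by (intro characters_eqI) (auto simp: characters_def)
  ultimately have "\<exists>!f. ?P f" by blast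
  then have THE: "?P (THE f. ?P f)" by (rule theI')
  have eq: "univ_counit scale br tr n e = (THE f. ?P f)"
    by (simp add: univ_counit_def Let_def)
  have "?P (univ_counit scale br tr n e)" unfolding eq by (rule THE)
  then show "univ_counit scale br tr n e \<in> characters U"
    "i \<in> {1..n} \<Longrightarrow> j \<in> {1..n} \<Longrightarrow> univ_counit scale br tr n e (x i j) = (if i = j then 1 else 0)"
    unfolding characters_def by blast+
qed

lemma finite_dual_one: "\<one>\<^bsub>finite_dual_algebra Bi\<^esub> = univ_counit scale br tr n e"
  using univ_counit(1)
  by (auto simp: finite_dual_algebra_def characters_def linear_functionals_def)

text \<open>The convolution product of characters is the product of their matrices.\<close>

lemma convolution_characters:
  assumes f: "f \<in> characters U" and g: "g \<in> characters U"
  shows "convolution Bi f g \<in> characters U"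
    and "i \<in> {1..n} \<Longrightarrow> j \<in> {1..n} \<Longrightarrow>
      convolution Bi f g (x i j) = (\<Sum>s=1..n. f (x i s) * g (x s j))"
proof -
  interpret two_algebras U U by (rule two_algebras_univ)
  let ?T = "tensor_algebra U U"
  have fh: "f \<in> alg_hom U ground_algebra" and gh: "g \<in> alg_hom U ground_algebra"
    using f g by (auto simp: characters_def)
  note fg = tensor_functional_alg_hom[OF fh gh]
  show "convolution Bi f g \<in> characters U"
    by (rule charactersI[OF alg_hom_comp[OF univ_comult(1) fg] univ_algebra_commutative_algebra])
      (simp_all add: convolution_def)
  show "convolution Bi f g (x i j) = (\<Sum>s=1..n. f (x i s) * g (x s j))"
    if ij: "i \<in> {1..n}" "j \<in> {1..n}"
  proof -
    have "convolution Bi f g (x i j) =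
        tensor_functional f g (\<Oplus>\<^bsub>?T\<^esub>s\<in>{1..n}. tensor U U (x i s) (x s j))"
      by (simp add: convolution_def univ_gen_closed[OF ij] univ_comult(2)[OF ij])
    also have "\<dots> = (\<Sum>s=1..n. tensor_functional f g (tensor U U (x i s) (x s j)))"
      using ij by (subst alg_hom_finsum[OF fg tensor_commutative_algebra commutative_algebra_ground])
        (simp_all add: tensor_closed univ_gen_closed Pi_def)
    also have "\<dots> = (\<Sum>s=1..n. f (x i s) * g (x s j))"
      by (simp add: tensor_functional_tensor[OF alg_hom_linear_form[OF fh] alg_hom_linear_form[OF gh]])
    finally show ?thesis .
  qed
qed

end

section \<open>Functionals and ideals of finite codimension\<close>

text \<open>The pointwise vector space structure on functionals.\<close>

definition fscale :: "'k::field \<Rightarrow> ('a \<Rightarrow> 'k) \<Rightarrow> 'a \<Rightarrow> 'k"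
  where "fscale c f = (\<lambda>x. c * f x)"

interpretation fn: vector_space "fscale :: 'k::field \<Rightarrow> ('a \<Rightarrow> 'k) \<Rightarrow> 'a \<Rightarrow> 'k"
  by unfold_locales (simp_all add: fscale_def fun_eq_iff algebra_simps)

lemma fscale_apply: "fscale c f x = c * f x"
  by (simp add: fscale_def)

lemma sum_fun_apply: "(\<Sum>s\<in>S. f s) x = (\<Sum>s\<in>S. f s x)"
  by (induction S rule: infinite_finite_induct) simp_all

lemma linear_functionals_subspace: "fn.subspace (linear_functionals A)"
  by (auto simp: fn.subspace_def linear_functionals_def fscale_apply algebra_simps)

text \<open>The annihilator of a set of functionals. The ideals of finite codimension will be those of the form
  \<^term>\<open>common_kernel A \<Phi>\<close> for a finite set \<open>\<Phi>\<close> of functionals; in this form they are evidently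
  closed under intersection.\<close>

definition common_kernel :: "('k::field, 'a, 'm) module_scheme \<Rightarrow> ('a \<Rightarrow> 'k) set \<Rightarrow> 'a set"
  where "common_kernel A \<Phi> = {x \<in> carrier A. \<forall>\<phi>\<in>\<Phi>. \<phi> x = 0}"

context commutative_algebra
begin

context
  fixes f assumes f: "f \<in> linear_functionals A"
begin

lemma functional_add: "x \<in> carrier A \<Longrightarrow> y \<in> carrier A \<Longrightarrow> f (x \<oplus> y) = f x + f y"
  and functional_smult: "x \<in> carrier A \<Longrightarrow> f (c \<odot> x) = c * f x"
  and functional_outside: "x \<notin> carrier A \<Longrightarrow> f x = 0"
  using f by (simp_all add: linear_functionals_def)

lemma functional_zero: "f \<zero> = 0"
  using functional_smult[of \<zero> 0] by simp

lemma functional_minus: "x \<in> carrier A \<Longrightarrow> y \<in> carrier A \<Longrightarrow> f (x \<ominus> y) = f x - f y"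
  using functional_add[of x "\<ominus> y"] functional_smult[of y "- 1"]
  by (simp add: a_minus_def smult_minus_one)

lemma functional_finsum: "x \<in> S \<rightarrow> carrier A \<Longrightarrow> f (\<Oplus>s\<in>S. x s) = (\<Sum>s\<in>S. f (x s))"
  by (induction S rule: infinite_finite_induct) (simp_all add: functional_zero functional_add Pi_def)

end

text \<open>Finitely many linearly independent functionals have a dual system of elements.\<close>

lemma dual_elements_exist:
  assumes "finite \<Phi>" "fn.independent \<Phi>" "\<Phi> \<subseteq> linear_functionals A"
  shows "\<exists>a. \<forall>\<phi>\<in>\<Phi>. a \<phi> \<in> carrier A \<and> (\<forall>\<psi>\<in>\<Phi>. \<psi> (a \<phi>) = (if \<psi> = \<phi> then 1 else 0))"
  using assms
proof (induction \<Phi>)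
  case empty
  show ?case by simp
next
  case (insert \<psi> \<Phi>)
  have ind: "fn.independent \<Phi>" "\<psi> \<notin> fn.span \<Phi>"
    using insert.prems(1) insert.hyps(2) by (simp_all add: fn.independent_insert)
  from insert ind obtain a where a: "\<And>\<phi>. \<phi> \<in> \<Phi> \<Longrightarrow> a \<phi> \<in> carrier A"
    "\<And>\<phi> \<chi>. \<phi> \<in> \<Phi> \<Longrightarrow> \<chi> \<in> \<Phi> \<Longrightarrow> \<chi> (a \<phi>) = (if \<chi> = \<phi> then 1 else 0)" by auto
  have lf: "\<phi> \<in> linear_functionals A" if "\<phi> \<in> insert \<psi> \<Phi>" for \<phi> using insert.prems that by blast
  \<comment> \<open>\<open>\<chi>\<close> is the part of \<open>\<psi>\<close> that vanishes on the dual system found so far.\<close>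
  define \<chi> where "\<chi> = \<psi> - (\<Sum>\<phi>\<in>\<Phi>. fscale (\<psi> (a \<phi>)) \<phi>)"
  have "(\<Sum>\<phi>\<in>\<Phi>. fscale (\<psi> (a \<phi>)) \<phi>) \<in> fn.span \<Phi>"
    by (intro fn.span_sum fn.span_scale fn.span_base)
  then have "\<chi> \<noteq> 0" using ind(2) by (auto simp: \<chi>_def)
  then obtain x where x: "\<chi> x \<noteq> 0" by (auto simp: fun_eq_iff)
  have "\<chi> \<in> linear_functionals A"
    unfolding \<chi>_def using lf
    by (intro fn.subspace_diff fn.subspace_sum fn.subspace_scale linear_functionals_subspace) auto
  then have xA: "x \<in> carrier A" using x functional_outside by blast
  \<comment> \<open>Correct \<open>x\<close> so that all \<open>\<phi> \<in> \<Phi>\<close> vanish on it; \<open>\<psi>\<close> then takes the value \<open>\<chi> x \<noteq> 0\<close>.\<close>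
  define y where "y = x \<ominus> (\<Oplus>\<phi>\<in>\<Phi>. \<phi> x \<odot> a \<phi>)"
  define b where "b = inverse (\<chi> x) \<odot> y"
  have sumA: "(\<lambda>\<phi>. \<phi> x \<odot> a \<phi>) \<in> \<Phi> \<rightarrow> carrier A" using a(1) by auto
  have yA: "y \<in> carrier A" using xA sumA by (simp add: y_def)
  have eval_y: "\<theta> y = \<theta> x - (\<Sum>\<phi>\<in>\<Phi>. \<phi> x * \<theta> (a \<phi>))" if "\<theta> \<in> insert \<psi> \<Phi>" for \<theta>
  proof -
    have "\<theta> (\<Oplus>\<phi>\<in>\<Phi>. \<phi> x \<odot> a \<phi>) = (\<Sum>\<phi>\<in>\<Phi>. \<theta> (\<phi> x \<odot> a \<phi>))"
      by (rule functional_finsum[OF lf[OF that] sumA])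
    also have "\<dots> = (\<Sum>\<phi>\<in>\<Phi>. \<phi> x * \<theta> (a \<phi>))"
      by (rule sum.cong) (simp_all add: functional_smult[OF lf[OF that]] a(1))
    finally show ?thesis
      unfolding y_def using functional_minus[OF lf[OF that] xA] sumA by simp
  qed
  have \<psi>y: "\<psi> y = \<chi> x"
    using eval_y[of \<psi>] by (simp add: \<chi>_def sum_fun_apply fscale_apply mult.commute)
  have \<theta>y: "\<theta> y = 0" if "\<theta> \<in> \<Phi>" for \<theta>
  proof -
    have "(\<Sum>\<phi>\<in>\<Phi>. \<phi> x * \<theta> (a \<phi>)) = (\<Sum>\<phi>\<in>\<Phi>. if \<phi> = \<theta> then \<phi> x else 0)"
      by (rule sum.cong) (auto simp: a(2) that)
    then show ?thesis using eval_y[of \<theta>] that insert.hyps(1) by simp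
  qed
  have bA: "b \<in> carrier A" using yA by (simp add: b_def)
  have \<psi>b: "\<psi> b = 1" using x by (simp add: b_def functional_smult[OF lf] yA \<psi>y)
  have \<theta>b: "\<theta> b = 0" if "\<theta> \<in> \<Phi>" for \<theta>
    using that by (simp add: b_def functional_smult[OF lf] yA \<theta>y)
  define a' where "a' \<phi> = (if \<phi> = \<psi> then b else a \<phi> \<ominus> \<psi> (a \<phi>) \<odot> b)" for \<phi>
  have "a' \<phi> \<in> carrier A \<and> (\<forall>\<theta>\<in>insert \<psi> \<Phi>. \<theta> (a' \<phi>) = (if \<theta> = \<phi> then 1 else 0))"
    if \<phi>: "\<phi> \<in> insert \<psi> \<Phi>" for \<phi>
  proof (cases "\<phi> = \<psi>")
    case True
    then show ?thesis using bA \<psi>b \<theta>b insert.hyps(2) by (auto simp: a'_def)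
  next
    case False
    then have *: "\<phi> \<in> \<Phi>" "a \<phi> \<in> carrier A" using \<phi> a(1) by auto
    have "\<theta> (a' \<phi>) = (if \<theta> = \<phi> then 1 else 0)" if \<theta>: "\<theta> \<in> insert \<psi> \<Phi>" for \<theta>
    proof -
      have eq: "\<theta> (a' \<phi>) = \<theta> (a \<phi>) - \<psi> (a \<phi>) * \<theta> b"
        using False functional_minus[OF lf[OF \<theta>]] functional_smult[OF lf[OF \<theta>]] * bA
        by (simp add: a'_def)
      show ?thesis
      proof (cases "\<theta> = \<psi>")
        case True
        then show ?thesis using eq \<psi>b False by simp
      next
        case False
        then show ?thesis using eq \<theta> \<theta>b[of \<theta>] a(2)[OF *(1), of \<theta>] by simp
      qed
    qed
    then show ?thesis using False * bA by (auto simp: a'_def)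
  qed
  then show ?case by blast
qed

lemma common_kernel_span: "common_kernel A (fn.span \<Phi>) = common_kernel A \<Phi>"
proof -
  have "\<phi> x = 0" if "\<phi> \<in> fn.span \<Phi>" "\<forall>\<phi>\<in>\<Phi>. \<phi> x = 0" for \<phi> x
    using that(1) by (induction rule: fn.span_induct) (use that(2) in \<open>auto simp: fn.subspace_def fscale_apply\<close>)
  then show ?thesis using fn.span_base by (fastforce simp: common_kernel_def)
qed

lemma common_kernel_basis:
  assumes "finite \<Phi>" "\<Phi> \<subseteq> linear_functionals A"
  obtains \<Psi> a where "finite \<Psi>" "\<Psi> \<subseteq> linear_functionals A" "common_kernel A \<Psi> = common_kernel A \<Phi>"
    "\<And>\<phi>. \<phi> \<in> \<Psi> \<Longrightarrow> a \<phi> \<in> carrier A"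
    "\<And>\<phi> \<psi>. \<phi> \<in> \<Psi> \<Longrightarrow> \<psi> \<in> \<Psi> \<Longrightarrow> \<psi> (a \<phi>) = (if \<psi> = \<phi> then 1 else 0)"
proof -
  obtain \<Psi> where \<Psi>: "\<Psi> \<subseteq> \<Phi>" "fn.independent \<Psi>" "\<Phi> \<subseteq> fn.span \<Psi>"
    by (rule fn.maximal_independent_subset)
  have fin: "finite \<Psi>" and sub: "\<Psi> \<subseteq> linear_functionals A"
    using \<Psi>(1) assms finite_subset by auto
  have "common_kernel A (fn.span \<Psi>) \<subseteq> common_kernel A \<Phi>" "common_kernel A \<Phi> \<subseteq> common_kernel A \<Psi>"
    using \<Psi> by (auto simp: common_kernel_def)
  then have ker: "common_kernel A \<Psi> = common_kernel A \<Phi>" by (simp add: common_kernel_span)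
  obtain a where "\<forall>\<phi>\<in>\<Psi>. a \<phi> \<in> carrier A \<and> (\<forall>\<psi>\<in>\<Psi>. \<psi> (a \<phi>) = (if \<psi> = \<phi> then 1 else 0))"
    using dual_elements_exist[OF fin \<Psi>(2) sub] by blast
  then show thesis using that[OF fin sub ker, of a] by blast
qed

lemma common_kernel_expansion:
  assumes "finite \<Psi>" "\<Psi> \<subseteq> linear_functionals A"
    and "\<And>\<phi>. \<phi> \<in> \<Psi> \<Longrightarrow> a \<phi> \<in> carrier A"
    and "\<And>\<phi> \<psi>. \<phi> \<in> \<Psi> \<Longrightarrow> \<psi> \<in> \<Psi> \<Longrightarrow> \<psi> (a \<phi>) = (if \<psi> = \<phi> then 1 else 0)"
    and x: "x \<in> carrier A"
  shows "x \<ominus> (\<Oplus>\<phi>\<in>\<Psi>. c \<phi> \<odot> a \<phi>) \<in> common_kernel A \<Psi> \<longleftrightarrow> (\<forall>\<phi>\<in>\<Psi>. \<phi> x = c \<phi>)"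
proof -
  have sumA: "(\<lambda>\<phi>. c \<phi> \<odot> a \<phi>) \<in> \<Psi> \<rightarrow> carrier A" using assms(3) by auto
  have eq: "\<psi> (x \<ominus> (\<Oplus>\<phi>\<in>\<Psi>. c \<phi> \<odot> a \<phi>)) = \<psi> x - c \<psi>" if "\<psi> \<in> \<Psi>" for \<psi>
  proof -
    have \<psi>: "\<psi> \<in> linear_functionals A" using that assms(2) by blast
    have "\<psi> (\<Oplus>\<phi>\<in>\<Psi>. c \<phi> \<odot> a \<phi>) = (\<Sum>\<phi>\<in>\<Psi>. \<psi> (c \<phi> \<odot> a \<phi>))"
      by (rule functional_finsum[OF \<psi> sumA])
    also have "\<dots> = (\<Sum>\<phi>\<in>\<Psi>. if \<phi> = \<psi> then c \<phi> else 0)"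
      by (rule sum.cong) (auto simp: functional_smult[OF \<psi>] assms(3,4) that)
    also have "\<dots> = c \<psi>" using assms(1) that by simp
    finally show ?thesis using functional_minus[OF \<psi> x] sumA by simp
  qed
  have "\<psi> (x \<ominus> (\<Oplus>\<phi>\<in>\<Psi>. c \<phi> \<odot> a \<phi>)) = 0 \<longleftrightarrow> \<psi> x = c \<psi>" if "\<psi> \<in> \<Psi>" for \<psi>
    using eq[OF that] by simp
  then have "(\<forall>\<psi>\<in>\<Psi>. \<psi> (x \<ominus> (\<Oplus>\<phi>\<in>\<Psi>. c \<phi> \<odot> a \<phi>)) = 0) \<longleftrightarrow> (\<forall>\<psi>\<in>\<Psi>. \<psi> x = c \<psi>)"
    by (intro ball_cong refl)
  then show ?thesis using x sumA by (simp add: common_kernel_def)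
qed

text \<open>The coordinate functionals of a basis of the quotient cut out the ideal.\<close>

lemma finite_dim_quotient_imp_common_kernel:
  assumes I: "ideal I A" and fd: "finite_dim (quotient_algebra A I)"
  obtains \<Phi> where "finite \<Phi>" "\<Phi> \<subseteq> linear_functionals A" "I = common_kernel A \<Phi>"
proof -
  interpret I: ideal I A by fact
  let ?Q = "quotient_algebra A I"
  interpret Q: commutative_algebra ?Q by (rule commutative_algebra_quotient[OF I])
  note ops = quotient_algebra_ops[OF I]
  obtain S where fS: "finite S \<and> S \<subseteq> carrier ?Q \<and>
      (\<forall>X\<in>carrier ?Q. \<exists>!c. c \<in> S \<rightarrow>\<^sub>E UNIV \<and> X = (\<Oplus>\<^bsub>?Q\<^esub>s\<in>S. c s \<odot>\<^bsub>?Q\<^esub> s))"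
    using fd unfolding finite_dim_def by (rule exE)
  note S = conjunct1[OF fS] conjunct1[OF conjunct2[OF fS]]
    and ex = bspec[OF conjunct2[OF conjunct2[OF fS]]]
  define c where "c x = (THE c. c \<in> S \<rightarrow>\<^sub>E UNIV \<and> I +> x = (\<Oplus>\<^bsub>?Q\<^esub>s\<in>S. c s \<odot>\<^bsub>?Q\<^esub> s))" for x
  have Qc: "I +> x \<in> carrier ?Q" if "x \<in> carrier A" for x
    using that by (auto simp: a_rcosets_iff)
  have sQ: "(\<lambda>s. d s \<odot>\<^bsub>?Q\<^esub> s) \<in> S \<rightarrow> carrier ?Q" for d
  proof
    fix s assume "s \<in> S"
    then show "d s \<odot>\<^bsub>?Q\<^esub> s \<in> carrier ?Q" using S(2) by (intro Q.smult_closed) blast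
  qed
  have c: "I +> x = (\<Oplus>\<^bsub>?Q\<^esub>s\<in>S. c x s \<odot>\<^bsub>?Q\<^esub> s)" if "x \<in> carrier A" for x
    using theI'[OF ex[OF Qc[OF that]]] by (simp add: c_def)
  have c_eq: "c x s = d s" if x: "x \<in> carrier A" and d: "I +> x = (\<Oplus>\<^bsub>?Q\<^esub>s\<in>S. d s \<odot>\<^bsub>?Q\<^esub> s)" and s: "s \<in> S"
    for x d s
  proof -
    have "(\<Oplus>\<^bsub>?Q\<^esub>s\<in>S. d s \<odot>\<^bsub>?Q\<^esub> s) = (\<Oplus>\<^bsub>?Q\<^esub>s\<in>S. restrict d S s \<odot>\<^bsub>?Q\<^esub> s)"
      using sQ[of d] by (intro Q.finsum_cong') (auto simp: Pi_def)
    then have "c x = restrict d S"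
      unfolding c_def using d by (intro the1_equality[OF ex[OF Qc[OF x]]]) auto
    then show ?thesis using s by simp
  qed
  define \<phi> where "\<phi> s x = (if x \<in> carrier A then c x s else 0)" for s x
  have lin: "\<phi> s \<in> linear_functionals A" if s: "s \<in> S" for s
  proof -
    have "c (x \<oplus> y) s = c x s + c y s" if xy: "x \<in> carrier A" "y \<in> carrier A" for x y
    proof (rule c_eq[OF _ _ s, where d = "\<lambda>s. c x s + c y s"])
      have "I +> (x \<oplus> y) = (\<Oplus>\<^bsub>?Q\<^esub>s\<in>S. c x s \<odot>\<^bsub>?Q\<^esub> s) \<oplus>\<^bsub>?Q\<^esub> (\<Oplus>\<^bsub>?Q\<^esub>s\<in>S. c y s \<odot>\<^bsub>?Q\<^esub> s)"
        using c[OF xy(1)] c[OF xy(2)] ops(1)[OF xy] by simp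
      also have "\<dots> = (\<Oplus>\<^bsub>?Q\<^esub>s\<in>S. c x s \<odot>\<^bsub>?Q\<^esub> s \<oplus>\<^bsub>?Q\<^esub> c y s \<odot>\<^bsub>?Q\<^esub> s)"
        by (rule Q.finsum_addf[OF sQ sQ, symmetric])
      also have "\<dots> = (\<Oplus>\<^bsub>?Q\<^esub>s\<in>S. (c x s + c y s) \<odot>\<^bsub>?Q\<^esub> s)"
        by (rule Q.finsum_cong'[OF refl sQ]) (use S(2) in \<open>auto simp: Q.smult_l_distr\<close>)
      finally show "I +> (x \<oplus> y) = (\<Oplus>\<^bsub>?Q\<^esub>s\<in>S. (c x s + c y s) \<odot>\<^bsub>?Q\<^esub> s)" .
    qed (use xy in simp)
    moreover have "c (d \<odot> x) s = d * c x s" if x: "x \<in> carrier A" for d x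
    proof (rule c_eq[OF _ _ s, where d = "\<lambda>s. d * c x s"])
      have "I +> (d \<odot> x) = d \<odot>\<^bsub>?Q\<^esub> (\<Oplus>\<^bsub>?Q\<^esub>s\<in>S. c x s \<odot>\<^bsub>?Q\<^esub> s)"
        using c[OF x] ops(3)[OF x x] by simp
      also have "\<dots> = (\<Oplus>\<^bsub>?Q\<^esub>s\<in>S. d \<odot>\<^bsub>?Q\<^esub> (c x s \<odot>\<^bsub>?Q\<^esub> s))"
        by (rule Q.smult_finsum[OF sQ])
      also have "\<dots> = (\<Oplus>\<^bsub>?Q\<^esub>s\<in>S. (d * c x s) \<odot>\<^bsub>?Q\<^esub> s)"
        by (rule Q.finsum_cong'[OF refl sQ]) (use S(2) in \<open>auto simp: Q.smult_assoc\<close>)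
      finally show "I +> (d \<odot> x) = (\<Oplus>\<^bsub>?Q\<^esub>s\<in>S. (d * c x s) \<odot>\<^bsub>?Q\<^esub> s)" .
    qed (use x in simp)
    ultimately show ?thesis by (simp add: linear_functionals_def \<phi>_def)
  qed
  have zero: "(\<Oplus>\<^bsub>?Q\<^esub>s\<in>S. 0 \<odot>\<^bsub>?Q\<^esub> s) = I"
  proof -
    have "(\<Oplus>\<^bsub>?Q\<^esub>s\<in>S. 0 \<odot>\<^bsub>?Q\<^esub> s) = \<zero>\<^bsub>?Q\<^esub>"
      using S(2) by (intro Q.add.finprod_one_eqI) (auto intro!: Q.smult_l_null)
    then show ?thesis by simp
  qed
  have "x \<in> I \<longleftrightarrow> (\<forall>s\<in>S. c x s = 0)" if x: "x \<in> carrier A" for x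
  proof
    assume "x \<in> I"
    then have "I +> x = (\<Oplus>\<^bsub>?Q\<^esub>s\<in>S. 0 \<odot>\<^bsub>?Q\<^esub> s)" by (simp add: zero I.a_rcos_const)
    then show "\<forall>s\<in>S. c x s = 0" using c_eq[OF x, where d = "\<lambda>_. 0"] by blast
  next
    assume "\<forall>s\<in>S. c x s = 0"
    then have "(\<Oplus>\<^bsub>?Q\<^esub>s\<in>S. c x s \<odot>\<^bsub>?Q\<^esub> s) = (\<Oplus>\<^bsub>?Q\<^esub>s\<in>S. 0 \<odot>\<^bsub>?Q\<^esub> s)"
      by (intro Q.finsum_cong'[OF refl sQ]) auto
    then have "I +> x = I" using c[OF x] zero by simp
    then show "x \<in> I" using I.a_rcos_self[OF x] by simp
  qed
  then have "I = common_kernel A (\<phi> ` S)"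
    using I.a_subset by (auto simp: common_kernel_def \<phi>_def)
  then show thesis using that[of "\<phi> ` S"] S(1) lin by blast
qed

text \<open>The classes of a dual system form a basis of the quotient.\<close>

lemma common_kernel_imp_finite_dim_quotient:
  assumes I: "ideal I A" and \<Phi>: "finite \<Phi>" "\<Phi> \<subseteq> linear_functionals A" "I = common_kernel A \<Phi>"
  shows "finite_dim (quotient_algebra A I)"
proof -
  let ?Q = "quotient_algebra A I"
  interpret Q: commutative_algebra ?Q by (rule commutative_algebra_quotient[OF I])
  obtain \<Psi> a where \<Psi>: "finite \<Psi>" "\<Psi> \<subseteq> linear_functionals A" "common_kernel A \<Psi> = common_kernel A \<Phi>"
    "\<And>\<phi>. \<phi> \<in> \<Psi> \<Longrightarrow> a \<phi> \<in> carrier A"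
    "\<And>\<phi> \<psi>. \<phi> \<in> \<Psi> \<Longrightarrow> \<psi> \<in> \<Psi> \<Longrightarrow> \<psi> (a \<phi>) = (if \<psi> = \<phi> then 1 else 0)"
    using common_kernel_basis[OF \<Phi>(1,2)] by blast
  define b where "b \<phi> = I +> a \<phi>" for \<phi>
  have bQ: "b \<phi> \<in> carrier ?Q" if "\<phi> \<in> \<Psi>" for \<phi>
    using \<Psi>(4)[OF that] by (auto simp: b_def a_rcosets_iff)
  have inj: "inj_on b \<Psi>"
  proof
    fix \<phi> \<psi> assume *: "\<phi> \<in> \<Psi>" "\<psi> \<in> \<Psi>" "b \<phi> = b \<psi>"
    then have "a \<phi> \<ominus> a \<psi> \<in> common_kernel A \<Psi>"
      using coset_eq_iff[OF I, of "a \<phi>" "a \<psi>"] \<Psi>(3,4) \<Phi>(3) by (simp add: b_def)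
    then have "\<phi> (a \<phi> \<ominus> a \<psi>) = 0" using *(1) by (simp add: common_kernel_def)
    then have "\<phi> (a \<phi>) = \<phi> (a \<psi>)"
      using functional_minus[of \<phi> "a \<phi>" "a \<psi>"] \<Psi>(2,4) * by auto
    then show "\<phi> = \<psi>" using \<Psi>(5)[of \<phi> \<phi>] \<Psi>(5)[of \<psi> \<phi>] * by (auto split: if_splits)
  qed
  have comb: "I +> x = (\<Oplus>\<^bsub>?Q\<^esub>s\<in>b ` \<Psi>. c s \<odot>\<^bsub>?Q\<^esub> s) \<longleftrightarrow> (\<forall>\<phi>\<in>\<Psi>. \<phi> x = c (b \<phi>))"
    if x: "x \<in> carrier A" for x c
  proof -
    have sumA: "(\<lambda>\<phi>. c (b \<phi>) \<odot> a \<phi>) \<in> \<Psi> \<rightarrow> carrier A" using \<Psi>(4) by auto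
    have sumQ: "(\<lambda>\<phi>. c (b \<phi>) \<odot>\<^bsub>?Q\<^esub> b \<phi>) \<in> \<Psi> \<rightarrow> carrier ?Q" using bQ Q.smult_closed by blast
    have "(\<Oplus>\<^bsub>?Q\<^esub>s\<in>b ` \<Psi>. c s \<odot>\<^bsub>?Q\<^esub> s) = (\<Oplus>\<^bsub>?Q\<^esub>\<phi>\<in>\<Psi>. c (b \<phi>) \<odot>\<^bsub>?Q\<^esub> b \<phi>)"
      using sumQ inj by (intro Q.finsum_reindex) auto
    also have "\<dots> = (\<Oplus>\<^bsub>?Q\<^esub>\<phi>\<in>\<Psi>. I +> (c (b \<phi>) \<odot> a \<phi>))"
      using \<Psi>(4) alg_homD(1)[OF quotient_proj_alg_hom[OF I]]
      by (intro Q.finsum_cong') (auto simp: b_def quotient_algebra_ops(3)[OF I _ zero_closed] Pi_def)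
    also have "\<dots> = I +> (\<Oplus>\<phi>\<in>\<Psi>. c (b \<phi>) \<odot> a \<phi>)"
      by (rule alg_hom_finsum[OF quotient_proj_alg_hom[OF I] commutative_algebra_axioms
            Q.commutative_algebra_axioms sumA, symmetric])
    finally have "I +> x = (\<Oplus>\<^bsub>?Q\<^esub>s\<in>b ` \<Psi>. c s \<odot>\<^bsub>?Q\<^esub> s) \<longleftrightarrow>
        x \<ominus> (\<Oplus>\<phi>\<in>\<Psi>. c (b \<phi>) \<odot> a \<phi>) \<in> common_kernel A \<Psi>"
      using coset_eq_iff[OF I x] sumA \<Psi>(3) \<Phi>(3) by simp
    also have "\<dots> \<longleftrightarrow> (\<forall>\<phi>\<in>\<Psi>. \<phi> x = c (b \<phi>))"
      by (rule common_kernel_expansion) (fact \<Psi> x)+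
    finally show ?thesis .
  qed
  show ?thesis
    unfolding finite_dim_def
  proof (intro exI[of _ "b ` \<Psi>"] conjI ballI)
    show "finite (b ` \<Psi>)" using \<Psi>(1) by simp
    show "b ` \<Psi> \<subseteq> carrier ?Q" using bQ by blast
    fix X assume "X \<in> carrier ?Q"
    then obtain x where x: "x \<in> carrier A" "X = I +> x" by (auto simp: a_rcosets_iff)
    let ?c = "\<lambda>s\<in>b ` \<Psi>. inv_into \<Psi> b s x"
    show "\<exists>!c. c \<in> b ` \<Psi> \<rightarrow>\<^sub>E UNIV \<and> X = (\<Oplus>\<^bsub>?Q\<^esub>s\<in>b ` \<Psi>. c s \<odot>\<^bsub>?Q\<^esub> s)"
      unfolding x(2) comb[OF x(1)]
    proof (rule ex1I[of _ ?c])
      show "?c \<in> b ` \<Psi> \<rightarrow>\<^sub>E UNIV \<and> (\<forall>\<phi>\<in>\<Psi>. \<phi> x = ?c (b \<phi>))"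
        using inj by (simp add: inv_into_f_f)
      fix c assume c: "c \<in> b ` \<Psi> \<rightarrow>\<^sub>E UNIV \<and> (\<forall>\<phi>\<in>\<Psi>. \<phi> x = c (b \<phi>))"
      show "c = ?c"
      proof (rule extensionalityI[of _ "b ` \<Psi>"])
        fix s assume "s \<in> b ` \<Psi>"
        then show "c s = ?c s" using c inj by (auto simp: inv_into_f_f)
      qed (use c in \<open>auto simp: PiE_def\<close>)
    qed
  qed
qed

end

section \<open>Group-like elements of the finite dual\<close>

text \<open>Only the algebra structure of \<open>B\<close> matters for which functionals belong to the finite dual and
  which of these are group-like, so no axiom is imposed on the comultiplication.\<close>

locale commutative_bialgebra = commutative_algebra B
  for B :: "('k::field, 'a, 'm) bialgebra_scheme" (structure)
begin

abbreviation "H \<equiv> finite_dual_algebra B"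

lemma finite_dual_simps [simp]:
  "f \<oplus>\<^bsub>H\<^esub> g = f + g" "c \<odot>\<^bsub>H\<^esub> f = fscale c f"
  by (auto simp: finite_dual_algebra_def fscale_def fun_eq_iff)

lemma finite_dual_iff:
  "f \<in> carrier H \<longleftrightarrow> f \<in> linear_functionals B \<and>
    (\<exists>\<Phi>. finite \<Phi> \<and> \<Phi> \<subseteq> linear_functionals B \<and> ideal (common_kernel B \<Phi>) B \<and>
      (\<forall>x\<in>common_kernel B \<Phi>. f x = 0))"
  using finite_dim_quotient_imp_common_kernel common_kernel_imp_finite_dim_quotient
  unfolding finite_dual_algebra_def by (simp; metis)

lemma finite_dual_functional: "f \<in> carrier H \<Longrightarrow> f \<in> linear_functionals B"
  by (simp add: finite_dual_iff)

lemma finite_dual_subspace: "fn.subspace (carrier H)"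
  unfolding fn.subspace_def
proof (intro conjI ballI allI)
  have "common_kernel B {} = carrier B" by (simp add: common_kernel_def)
  then show "0 \<in> carrier H"
    using oneideal fn.subspace_0[OF linear_functionals_subspace]
    unfolding finite_dual_iff by (intro conjI exI[of _ "{}"]) auto
next
  fix f g assume "f \<in> carrier H" "g \<in> carrier H"
  then obtain \<Phi> \<Psi> where *: "f \<in> linear_functionals B" "g \<in> linear_functionals B"
    "finite \<Phi>" "\<Phi> \<subseteq> linear_functionals B" "ideal (common_kernel B \<Phi>) B" "\<forall>x\<in>common_kernel B \<Phi>. f x = 0"
    "finite \<Psi>" "\<Psi> \<subseteq> linear_functionals B" "ideal (common_kernel B \<Psi>) B" "\<forall>x\<in>common_kernel B \<Psi>. g x = 0"
    unfolding finite_dual_iff by blast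
  have "common_kernel B (\<Phi> \<union> \<Psi>) = common_kernel B \<Phi> \<inter> common_kernel B \<Psi>"
    by (auto simp: common_kernel_def)
  then show "f + g \<in> carrier H"
    unfolding finite_dual_iff using * i_intersect[OF *(5,9)]
    by (intro conjI exI[of _ "\<Phi> \<union> \<Psi>"]) (auto intro: fn.subspace_add[OF linear_functionals_subspace])
next
  fix c f assume "f \<in> carrier H"
  then show "fscale c f \<in> carrier H"
    unfolding finite_dual_iff using fn.subspace_scale[OF linear_functionals_subspace]
    by (auto simp: fscale_apply)
qed

lemma characters_finite_dual:
  assumes "f \<in> characters B"
  shows "f \<in> carrier H"
proof -
  have f: "f \<in> alg_hom B ground_algebra" "f \<in> linear_functionals B"
    using assms by (auto simp: characters_def)
  interpret ground: commutative_algebra "ground_algebra :: ('k, 'k) module"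
    by (rule commutative_algebra_ground)
  have "ideal (a_kernel B ground_algebra f) B"
    by (rule ring_hom_ring.kernel_is_ideal, rule ring_hom_ringI2)
      (use f(1) in \<open>simp_all add: alg_hom_def ring_axioms ground.ring_axioms\<close>)
  moreover have "a_kernel B ground_algebra f = common_kernel B {f}"
    by (auto simp: a_kernel_def' common_kernel_def)
  ultimately show ?thesis
    unfolding finite_dual_iff using f(2) by (intro conjI exI[of _ "{f}"]) (auto simp: common_kernel_def)
qed

lemma evaluation_linear_form: "linear_form_on H (\<lambda>g. g a)"
  by (simp add: linear_form_on_def fscale_apply)

lemma single_zero_relation:
  assumes "f \<in> carrier H"
  shows "Poly_Mapping.single (f, 0) 1 \<in> tensor_relations H H"
  using tensor_relations_intro(4)[OF assms fn.subspace_0[OF finite_dual_subspace], of 0]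
  by simp

text \<open>Modulo the bilinearity relations, \<open>d (\<Sum>c\<^sub>\<beta> \<beta>) \<otimes> h\<close> equals \<open>\<Sum>\<beta> \<otimes> (c\<^sub>\<beta> d h)\<close>.\<close>

lemma single_combination_relation:
  fixes c :: "('a \<Rightarrow> 'k) \<Rightarrow> 'k" and d :: 'k
  assumes "finite T" "T \<subseteq> carrier H" "h \<in> carrier H"
  shows "Poly_Mapping.single (\<Sum>\<beta>\<in>T. fscale (c \<beta>) \<beta>, h) d -
    (\<Sum>\<beta>\<in>T. Poly_Mapping.single (\<beta>, fscale (c \<beta> * d) h) 1) \<in> tensor_relations H H"
  using assms(1,2)
proof (induction T)
  case empty
  have "Poly_Mapping.single (fscale 0 h, h) d - Poly_Mapping.single (h, h) 0 \<in> tensor_relations H H"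
    using free.subspace_scale[OF tensor_relations_subspace
        tensor_relations_intro(3)[OF assms(3,3), of 0], of d]
    by (simp add: free.scale_right_diff_distrib)
  then show ?case by (simp only: sum.empty fn.scale_zero_left single_zero diff_0_right)
next
  case (insert \<beta> T)
  let ?R = "tensor_relations H H" and ?s = "\<Sum>\<beta>\<in>T. fscale (c \<beta>) \<beta>"
  note sub = tensor_relations_subspace[of H H] and subH = finite_dual_subspace
  have \<beta>: "\<beta> \<in> carrier H" and s: "?s \<in> carrier H"
    using insert.prems by (auto intro!: fn.subspace_sum[OF subH] fn.subspace_scale[OF subH])
  have r1: "Poly_Mapping.single (fscale (c \<beta>) \<beta> + ?s, h) d - Poly_Mapping.single (fscale (c \<beta>) \<beta>, h) d -
      Poly_Mapping.single (?s, h) d \<in> ?R"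
    using free.subspace_scale[OF sub tensor_relations_intro(1)[OF
        fn.subspace_scale[OF subH \<beta>, of "c \<beta>"] assms(3) s], of d]
    by (simp add: free.scale_right_diff_distrib)
  have r2: "Poly_Mapping.single (fscale (c \<beta>) \<beta>, h) d - Poly_Mapping.single (\<beta>, h) (c \<beta> * d) \<in> ?R"
    using free.subspace_scale[OF sub tensor_relations_intro(3)[OF \<beta> assms(3), of "c \<beta>"], of d]
    by (simp add: free.scale_right_diff_distrib mult.commute)
  have r3: "Poly_Mapping.single (\<beta>, fscale (c \<beta> * d) h) 1 - Poly_Mapping.single (\<beta>, h) (c \<beta> * d) \<in> ?R"
    using tensor_relations_intro(4)[OF \<beta> assms(3), of "c \<beta> * d"] by simp
  have r4: "Poly_Mapping.single (?s, h) d -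
      (\<Sum>\<beta>\<in>T. Poly_Mapping.single (\<beta>, fscale (c \<beta> * d) h) 1) \<in> ?R"
    using insert by simp
  have "(Poly_Mapping.single (fscale (c \<beta>) \<beta> + ?s, h) d -
        Poly_Mapping.single (fscale (c \<beta>) \<beta>, h) d - Poly_Mapping.single (?s, h) d) +
      (Poly_Mapping.single (fscale (c \<beta>) \<beta>, h) d - Poly_Mapping.single (\<beta>, h) (c \<beta> * d)) -
      (Poly_Mapping.single (\<beta>, fscale (c \<beta> * d) h) 1 - Poly_Mapping.single (\<beta>, h) (c \<beta> * d)) +
      (Poly_Mapping.single (?s, h) d - (\<Sum>\<beta>\<in>T. Poly_Mapping.single (\<beta>, fscale (c \<beta> * d) h) 1)) \<in> ?R"
    by (rule free.subspace_add[OF sub free.subspace_diff[OF sub free.subspace_add[OF sub r1 r2] r3] r4])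
  moreover have "(X - Y - Z) + (Y - W) - (V - W) + (Z - S) = X - (V + S)"
    for X Y Z W V S :: "('a \<Rightarrow> 'k) \<times> ('a \<Rightarrow> 'k) \<Rightarrow>\<^sub>0 'k"
    by (simp add: algebra_simps)
  ultimately show ?case by (simp only: sum.insert[OF insert.hyps])
qed

text \<open>If \<open>T\<close> spans the left factors, then every tensor is of the form \<open>\<Sum>\<beta>\<in>T. \<beta> \<otimes> h\<^sub>\<beta>\<close>.\<close>

lemma tensor_normal_form:
  assumes T: "finite T" "T \<subseteq> carrier H" "G \<subseteq> fn.span T"
    and p: "Poly_Mapping.keys p \<subseteq> G \<times> carrier H"
  shows "\<exists>h. (\<forall>\<beta>\<in>T. h \<beta> \<in> carrier H) \<and>
    p - (\<Sum>\<beta>\<in>T. Poly_Mapping.single (\<beta>, h \<beta>) 1) \<in> tensor_relations H H"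
  using p
proof (induction p rule: poly_mapping_add_single_induct)
  case zero
  note sub = tensor_relations_subspace[of H H]
  have "- (\<Sum>\<beta>\<in>T. Poly_Mapping.single (\<beta>, 0) 1) \<in> tensor_relations H H"
    using T(2) by (intro free.subspace_neg[OF sub] free.subspace_sum[OF sub] single_zero_relation) auto
  then show ?case
    using fn.subspace_0[OF finite_dual_subspace]
    by (intro exI[of _ "\<lambda>_::'a \<Rightarrow> 'k. 0 :: 'a \<Rightarrow> 'k"] conjI ballI) (simp_all only: diff_0)
next
  case (add k d p)
  let ?R = "tensor_relations H H"
  note sub = tensor_relations_subspace[of H H] and subH = finite_dual_subspace
  have "Poly_Mapping.keys (Poly_Mapping.single k d + p) = insert k (Poly_Mapping.keys p)"
    using add(2,3) by (rule keys_single_add)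
  then have kp: "k \<in> G \<times> carrier H" "Poly_Mapping.keys p \<subseteq> G \<times> carrier H" using add(4) by auto
  obtain f g where k: "k = (f, g)" "f \<in> fn.span T" "g \<in> carrier H" using kp(1) T(3) by auto
  obtain c where c: "f = (\<Sum>\<beta>\<in>T. fscale (c \<beta>) \<beta>)"
    using k(2) fn.span_finite[OF T(1)] by auto
  obtain h where h: "\<And>\<beta>. \<beta> \<in> T \<Longrightarrow> h \<beta> \<in> carrier H"
    "p - (\<Sum>\<beta>\<in>T. Poly_Mapping.single (\<beta>, h \<beta>) 1) \<in> ?R"
    using add(1)[OF kp(2)] by blast
  let ?g = "\<lambda>\<beta>. fscale (c \<beta> * d) g"
  have g: "?g \<beta> \<in> carrier H" for \<beta> using fn.subspace_scale[OF subH k(3)] .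
  have 1: "Poly_Mapping.single k d - (\<Sum>\<beta>\<in>T. Poly_Mapping.single (\<beta>, ?g \<beta>) 1) \<in> ?R"
    using single_combination_relation[OF T(1,2) k(3), of c d] by (simp add: k(1) c)
  have 2: "(\<Sum>\<beta>\<in>T. Poly_Mapping.single (\<beta>, ?g \<beta> + h \<beta>) 1 - Poly_Mapping.single (\<beta>, ?g \<beta>) 1 -
      Poly_Mapping.single (\<beta>, h \<beta>) 1) \<in> ?R"
  proof (rule free.subspace_sum[OF sub])
    fix \<beta> assume "\<beta> \<in> T"
    then show "Poly_Mapping.single (\<beta>, ?g \<beta> + h \<beta>) 1 - Poly_Mapping.single (\<beta>, ?g \<beta>) 1 -
        Poly_Mapping.single (\<beta>, h \<beta>) 1 \<in> ?R"
      using tensor_relations_intro(2)[of \<beta> H "?g \<beta>" H "h \<beta>"] T(2) g h(1) by auto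
  qed
  have alg: "(X - Y) + (Z - V) - (W - Y - V) = X + Z - W"
    for X Y Z V W :: "('a \<Rightarrow> 'k) \<times> ('a \<Rightarrow> 'k) \<Rightarrow>\<^sub>0 'k"
    by (simp add: algebra_simps)
  note free.subspace_diff[OF sub free.subspace_add[OF sub 1 h(2)] 2]
  then have "Poly_Mapping.single k d + p - (\<Sum>\<beta>\<in>T. Poly_Mapping.single (\<beta>, ?g \<beta> + h \<beta>) 1) \<in> ?R"
    unfolding sum_subtractf by (simp only: alg)
  moreover have "\<forall>\<beta>\<in>T. ?g \<beta> + h \<beta> \<in> carrier H"
    using fn.subspace_add[OF subH g h(1)] by blast
  ultimately show ?case by (intro exI[of _ "\<lambda>\<beta>. ?g \<beta> + h \<beta>"] conjI)
qed

text \<open>A tensor of functionals that vanishes on all pairs of arguments is \<open>0\<close>: bring it to normal form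
  over a basis and evaluate at a dual system. This is the uniqueness that the definition of the
  comultiplication of the finite dual relies on.\<close>

lemma tensor_separation:
  assumes p: "p \<in> carrier (free_algebra H H)"
    and zero: "\<And>a b. a \<in> carrier B \<Longrightarrow> b \<in> carrier B \<Longrightarrow> bilinear_value (\<lambda>g. g a) (\<lambda>h. h b) p = 0"
  shows "p \<in> tensor_relations H H"
proof -
  let ?R = "tensor_relations H H" and ?G = "fst ` Poly_Mapping.keys p"
  note sub = tensor_relations_subspace[of H H]
  have G: "?G \<subseteq> carrier H" "Poly_Mapping.keys p \<subseteq> ?G \<times> carrier H"
    using p by (force simp: free_algebra_carrier)+
  obtain T where T: "T \<subseteq> ?G" "fn.independent T" "?G \<subseteq> fn.span T"
    by (rule fn.maximal_independent_subset)
  have fin: "finite T" by (rule finite_subset[OF T(1)]) simp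
  have TH: "T \<subseteq> carrier H" by (rule subset_trans[OF T(1) G(1)])
  then have TL: "T \<subseteq> linear_functionals B" using finite_dual_functional by blast
  obtain h where h: "\<And>\<beta>. \<beta> \<in> T \<Longrightarrow> h \<beta> \<in> carrier H"
    and rel: "p - (\<Sum>\<beta>\<in>T. Poly_Mapping.single (\<beta>, h \<beta>) 1) \<in> ?R"
    using tensor_normal_form[OF fin TH T(3) G(2)] by blast
  \<comment> \<open>The value of the normal form at \<open>(a, b)\<close>.\<close>
  have sum0: "(\<Sum>\<beta>\<in>T. \<beta> a * h \<beta> b) = 0" if "a \<in> carrier B" "b \<in> carrier B" for a b
    using bilinear_value_relations[OF evaluation_linear_form evaluation_linear_form rel, of a b] zero[OF that]
    by (simp add: bilinear_value_minus bilinear_value_sum)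
  obtain a where a: "\<And>\<phi>. \<phi> \<in> T \<Longrightarrow> a \<phi> \<in> carrier B"
    "\<And>\<phi> \<psi>. \<phi> \<in> T \<Longrightarrow> \<psi> \<in> T \<Longrightarrow> \<psi> (a \<phi>) = (if \<psi> = \<phi> then 1 else 0)"
    using dual_elements_exist[OF fin T(2) TL] by blast
  have "h \<beta> = 0" if \<beta>: "\<beta> \<in> T" for \<beta>
  proof
    fix b
    show "h \<beta> b = 0 b"
    proof (cases "b \<in> carrier B")
      case True
      have "(\<Sum>\<gamma>\<in>T. \<gamma> (a \<beta>) * h \<gamma> b) = (\<Sum>\<gamma>\<in>T. if \<gamma> = \<beta> then h \<gamma> b else 0)"
        by (intro sum.cong refl) (simp add: a(2)[OF \<beta>])
      then show ?thesis using sum0[OF a(1)[OF \<beta>] True] fin \<beta> by simp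
    next
      case False
      then show ?thesis using functional_outside[OF finite_dual_functional[OF h[OF \<beta>]]] by simp
    qed
  qed
  then have "(\<Sum>\<beta>\<in>T. Poly_Mapping.single (\<beta>, h \<beta>) 1) \<in> ?R"
    using TH by (intro free.subspace_sum[OF sub]) (auto intro: single_zero_relation)
  from free.subspace_add[OF sub rel this] show ?thesis by simp
qed

lemma finite_dual_comult_eqI:
  assumes "t \<in> carrier (tensor_algebra H H)"
    and "\<And>a b. a \<in> carrier B \<Longrightarrow> b \<in> carrier B \<Longrightarrow>
      tensor_functional (\<lambda>g. g a) (\<lambda>h. h b) t = f (a \<otimes> b)"
  shows "finite_dual_comult B f = t"
  unfolding finite_dual_comult_def
proof (rule the_equality)
  fix u assume u: "u \<in> carrier (tensor_algebra H H) \<and> (\<forall>a\<in>carrier B. \<forall>b\<in>carrier B.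
    tensor_functional (\<lambda>g. g a) (\<lambda>h. h b) u = f (a \<otimes> b))"
  note val = tensor_functional_coset[OF evaluation_linear_form evaluation_linear_form]
  obtain p q where pq: "p \<in> carrier (free_algebra H H)" "q \<in> carrier (free_algebra H H)"
    "u = tensor_relations H H +>\<^bsub>free_algebra H H\<^esub> p" "t = tensor_relations H H +>\<^bsub>free_algebra H H\<^esub> q"
    using u assms(1) by (auto simp: tensor_algebra_carrier)
  have "p - q \<in> tensor_relations H H"
  proof (rule tensor_separation)
    show "p - q \<in> carrier (free_algebra H H)"
      using free.subspace_diff[OF free_algebra_subspace pq(1,2)] .
    show "bilinear_value (\<lambda>g. g a) (\<lambda>h. h b) (p - q) = 0" if "a \<in> carrier B" "b \<in> carrier B" for a b
      using u assms(2)[OF that] that by (simp add: bilinear_value_minus pq(3,4) val)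
  qed
  then show "u = t" by (simp add: pq tensor_relations_coset_eq_iff)
qed (use assms in auto)

text \<open>If \<open>f\<close> vanishes on an ideal that is the common kernel of functionals \<open>\<phi>\<close> with dual system
  \<open>a\<^sub>\<phi>\<close>, then \<open>f (x y) = \<Sum>\<phi> x * f (a\<^sub>\<phi> y)\<close>.\<close>

lemma finite_dual_comult_exists:
  assumes "f \<in> carrier H"
  obtains t where "t \<in> carrier (tensor_algebra H H)"
    "\<And>a b. a \<in> carrier B \<Longrightarrow> b \<in> carrier B \<Longrightarrow>
      tensor_functional (\<lambda>g. g a) (\<lambda>h. h b) t = f (a \<otimes> b)"
proof -
  obtain \<Phi> where \<Phi>: "f \<in> linear_functionals B" "finite \<Phi>" "\<Phi> \<subseteq> linear_functionals B"
    "ideal (common_kernel B \<Phi>) B" "\<And>x. x \<in> common_kernel B \<Phi> \<Longrightarrow> f x = 0"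
    using assms unfolding finite_dual_iff by blast
  obtain \<Psi> a where \<Psi>: "finite \<Psi>" "\<Psi> \<subseteq> linear_functionals B" "common_kernel B \<Psi> = common_kernel B \<Phi>"
    "\<And>\<phi>. \<phi> \<in> \<Psi> \<Longrightarrow> a \<phi> \<in> carrier B"
    "\<And>\<phi> \<psi>. \<phi> \<in> \<Psi> \<Longrightarrow> \<psi> \<in> \<Psi> \<Longrightarrow> \<psi> (a \<phi>) = (if \<psi> = \<phi> then 1 else 0)"
    using common_kernel_basis[OF \<Phi>(2,3)] by blast
  interpret I: ideal "common_kernel B \<Psi>" B by (simp only: \<Psi>(3) \<Phi>(4))
  define g where "g \<phi> y = (if y \<in> carrier B then f (a \<phi> \<otimes> y) else 0)" for \<phi> y
  have finite_dualI: "\<chi> \<in> carrier H" if "\<chi> \<in> linear_functionals B" "\<forall>x\<in>common_kernel B \<Psi>. \<chi> x = 0" for \<chi>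
    unfolding finite_dual_iff
    by (rule conjI[OF that(1) exI[of _ \<Psi>]], intro conjI) (fact \<Psi> I.ideal_axioms that)+
  have \<phi>H: "\<phi> \<in> carrier H" if \<phi>: "\<phi> \<in> \<Psi>" for \<phi>
  proof (rule finite_dualI)
    show "\<phi> \<in> linear_functionals B" by (rule subsetD[OF \<Psi>(2) \<phi>])
    show "\<forall>x\<in>common_kernel B \<Psi>. \<phi> x = 0" using \<phi> unfolding common_kernel_def by blast
  qed
  have gH: "g \<phi> \<in> carrier H" if "\<phi> \<in> \<Psi>" for \<phi>
  proof -
    have "g \<phi> \<in> linear_functionals B"
      using functional_add[OF \<Phi>(1)] functional_smult[OF \<Phi>(1)] \<Psi>(4)[OF that]
      by (simp add: linear_functionals_def g_def r_distr smult_mult_right)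
    moreover have "g \<phi> y = 0" if "y \<in> common_kernel B \<Psi>" for y
      using \<Phi>(5)[OF I.I_l_closed[OF that \<Psi>(4)[OF \<open>\<phi> \<in> \<Psi>\<close>], unfolded \<Psi>(3)]]
      by (simp add: g_def)
    ultimately show ?thesis using finite_dualI by blast
  qed
  let ?p = "\<Sum>\<phi>\<in>\<Psi>. Poly_Mapping.single (\<phi>, g \<phi>) 1"
  have p: "?p \<in> carrier (free_algebra H H)"
    using \<phi>H gH by (intro free.subspace_sum[OF free_algebra_subspace] free_algebra_single_closed)
  have "bilinear_value (\<lambda>h. h x) (\<lambda>h. h y) ?p = f (x \<otimes> y)" if xy: "x \<in> carrier B" "y \<in> carrier B" for x y
  proof -
    let ?s = "\<Oplus>\<phi>\<in>\<Psi>. \<phi> x \<odot> a \<phi>"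
    have sA: "(\<lambda>\<phi>. \<phi> x \<odot> a \<phi>) \<in> \<Psi> \<rightarrow> carrier B" using \<Psi>(4) by auto
    have "x \<ominus> ?s \<in> common_kernel B \<Psi>"
    proof (subst common_kernel_expansion)
      show "\<forall>\<phi>\<in>\<Psi>. \<phi> x = \<phi> x" by simp
    qed (fact \<Psi> xy)+
    then have "(x \<ominus> ?s) \<otimes> y \<in> common_kernel B \<Psi>" using I.I_r_closed xy(2) by blast
    then have "f ((x \<ominus> ?s) \<otimes> y) = 0" using \<Phi>(5) \<Psi>(3) by simp
    moreover have "(x \<ominus> ?s) \<otimes> y = x \<otimes> y \<ominus> ?s \<otimes> y"
      using xy sA by (simp add: a_minus_def l_distr l_minus)
    ultimately have "f (x \<otimes> y) = f (?s \<otimes> y)"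
      using functional_minus[OF \<Phi>(1)] xy sA by simp
    also have "?s \<otimes> y = (\<Oplus>\<phi>\<in>\<Psi>. \<phi> x \<odot> (a \<phi> \<otimes> y))"
      unfolding finsum_ldistr[OF \<Psi>(1) xy(2) sA]
      using \<Psi>(4) xy by (intro finsum_cong') (auto simp: smult_mult)
    also have "f \<dots> = (\<Sum>\<phi>\<in>\<Psi>. f (\<phi> x \<odot> (a \<phi> \<otimes> y)))"
      using \<Psi>(4) xy by (intro functional_finsum[OF \<Phi>(1)]) auto
    also have "\<dots> = (\<Sum>\<phi>\<in>\<Psi>. \<phi> x * g \<phi> y)"
      using \<Psi>(4) xy by (intro sum.cong) (auto simp: functional_smult[OF \<Phi>(1)] g_def)
    finally show ?thesis by (simp add: bilinear_value_sum)
  qed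
  then show thesis
    using p that[of "tensor_relations H H +>\<^bsub>free_algebra H H\<^esub> ?p"]
    by (auto simp: tensor_algebra_carrier
        tensor_functional_coset[OF evaluation_linear_form evaluation_linear_form])
qed

lemma finite_dual_tensor_closed:
  assumes "f \<in> carrier H" "g \<in> carrier H"
  shows "tensor H H f g \<in> carrier (tensor_algebra H H)"
  unfolding tensor_algebra_carrier tensor_def using free_algebra_single_closed[OF assms] by blast

lemma tensor_extend: "tensor (module.extend A m) (module.extend A m') f g = tensor A A f g"
  by (simp add: tensor_def tensor_relations_def a_r_coset_def r_coset_def free_algebra_def)

theorem grouplikes_finite_dual: "carrier (grouplikes (finite_dual B)) = characters B"
proof -
  have carrier: "f \<in> carrier (grouplikes (finite_dual B)) \<longleftrightarrow>
      f \<in> carrier H \<and> finite_dual_comult B f = tensor H H f f \<and> f \<one> = 1" for f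
    by (simp add: grouplikes_def finite_dual_def tensor_extend) (simp add: module.extend_def)
  have val: "tensor_functional (\<lambda>g. g a) (\<lambda>h. h b) (tensor H H f f) = f a * f b" for f a b
    by (rule tensor_functional_tensor[OF evaluation_linear_form evaluation_linear_form])
  show ?thesis
  proof (intro equalityI subsetI)
    fix f assume "f \<in> carrier (grouplikes (finite_dual B))"
    then have f: "f \<in> carrier H" "finite_dual_comult B f = tensor H H f f" "f \<one> = 1"
      by (auto simp: carrier)
    obtain t where t: "t \<in> carrier (tensor_algebra H H)"
      "\<And>a b. a \<in> carrier B \<Longrightarrow> b \<in> carrier B \<Longrightarrow>
        tensor_functional (\<lambda>g. g a) (\<lambda>h. h b) t = f (a \<otimes> b)"
      using finite_dual_comult_exists[OF f(1)] by blast
    have "t = tensor H H f f" using finite_dual_comult_eqI[OF t] f(2) by simp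
    then have "f (a \<otimes> b) = f a * f b" if "a \<in> carrier B" "b \<in> carrier B" for a b
      using t(2)[OF that] by (simp add: val)
    then show "f \<in> characters B"
      using finite_dual_functional[OF f(1)] f(3)
      by (auto simp: characters_def linear_functionals_def intro!: alg_homI)
  next
    fix f assume f: "f \<in> characters B"
    then have h: "f \<in> alg_hom B ground_algebra" by (simp add: characters_def)
    have fH: "f \<in> carrier H" by (rule characters_finite_dual[OF f])
    have "finite_dual_comult B f = tensor H H f f"
      by (rule finite_dual_comult_eqI[OF finite_dual_tensor_closed[OF fH fH]])
        (simp add: val alg_homD(3)[OF h])
    then show "f \<in> carrier (grouplikes (finite_dual B))"
      using fH alg_homD(4)[OF h] by (simp add: carrier)
  qed
qed

end

section \<open>Endomorphisms and their matrices\<close>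

text \<open>The convolution monoid is compared with a monoid of maps by a multiplicative bijection; its monoid
  laws are transported rather than proved directly.\<close>

lemma bij_monoid:
  assumes E: "monoid E" and bij: "bij_betw z (carrier G) (carrier E)"
    and closed: "\<And>f g. f \<in> carrier G \<Longrightarrow> g \<in> carrier G \<Longrightarrow> f \<otimes>\<^bsub>G\<^esub> g \<in> carrier G"
    and one: "\<one>\<^bsub>G\<^esub> \<in> carrier G" and z_one: "z \<one>\<^bsub>G\<^esub> = \<one>\<^bsub>E\<^esub>"
    and z_mult: "\<And>f g. f \<in> carrier G \<Longrightarrow> g \<in> carrier G \<Longrightarrow> z (f \<otimes>\<^bsub>G\<^esub> g) = z f \<otimes>\<^bsub>E\<^esub> z g"
  shows "monoid G"
proof -
  interpret E: monoid E by fact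
  have inj: "f = g" if "z f = z g" "f \<in> carrier G" "g \<in> carrier G" for f g
    using bij that by (auto simp: bij_betw_def inj_on_def)
  have zE: "z f \<in> carrier E" if "f \<in> carrier G" for f using bij that by (auto simp: bij_betw_def)
  show ?thesis
  proof (rule monoidI)
    show "f \<otimes>\<^bsub>G\<^esub> g \<otimes>\<^bsub>G\<^esub> h = f \<otimes>\<^bsub>G\<^esub> (g \<otimes>\<^bsub>G\<^esub> h)"
      if "f \<in> carrier G" "g \<in> carrier G" "h \<in> carrier G" for f g h
      by (rule inj) (simp_all add: that closed z_mult zE E.m_assoc)
    show "\<one>\<^bsub>G\<^esub> \<otimes>\<^bsub>G\<^esub> f = f" if "f \<in> carrier G" for f
      by (rule inj) (simp_all add: that closed one z_mult z_one zE)
    show "f \<otimes>\<^bsub>G\<^esub> \<one>\<^bsub>G\<^esub> = f" if "f \<in> carrier G" for f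
      by (rule inj) (simp_all add: that closed one z_mult z_one zE)
  qed (fact closed one)+
qed

lemma bij_units_iso:
  assumes G: "monoid G" and E: "monoid E" and bij: "bij_betw z (carrier G) (carrier E)"
    and z_one: "z \<one>\<^bsub>G\<^esub> = \<one>\<^bsub>E\<^esub>"
    and z_mult: "\<And>f g. f \<in> carrier G \<Longrightarrow> g \<in> carrier G \<Longrightarrow> z (f \<otimes>\<^bsub>G\<^esub> g) = z f \<otimes>\<^bsub>E\<^esub> z g"
  shows "z \<in> iso (units_of G) (units_of E)"
proof -
  interpret G: monoid G by fact
  interpret E: monoid E by fact
  have inj: "f = g" if "z f = z g" "f \<in> carrier G" "g \<in> carrier G" for f g
    using bij that by (auto simp: bij_betw_def inj_on_def)
  have zE: "z f \<in> carrier E" if "f \<in> carrier G" for f using bij that by (auto simp: bij_betw_def)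
  have fwd: "z f \<in> Units E" if f: "f \<in> Units G" for f
  proof -
    obtain g where g: "f \<in> carrier G" "g \<in> carrier G" "g \<otimes>\<^bsub>G\<^esub> f = \<one>\<^bsub>G\<^esub>" "f \<otimes>\<^bsub>G\<^esub> g = \<one>\<^bsub>G\<^esub>"
      using f unfolding Units_def by blast
    then have "z g \<otimes>\<^bsub>E\<^esub> z f = \<one>\<^bsub>E\<^esub>" "z f \<otimes>\<^bsub>E\<^esub> z g = \<one>\<^bsub>E\<^esub>"
      using z_mult[of g f] z_mult[of f g] z_one by auto
    then show ?thesis using zE g unfolding Units_def by blast
  qed
  have bwd: "\<exists>f\<in>Units G. z f = u" if u: "u \<in> Units E" for u
  proof -
    obtain v where v: "u \<in> carrier E" "v \<in> carrier E" "v \<otimes>\<^bsub>E\<^esub> u = \<one>\<^bsub>E\<^esub>" "u \<otimes>\<^bsub>E\<^esub> v = \<one>\<^bsub>E\<^esub>"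
      using u unfolding Units_def by blast
    have "u \<in> z ` carrier G" "v \<in> z ` carrier G" using bij v(1,2) by (simp_all add: bij_betw_def)
    then obtain f g where fg: "f \<in> carrier G" "g \<in> carrier G" "z f = u" "z g = v" by blast
    have "g \<otimes>\<^bsub>G\<^esub> f = \<one>\<^bsub>G\<^esub>" "f \<otimes>\<^bsub>G\<^esub> g = \<one>\<^bsub>G\<^esub>"
      by (rule inj; simp add: fg z_mult z_one v)+
    then show ?thesis using fg unfolding Units_def by blast
  qed
  show ?thesis
  proof (rule isoI)
    show "z \<in> hom (units_of G) (units_of E)"
      by (rule homI) (auto simp: units_of_carrier units_of_mult fwd z_mult G.Units_closed)
    show "bij_betw z (carrier (units_of G)) (carrier (units_of E))"
      unfolding units_of_carrier bij_betw_def
      using fwd bwd inj G.Units_closed by (auto simp: inj_on_def)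
  qed
qed

text \<open>A Lie-Yamaguti algebra with basis \<open>e 1, \<dots>, e n\<close>.\<close>

locale lie_yamaguti_basis = lie_yamaguti_algebra scale br tr + structure_constants scale br tr n e
  for scale :: "'k::field \<Rightarrow> 'v::ab_group_add \<Rightarrow> 'v" and br tr n e +
  assumes inj: "inj_on e {1..n}"
    and indep: "independent (e ` {1..n})"
    and spanning: "span (e ` {1..n}) = UNIV"
begin

abbreviation "lin \<equiv> Vector_Spaces.linear scale scale"

lemma lin_iff: "lin f \<longleftrightarrow> (\<forall>v w. f (v + w) = f v + f w) \<and> (\<forall>c v. f (scale c v) = scale c (f v))"
  by (simp add: Vector_Spaces.linear_iff vector_space_axioms)

lemma linD:
  assumes "lin f"
  shows "f (v + w) = f v + f w" "f (scale c v) = scale c (f v)" "f (\<Sum>s\<in>S. u s) = (\<Sum>s\<in>S. f (u s))"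
proof -
  show *: "f (v + w) = f v + f w" "f (scale c v) = scale c (f v)" for v w c
    using assms by (simp_all add: lin_iff)
  have "f 0 = 0" using *(2)[of 0 0] by simp
  then show "f (\<Sum>s\<in>S. u s) = (\<Sum>s\<in>S. f (u s))"
    by (induction S rule: infinite_finite_induct) (simp_all add: *)
qed

text \<open>The coefficient of \<open>v\<close> at \<open>e s\<close>.\<close>

definition coord :: "'v \<Rightarrow> nat \<Rightarrow> 'k"
  where "coord v s = representation (e ` {1..n}) v (e s)"

lemma expansion: "v = (\<Sum>s=1..n. scale (coord v s) (e s))"
proof -
  have "(\<Sum>b\<in>e ` {1..n}. scale (representation (e ` {1..n}) v b) b) = v"
    by (rule sum_representation_eq[OF indep]) (simp_all add: spanning)
  then show ?thesis by (simp add: sum.reindex[OF inj] coord_def)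
qed

lemma coord_add: "coord (v + w) s = coord v s + coord w s"
  by (simp add: coord_def representation_add[OF indep] spanning)

lemma coord_scale: "coord (scale c v) s = c * coord v s"
  by (simp add: coord_def representation_scale[OF indep] spanning)

lemma coord_sum: "coord (\<Sum>i\<in>I. v i) s = (\<Sum>i\<in>I. coord (v i) s)"
  by (simp add: coord_def representation_sum[OF indep] spanning)

lemma coord_basis:
  "s \<in> {1..n} \<Longrightarrow> i \<in> {1..n} \<Longrightarrow> coord (e i) s = (if s = i then 1 else 0)"
  using inj by (auto simp: coord_def representation_basis[OF indep] inj_on_eq_iff)

lemma coord_combination:
  assumes "s \<in> {1..n}"
  shows "coord (\<Sum>i=1..n. scale (c i) (e i)) s = c s"
proof -
  have "coord (\<Sum>i=1..n. scale (c i) (e i)) s = (\<Sum>i=1..n. if i = s then c i else 0)"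
    unfolding coord_sum coord_scale using assms by (intro sum.cong) (auto simp: coord_basis)
  then show ?thesis using assms by simp
qed

lemma coord_eqI: "(\<And>s. s \<in> {1..n} \<Longrightarrow> coord v s = coord w s) \<Longrightarrow> v = w"
  by (subst expansion[of v], subst expansion[of w]) (rule sum.cong, auto)

lemma lin_eqI:
  assumes "lin f" "lin g" "\<And>i. i \<in> {1..n} \<Longrightarrow> f (e i) = g (e i)"
  shows "f v = g v"
proof -
  have "f (\<Sum>s=1..n. scale (coord v s) (e s)) = g (\<Sum>s=1..n. scale (coord v s) (e s))"
    using assms(3) by (simp add: linD[OF assms(1)] linD[OF assms(2)])
  then show ?thesis by (simp flip: expansion)
qed

lemma coord_br: "coord (br v w) a =
  (\<Sum>\<sigma>\<in>{1..n} \<times> {1..n}. \<tau> (fst \<sigma>) (snd \<sigma>) a * (coord v (fst \<sigma>) * coord w (snd \<sigma>)))"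
proof -
  have "br v w = (\<Sum>i=1..n. scale (coord v i) (br (e i) w))"
    by (subst expansion[of v]) (simp add: linD[OF br_linear1])
  moreover have "br (e i) w = (\<Sum>j=1..n. scale (coord w j) (br (e i) (e j)))" for i
    by (subst expansion[of w]) (simp add: linD[OF br_linear2])
  ultimately have "br v w = (\<Sum>i=1..n. \<Sum>j=1..n. scale (coord v i) (scale (coord w j) (br (e i) (e j))))"
    by (simp only: scale_sum_right)
  then have "coord (br v w) a =
      (\<Sum>i=1..n. \<Sum>j=1..n. \<tau> i j a * (coord v i * coord w j))"
    by (simp add: coord_sum coord_scale br_coeff_def mult_ac flip: coord_def)
  then show ?thesis by (simp add: sum.cartesian_product case_prod_unfold)
qed

lemma coord_tr: "coord (tr v w u) a =
  (\<Sum>\<sigma>\<in>{1..n} \<times> {1..n} \<times> {1..n}. \<omega> (fst \<sigma>) (fst (snd \<sigma>)) (snd (snd \<sigma>)) a *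
    (coord v (fst \<sigma>) * (coord w (fst (snd \<sigma>)) * coord u (snd (snd \<sigma>)))))"
proof -
  have "tr v w u = (\<Sum>i=1..n. scale (coord v i) (tr (e i) w u))"
    by (subst expansion[of v]) (simp add: linD[OF tr_linear1])
  moreover have "tr (e i) w u = (\<Sum>j=1..n. scale (coord w j) (tr (e i) (e j) u))" for i
    by (subst expansion[of w]) (simp add: linD[OF tr_linear2])
  moreover have "tr (e i) (e j) u = (\<Sum>k=1..n. scale (coord u k) (tr (e i) (e j) (e k)))" for i j
    by (subst expansion[of u]) (simp add: linD[OF tr_linear3])
  ultimately have "tr v w u = (\<Sum>i=1..n. \<Sum>j=1..n. \<Sum>k=1..n. scale (coord v i) (scale (coord w j)
      (scale (coord u k) (tr (e i) (e j) (e k)))))"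
    by (simp only: scale_sum_right)
  then have "coord (tr v w u) a =
      (\<Sum>i=1..n. \<Sum>j=1..n. \<Sum>k=1..n. \<omega> i j k a * (coord v i * (coord w j * coord u k)))"
    by (simp add: coord_sum coord_scale tr_coeff_def mult_ac flip: coord_def)
  then show ?thesis by (simp add: sum.cartesian_product case_prod_unfold)
qed

lemma coord_lin:
  assumes "lin f"
  shows "coord (f v) a = (\<Sum>u=1..n. coord v u * coord (f (e u)) a)"
  by (subst expansion[of v]) (simp add: linD[OF assms] coord_sum coord_scale)

text \<open>Linear maps that preserve both brackets.\<close>

definition endomorphism :: "('v \<Rightarrow> 'v) \<Rightarrow> bool"
  where "endomorphism f \<longleftrightarrow> lin f \<and> (\<forall>v w. f (br v w) = br (f v) (f w)) \<and>
    (\<forall>v w u. f (tr v w u) = tr (f v) (f w) (f u))"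

lemma endomorphism_iff_structure_matrix:
  assumes f: "lin f"
  shows "endomorphism f \<longleftrightarrow> structure_matrix ground_algebra n \<tau> \<omega> (\<lambda>s i. coord (f (e i)) s)"
proof -
  let ?N = "{1..n}"
  have lin_br: "lin (\<lambda>v. f (br v w))" "lin (\<lambda>v. br (f v) (f w))"
    "lin (\<lambda>v. f (br w v))" "lin (\<lambda>v. br (f w) (f v))" for w
    using linD[OF f] linD[OF br_linear1] linD[OF br_linear2] by (simp_all add: lin_iff)
  have br: "(\<forall>v w. f (br v w) = br (f v) (f w)) \<longleftrightarrow>
      (\<forall>i\<in>?N. \<forall>j\<in>?N. f (br (e i) (e j)) = br (f (e i)) (f (e j)))"
  proof (intro iffI allI)
    fix v w assume *: "\<forall>i\<in>?N. \<forall>j\<in>?N. f (br (e i) (e j)) = br (f (e i)) (f (e j))"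
    have "f (br (e i) w) = br (f (e i)) (f w)" if "i \<in> ?N" for i
      by (rule lin_eqI[OF lin_br(3,4)]) (use * that in blast)
    then show "f (br v w) = br (f v) (f w)" by (rule lin_eqI[OF lin_br(1,2)])
  qed blast
  have lin_tr: "lin (\<lambda>v. f (tr v w u))" "lin (\<lambda>v. tr (f v) (f w) (f u))"
    "lin (\<lambda>v. f (tr w v u))" "lin (\<lambda>v. tr (f w) (f v) (f u))"
    "lin (\<lambda>v. f (tr w u v))" "lin (\<lambda>v. tr (f w) (f u) (f v))" for w u
    using linD[OF f] linD[OF tr_linear1] linD[OF tr_linear2] linD[OF tr_linear3]
    by (simp_all add: lin_iff)
  have tr: "(\<forall>v w u. f (tr v w u) = tr (f v) (f w) (f u)) \<longleftrightarrow>
      (\<forall>i\<in>?N. \<forall>j\<in>?N. \<forall>k\<in>?N. f (tr (e i) (e j) (e k)) = tr (f (e i)) (f (e j)) (f (e k)))"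
  proof (intro iffI allI)
    fix v w u
    assume *: "\<forall>i\<in>?N. \<forall>j\<in>?N. \<forall>k\<in>?N. f (tr (e i) (e j) (e k)) = tr (f (e i)) (f (e j)) (f (e k))"
    have "f (tr (e i) (e j) u) = tr (f (e i)) (f (e j)) (f u)" if "i \<in> ?N" "j \<in> ?N" for i j
      by (rule lin_eqI[OF lin_tr(5,6)]) (use * that in blast)
    then have "f (tr (e i) w u) = tr (f (e i)) (f w) (f u)" if "i \<in> ?N" for i
      by (rule lin_eqI[OF lin_tr(3,4)]) (use that in blast)
    then show "f (tr v w u) = tr (f v) (f w) (f u)" by (rule lin_eqI[OF lin_tr(1,2)])
  qed blast
  have coord_eq: "v = w \<longleftrightarrow> (\<forall>a\<in>?N. coord v a = coord w a)" for v w using coord_eqI by blast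
  have br': "f (br (e i) (e j)) = br (f (e i)) (f (e j)) \<longleftrightarrow>
      (\<forall>a\<in>?N. (\<Sum>u\<in>?N. \<tau> i j u * coord (f (e u)) a) =
        (\<Sum>\<sigma>\<in>?N \<times> ?N. \<tau> (fst \<sigma>) (snd \<sigma>) a *
          (coord (f (e i)) (fst \<sigma>) * coord (f (e j)) (snd \<sigma>))))" for i j
    unfolding coord_eq[of "f (br (e i) (e j))"] coord_lin[OF f, of "br (e i) (e j)"]
      coord_br[of "f (e i)" "f (e j)"]
    by (simp add: br_coeff_def coord_def)
  have tr': "f (tr (e i) (e j) (e k)) = tr (f (e i)) (f (e j)) (f (e k)) \<longleftrightarrow>
      (\<forall>a\<in>?N. (\<Sum>u\<in>?N. \<omega> i j k u * coord (f (e u)) a) =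
        (\<Sum>\<sigma>\<in>?N \<times> ?N \<times> ?N. \<omega> (fst \<sigma>) (fst (snd \<sigma>)) (snd (snd \<sigma>)) a *
          (coord (f (e i)) (fst \<sigma>) *
            (coord (f (e j)) (fst (snd \<sigma>)) * coord (f (e k)) (snd (snd \<sigma>))))))" for i j k
    unfolding coord_eq[of "f (tr (e i) (e j) (e k))"] coord_lin[OF f, of "tr (e i) (e j) (e k)"]
      coord_tr[of "f (e i)" "f (e j)" "f (e k)"]
    by (simp add: tr_coeff_def coord_def)
  show ?thesis
    unfolding endomorphism_def br tr br' tr' structure_matrix_def ground_algebra_simps finsum_ground
      split_paired_Ball_Sigma prod.case
    using f by blast
qed

lemma zeta:
  shows "lin (zeta scale br tr n e \<theta>)"
    and "i \<in> {1..n} \<Longrightarrow> zeta scale br tr n e \<theta> (e i) = (\<Sum>s=1..n. scale (\<theta> (x s i)) (e s))"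
proof -
  define w where "w i = (\<Sum>s=1..n. scale (\<theta> (x s i)) (e s))" for i
  let ?P = "\<lambda>f. lin f \<and> (\<forall>i\<in>{1..n}. f (e i) = w i)"
  define f where "f v = (\<Sum>i=1..n. scale (coord v i) (w i))" for v
  have "lin f"
    by (simp add: lin_iff f_def coord_add coord_scale scale_left_distrib sum.distrib
        scale_sum_right)
  moreover have "f (e i) = w i" if "i \<in> {1..n}" for i
  proof -
    have "f (e i) = (\<Sum>j=1..n. if j = i then w j else 0)"
      unfolding f_def using that by (intro sum.cong) (auto simp: coord_basis)
    then show ?thesis using that by simp
  qed
  ultimately have "?P f" by blast
  moreover have "g = f" if "?P g" for g
  proof
    show "g v = f v" for v
      by (rule lin_eqI) (use that \<open>?P f\<close> in simp_all)
  qed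
  ultimately have "zeta scale br tr n e \<theta> = f" unfolding zeta_def w_def by (rule the_equality)
  then show "lin (zeta scale br tr n e \<theta>)"
    "i \<in> {1..n} \<Longrightarrow> zeta scale br tr n e \<theta> (e i) = (\<Sum>s=1..n. scale (\<theta> (x s i)) (e s))"
    using \<open>?P f\<close> by (auto simp: w_def)
qed

lemma coord_zeta:
  "s \<in> {1..n} \<Longrightarrow> i \<in> {1..n} \<Longrightarrow> coord (zeta scale br tr n e \<theta> (e i)) s = \<theta> (x s i)"
  by (simp only: zeta(2) coord_combination)

lemma zeta_bij: "bij_betw (zeta scale br tr n e) (characters U) {f. endomorphism f}"
proof -
  let ?z = "zeta scale br tr n e"
  have cong: "structure_matrix ground_algebra n \<tau> \<omega> V \<longleftrightarrow> structure_matrix ground_algebra n \<tau> \<omega> W"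
    if "\<And>s i. s \<in> {1..n} \<Longrightarrow> i \<in> {1..n} \<Longrightarrow> V s i = W s i" for V W :: "nat \<Rightarrow> nat \<Rightarrow> 'k"
    unfolding structure_matrix_def ground_algebra_simps finsum_ground
    by (intro conj_cong ball_cong refl) (auto simp: that intro!: arg_cong2[where f = "(=)"] sum.cong)
  have "endomorphism (?z \<theta>)" if \<theta>: "\<theta> \<in> characters U" for \<theta>
  proof -
    have "structure_matrix ground_algebra n \<tau> \<omega> (\<lambda>s i. \<theta> (x s i))"
      using \<theta> structure_matrix_hom[OF _ univ_algebra_commutative_algebra commutative_algebra_ground
          univ_gen_structure_matrix] by (simp add: characters_def)
    then show ?thesis
      using cong[of "\<lambda>s i. coord (?z \<theta> (e i)) s" "\<lambda>s i. \<theta> (x s i)"] coord_zeta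
      by (simp add: endomorphism_iff_structure_matrix[OF zeta(1)])
  qed
  moreover have "\<exists>\<theta>\<in>characters U. ?z \<theta> = f" if f: "endomorphism f" for f
  proof -
    have lf: "lin f" using f by (simp add: endomorphism_def)
    have "structure_matrix ground_algebra n \<tau> \<omega> (\<lambda>s i. coord (f (e i)) s)"
      using f endomorphism_iff_structure_matrix[OF lf] by blast
    then obtain \<theta> where \<theta>: "\<theta> \<in> characters U"
      "\<And>s i. s \<in> {1..n} \<Longrightarrow> i \<in> {1..n} \<Longrightarrow> \<theta> (x s i) = coord (f (e i)) s"
      using characters_exist by blast
    have "?z \<theta> (e i) = f (e i)" if "i \<in> {1..n}" for i
      by (rule coord_eqI) (simp only: coord_zeta \<theta>(2) that)
    then have "?z \<theta> v = f v" for v by (rule lin_eqI[OF zeta(1) lf])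
    then have "?z \<theta> = f" ..
    then show ?thesis using \<theta>(1) by blast
  qed
  moreover have "inj_on ?z (characters U)"
  proof (rule inj_onI)
    fix \<theta> \<eta> assume *: "\<theta> \<in> characters U" "\<eta> \<in> characters U" "?z \<theta> = ?z \<eta>"
    show "\<theta> = \<eta>"
      by (rule characters_eqI[OF *(1,2)]) (simp only: *(3) flip: coord_zeta)
  qed
  ultimately show ?thesis by (auto simp: bij_betw_def)
qed

lemma zeta_convolution:
  assumes "f \<in> characters U" "g \<in> characters U"
  shows "zeta scale br tr n e (convolution Bi f g) = zeta scale br tr n e f \<circ> zeta scale br tr n e g"
proof
  let ?z = "zeta scale br tr n e"
  have lc: "lin (\<lambda>v. ?z f (?z g v))"
    using linD[OF zeta(1)[of f]] linD[OF zeta(1)[of g]] by (simp add: lin_iff)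
  have "?z (convolution Bi f g) (e j) = ?z f (?z g (e j))" if j: "j \<in> {1..n}" for j
  proof (rule coord_eqI)
    fix i assume i: "i \<in> {1..n}"
    have "coord (?z f (?z g (e j))) i = (\<Sum>s=1..n. g (x s j) * f (x i s))"
      unfolding coord_lin[OF zeta(1)[of f], of "?z g (e j)"]
      using i j by (intro sum.cong) (simp_all only: coord_zeta)
    then show "coord (?z (convolution Bi f g) (e j)) i = coord (?z f (?z g (e j))) i"
      by (simp only: coord_zeta[OF i j] convolution_characters(2)[OF assms i j] mult.commute)
  qed
  then have "?z (convolution Bi f g) v = ?z f (?z g v)" for v
    by (rule lin_eqI[OF zeta(1) lc])
  then show "?z (convolution Bi f g) v = (?z f \<circ> ?z g) v" for v by simp
qed

lemma zeta_counit: "zeta scale br tr n e (univ_counit scale br tr n e) = id"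
proof
  let ?z = "zeta scale br tr n e"
  have lid: "lin (\<lambda>v. v)" by (simp add: lin_iff)
  have "?z (univ_counit scale br tr n e) (e j) = e j" if j: "j \<in> {1..n}" for j
    by (rule coord_eqI) (simp only: coord_zeta univ_counit(2) coord_basis j)
  then have "?z (univ_counit scale br tr n e) v = v" for v
    by (rule lin_eqI[OF zeta(1) lid])
  then show "?z (univ_counit scale br tr n e) v = id v" for v by simp
qed

text \<open>The monoid of endomorphisms, whose units are the automorphisms.\<close>

definition End_LYA :: "('v \<Rightarrow> 'v) monoid"
  where "End_LYA = \<lparr>carrier = {f. endomorphism f}, monoid.mult = (\<circ>), one = id\<rparr>"

lemma End_LYA_monoid: "monoid End_LYA"
  by (rule monoidI) (auto simp: End_LYA_def endomorphism_def lin_iff)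

lemma Aut_LYA_units: "Aut_LYA scale br tr = units_of End_LYA"
proof -
  have "f \<in> Units End_LYA \<longleftrightarrow> endomorphism f \<and> bij f" for f
  proof
    assume "f \<in> Units End_LYA"
    then show "endomorphism f \<and> bij f"
      by (auto simp: Units_def End_LYA_def intro: o_bij)
  next
    assume f: "endomorphism f \<and> bij f"
    then have *: "f (inv_into UNIV f v) = v" "inv_into UNIV f (f v) = v" for v
      by (simp_all add: bij_is_surj surj_f_inv_f bij_is_inj)
    have inj: "v = w" if "f v = f w" for v w using f that by (auto simp: bij_def inj_def)
    have fD: "f (v + w) = f v + f w" "f (scale c v) = scale c (f v)"
      "f (br v w) = br (f v) (f w)" "f (tr v w u) = tr (f v) (f w) (f u)" for v w u c
      using f by (auto simp: endomorphism_def lin_iff)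
    have "endomorphism (inv_into UNIV f)"
      unfolding endomorphism_def lin_iff by (intro conjI allI; rule inj; simp only: fD *)
    then show "f \<in> Units End_LYA"
      using f * by (auto simp: Units_def End_LYA_def fun_eq_iff intro!: exI[of _ "inv_into UNIV f"])
  qed
  then show ?thesis
    by (auto simp: Aut_LYA_def units_of_def End_LYA_def endomorphism_def)
qed

theorem zeta_iso:
  "group (units_of (grouplikes (finite_dual Bi))) \<and> group (Aut_LYA scale br tr) \<and>
    zeta scale br tr n e \<in> iso (units_of (grouplikes (finite_dual Bi))) (Aut_LYA scale br tr)"
proof -
  let ?G = "grouplikes (finite_dual Bi)" and ?z = "zeta scale br tr n e"
  interpret commutative_bialgebra Bi
    unfolding commutative_bialgebra_def univ_bialgebra_def
    by (rule commutative_algebra_extend[OF univ_algebra_commutative_algebra])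
  have G: "carrier ?G = characters U" "monoid.mult ?G = convolution Bi"
    "\<one>\<^bsub>?G\<^esub> = univ_counit scale br tr n e"
    using grouplikes_finite_dual finite_dual_one
    by (simp_all add: grouplikes_def finite_dual_def finite_dual_algebra_def)
  have E: "carrier End_LYA = {f. endomorphism f}" "monoid.mult End_LYA = (\<circ>)" "\<one>\<^bsub>End_LYA\<^esub> = id"
    by (simp_all add: End_LYA_def)
  have bij: "bij_betw ?z (carrier ?G) (carrier End_LYA)" unfolding G E by (rule zeta_bij)
  have mult: "?z (f \<otimes>\<^bsub>?G\<^esub> g) = ?z f \<otimes>\<^bsub>End_LYA\<^esub> ?z g" if "f \<in> carrier ?G" "g \<in> carrier ?G" for f g
    using that unfolding G E by (rule zeta_convolution)
  have one: "?z \<one>\<^bsub>?G\<^esub> = \<one>\<^bsub>End_LYA\<^esub>" unfolding G E by (rule zeta_counit)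
  have monoid: "monoid ?G"
    by (rule bij_monoid[where z = ?z and G = ?G and E = End_LYA, OF End_LYA_monoid bij _ _ one mult])
      (simp_all add: G convolution_characters(1) univ_counit(1))
  show ?thesis
    unfolding Aut_LYA_units
    by (intro conjI monoid.units_group[OF monoid] monoid.units_group[OF End_LYA_monoid]
        bij_units_iso[where z = ?z and G = ?G and E = End_LYA, OF monoid End_LYA_monoid bij one mult])
qed

end

theorem theorem5p1:
  fixes scale :: "'k::field_char_0 \<Rightarrow> 'v::ab_group_add \<Rightarrow> 'v"
    and br :: "'v \<Rightarrow> 'v \<Rightarrow> 'v" and tr :: "'v \<Rightarrow> 'v \<Rightarrow> 'v \<Rightarrow> 'v"
    and n :: nat and e :: "nat \<Rightarrow> 'v"
  assumes "lie_yamaguti_algebra scale br tr"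
    and "inj_on e {1..n}"
    and "\<not> Modules.module.dependent scale (e ` {1..n})"
    and "Modules.module.span scale (e ` {1..n}) = UNIV"
  shows "group (units_of (grouplikes (finite_dual (univ_bialgebra scale br tr n e)))) \<and>
    group (Aut_LYA scale br tr) \<and>
    zeta scale br tr n e \<in>
      iso (units_of (grouplikes (finite_dual (univ_bialgebra scale br tr n e)))) (Aut_LYA scale br tr)"
proof -
  interpret lie_yamaguti_basis scale br tr n e
    using assms by (simp add: lie_yamaguti_basis_def lie_yamaguti_basis_axioms_def)
  show ?thesis by (rule zeta_iso)
qed

end
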